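(* Let $u=p+\mathbf i q$ ($p,q$ real-valued) be the solution of the nonlinear Schrödinger equation with white noise dispersion $$\mathbf i\,du+\Delta u\circ dW(t)+|u|^{2\sigma}u\,dt=0\quad\text{in }\mathbb R_+\times\mathbb R .$$ Then its phase flow preserves the stochastic symplectic structure $\bar\omega(t):=\int_{\mathbb R}dp(t,x)\wedge dq(t,x)\,dx$; that is, for all $0\le t_0\le t_1$, $$\int_{\mathbb R}dp(t_1,x)\wedge dq(t_1,x)\,dx=\int_{\mathbb R}dp(t_0,x)\wedge dq(t_0,x)\,dx,\quad\text{a.s.}$$
   Context: $W$ is a one-dimensional real-valued Brownian motion on a stochastic basis $(\Omega,\mathscr F,(\mathscr F_t)_{t\ge0},\mathbb P)$, $\circ\,dW$ denotes the Stratonovich differential, $\mathbf i$ is the imaginary unit, and $\sigma\le2$ is a positive integer. The solution is the mild solution $u(t)=S(t,0)u_0+\mathbf i\int_0^tS(t,r)|u(r)|^{2\sigma}u(r)\,dr$ with $S(t,r)=\exp(\mathbf i(W(t)-W(r))\Delta)$ the unitary solution operator of $\mathbf i\,du+\Delta u\circ dW=0$; for $u_0\in H^s(\mathbb R)$ with $s\ge1$ it exists uniquely in $\mathcal C(\mathbb R_+;H^s)$. $d$ denotes the exterior differential on the phase space, i.e. differentiation of the solution with respect to the initial datum: $dp(t,x)$, $dq(t,x)$ evaluated on a variation of the initial datum give the real and imaginary parts of the corresponding variation (tangent solution) of $u$ at $(t,x)$, and $(dp\wedge dq)(\xi,\eta)=dp(\xi)\,dq(\eta)-dp(\eta)\,dq(\xi)$.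 The two-form is understood for solutions regular enough that these objects make sense. *)

theory Defs
  imports "HOL-Probability.Probability"
begin

section \<open>Stochastic basis and Brownian motion\<close>

locale stochastic_basis = prob_space M for M :: "'w measure" +
  fixes F :: "real \<Rightarrow> 'w measure"
  assumes subalgebra_filtration: "0 \<le> t \<Longrightarrow> subalgebra M (F t)"
    and filtration_mono: "0 \<le> r \<Longrightarrow> r \<le> t \<Longrightarrow> sets (F r) \<subseteq> sets (F t)"

locale brownian_motion = stochastic_basis M F for M :: "'w measure" and F +
  fixes W :: "real \<Rightarrow> 'w \<Rightarrow> real"
  assumes adapted: "0 \<le> t \<Longrightarrow> W t \<in> borel_measurable (F t)"
    and starts_at_0: "AE \<omega> in M. W 0 \<omega> = 0"
    and increments_normal: "0 \<le> r \<Longrightarrow> r < t \<Longrightarrow>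
      distributed M lborel (\<lambda>\<omega>. W t \<omega> - W r \<omega>) (normal_density 0 (sqrt (t - r)))"
    and increments_indep: "0 \<le> r \<Longrightarrow> r < t \<Longrightarrow>
      indep_set (sets (F r)) (sets (vimage_algebra (space M) (\<lambda>\<omega>. W t \<omega> - W r \<omega>) borel))"
    and continuous_paths: "AE \<omega> in M. continuous_on {0..} (\<lambda>t. W t \<omega>)"

section \<open>The space \<open>L\<^sup>2(\<real>; \<complex>)\<close>\<close>

definition square_integrable :: "(real \<Rightarrow> complex) \<Rightarrow> bool" where
  "square_integrable f \<longleftrightarrow>
     f \<in> borel_measurable lborel \<and> integrable lborel (\<lambda>x. (cmod (f x))\<^sup>2)"

definition L2_equiv :: "(real \<Rightarrow> complex) \<Rightarrow> (real \<Rightarrow> complex) \<Rightarrow> bool" where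
  "L2_equiv f g \<longleftrightarrow> square_integrable f \<and> square_integrable g \<and> (AE x in lborel. f x = g x)"

lemma square_integrable_0: "square_integrable (\<lambda>x. 0)"
  by (simp add: square_integrable_def)

lemma square_integrable_add:
  assumes "square_integrable f" "square_integrable g"
  shows "square_integrable (\<lambda>x. f x + g x)"
proof -
  have [measurable]: "f \<in> borel_measurable lborel" "g \<in> borel_measurable lborel"
    using assms by (auto simp: square_integrable_def)
  have i: "integrable lborel (\<lambda>x. 2 * (cmod (f x))\<^sup>2 + 2 * (cmod (g x))\<^sup>2)"
    using assms by (auto simp: square_integrable_def)
  have b: "(cmod (f x + g x))\<^sup>2 \<le> 2 * (cmod (f x))\<^sup>2 + 2 * (cmod (g x))\<^sup>2" for x
  proof -
    have "(cmod (f x + g x))\<^sup>2 \<le> (cmod (f x) + cmod (g x))\<^sup>2"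
      by (intro power_mono norm_triangle_ineq) auto
    also have "\<dots> \<le> 2 * (cmod (f x))\<^sup>2 + 2 * (cmod (g x))\<^sup>2"
      using sum_squares_bound[of "cmod (f x)" "cmod (g x)"] by (simp add: power2_sum)
    finally show ?thesis .
  qed
  have "integrable lborel (\<lambda>x. (cmod (f x + g x))\<^sup>2)"
    by (rule Bochner_Integration.integrable_bound[OF i]) (use b in \<open>auto intro!: AE_I2 order_trans[OF b]\<close>)
  then show ?thesis by (simp add: square_integrable_def)
qed

lemma square_integrable_mult:
  assumes "square_integrable f"
  shows "square_integrable (\<lambda>x. c * f x)"
  using assms by (auto simp: square_integrable_def norm_mult power_mult_distrib)

lemma square_integrable_scaleR:
  assumes "square_integrable f"
  shows "square_integrable (\<lambda>x. c *\<^sub>R f x)"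
  using square_integrable_mult[OF assms, of "of_real c"] by (simp add: scaleR_conv_of_real)

lemma square_integrable_inner:
  assumes "square_integrable f" "square_integrable g"
  shows "integrable lborel (\<lambda>x. f x \<bullet> g x)"
proof -
  have [measurable]: "f \<in> borel_measurable lborel" "g \<in> borel_measurable lborel"
    using assms by (auto simp: square_integrable_def)
  have i: "integrable lborel (\<lambda>x. (cmod (f x))\<^sup>2 + (cmod (g x))\<^sup>2)"
    using assms by (auto simp: square_integrable_def)
  have b: "\<bar>f x \<bullet> g x\<bar> \<le> (cmod (f x))\<^sup>2 + (cmod (g x))\<^sup>2" for x
  proof -
    have "\<bar>f x \<bullet> g x\<bar> \<le> cmod (f x) * cmod (g x)"
      by (rule Cauchy_Schwarz_ineq2)
    also have "\<dots> \<le> (cmod (f x))\<^sup>2 + (cmod (g x))\<^sup>2"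
      using sum_squares_bound[of "cmod (f x)" "cmod (g x)"]
        mult_nonneg_nonneg[OF norm_ge_zero[of "f x"] norm_ge_zero[of "g x"]] by linarith
    finally show ?thesis .
  qed
  show ?thesis
    by (rule Bochner_Integration.integrable_bound[OF i]) (use b in auto)
qed

quotient_type L2 = "real \<Rightarrow> complex" / partial: L2_equiv
  morphisms rep_L2 abs_L2
proof (rule part_equivpI)
  show "\<exists>f. L2_equiv f f"
    using square_integrable_0 by (auto simp: L2_equiv_def)
  show "symp L2_equiv"
    by (auto intro!: sympI simp: L2_equiv_def)
  show "transp L2_equiv"
    by (auto intro!: transpI simp: L2_equiv_def)
qed

instantiation L2 :: real_inner
begin

lift_definition zero_L2 :: L2 is "\<lambda>x. 0"
  by (simp add: L2_equiv_def square_integrable_0)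

lift_definition plus_L2 :: "L2 \<Rightarrow> L2 \<Rightarrow> L2" is "\<lambda>f g x. f x + g x"
  by (auto simp: L2_equiv_def square_integrable_add)

lift_definition scaleR_L2 :: "real \<Rightarrow> L2 \<Rightarrow> L2" is "\<lambda>c f x. c *\<^sub>R f x"
  by (auto simp: L2_equiv_def square_integrable_scaleR)

lift_definition uminus_L2 :: "L2 \<Rightarrow> L2" is "\<lambda>f x. - f x"
  using square_integrable_mult[where c = "-1"] by (auto simp: L2_equiv_def)

definition minus_L2 :: "L2 \<Rightarrow> L2 \<Rightarrow> L2" where
  "minus_L2 f g = f + - g"

text \<open>The inner product is the real one, \<open>Re (\<integral>f(x) cnj (g(x)) dx)\<close>.\<close>

lift_definition inner_L2 :: "L2 \<Rightarrow> L2 \<Rightarrow> real" is "\<lambda>f g. \<integral>x. f x \<bullet> g x \<partial>lborel"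
proof -
  fix f f' g g' assume *: "L2_equiv f f'" "L2_equiv g g'"
  then have [measurable]: "f \<in> borel_measurable lborel" "g \<in> borel_measurable lborel"
      "f' \<in> borel_measurable lborel" "g' \<in> borel_measurable lborel"
    by (auto simp: L2_equiv_def square_integrable_def)
  show "(\<integral>x. f x \<bullet> g x \<partial>lborel) = (\<integral>x. f' x \<bullet> g' x \<partial>lborel)"
    using * by (intro integral_cong_AE) (auto simp: L2_equiv_def)
qed

definition norm_L2 :: "L2 \<Rightarrow> real" where
  "norm_L2 f = sqrt (f \<bullet> f)"

definition sgn_L2 :: "L2 \<Rightarrow> L2" where
  "sgn_L2 f = inverse (norm f) *\<^sub>R f"

definition dist_L2 :: "L2 \<Rightarrow> L2 \<Rightarrow> real" where
  "dist_L2 f g = norm (f - g)"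

definition uniformity_L2 :: "(L2 \<times> L2) filter" where
  "uniformity_L2 = (INF e\<in>{0 <..}. principal {(x, y). dist x y < e})"

definition open_L2 :: "L2 set \<Rightarrow> bool" where
  "open_L2 S = (\<forall>x\<in>S. \<forall>\<^sub>F (x', y) in uniformity. x' = x \<longrightarrow> y \<in> S)"

instance
proof
  fix f g h :: L2 and a b :: real
  show "f + g + h = f + (g + h)"
    by transfer (auto simp: L2_equiv_def add.assoc intro!: square_integrable_add)
  show "f + g = g + f"
    by transfer (auto simp: L2_equiv_def add.commute intro!: square_integrable_add)
  show "0 + f = f"
    by transfer (auto simp: L2_equiv_def)
  show "- f + f = 0"
    by transfer (auto simp: L2_equiv_def square_integrable_0)
  show "f - g = f + - g"
    by (simp add: minus_L2_def)
  show "a *\<^sub>R (f + g) = a *\<^sub>R f + a *\<^sub>R g"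
    by transfer (auto simp: L2_equiv_def scaleR_add_right
        intro!: square_integrable_add square_integrable_scaleR)
  show "(a + b) *\<^sub>R f = a *\<^sub>R f + b *\<^sub>R f"
    by transfer (auto simp: L2_equiv_def scaleR_add_left
        intro!: square_integrable_add square_integrable_scaleR)
  show "a *\<^sub>R b *\<^sub>R f = (a * b) *\<^sub>R f"
    by transfer (auto simp: L2_equiv_def intro!: square_integrable_scaleR)
  show "1 *\<^sub>R f = f"
    by transfer (auto simp: L2_equiv_def)
  show "sgn f = inverse (norm f) *\<^sub>R f"
    by (rule sgn_L2_def)
  show "dist f g = norm (f - g)"
    by (rule dist_L2_def)
  show "(uniformity :: (L2 \<times> L2) filter) = (INF e\<in>{0 <..}. principal {(x, y). dist x y < e})"
    by (rule uniformity_L2_def)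
  show "open U = (\<forall>x\<in>U. \<forall>\<^sub>F (x', y) in uniformity. x' = x \<longrightarrow> y \<in> U)" for U :: "L2 set"
    by (rule open_L2_def)
  show "f \<bullet> g = g \<bullet> f"
    by transfer (simp add: inner_commute)
  show "(f + g) \<bullet> h = f \<bullet> h + g \<bullet> h"
    by transfer (auto simp: L2_equiv_def inner_add_left square_integrable_inner)
  show "a *\<^sub>R f \<bullet> g = a * (f \<bullet> g)"
    by transfer (simp add: L2_equiv_def)
  show "0 \<le> f \<bullet> f"
    by transfer simp
  show "(f \<bullet> f = 0) = (f = 0)"
  proof transfer
    fix f assume "L2_equiv f f"
    then have *: "square_integrable f" by (simp add: L2_equiv_def)
    show "((\<integral>x. f x \<bullet> f x \<partial>lborel) = 0) = L2_equiv f (\<lambda>x. 0)"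
      using * square_integrable_0 square_integrable_inner[OF * *]
      by (subst integral_nonneg_eq_0_iff_AE) (auto simp: L2_equiv_def)
  qed
  show "norm f = sqrt (f \<bullet> f)"
    by (rule norm_L2_def)
qed

end

definition pointwise_mult :: "(real \<Rightarrow> complex) \<Rightarrow> L2 \<Rightarrow> L2" where
  "pointwise_mult m f = abs_L2 (\<lambda>x. m x * rep_L2 f x)"

section \<open>Fourier transform, Sobolev spaces, and the unitary group\<close>

text \<open>Plancherel's transform on \<open>L\<^sup>2\<close>, normalised to be unitary: the \<open>L\<^sup>2\<close> limit, as
  \<open>R \<rightarrow> \<infinity>\<close>, of the Fourier integrals of \<open>f\<close> over \<open>[-R, R]\<close>.
  The extended nonnegative integral makes sense whether or not the difference is square integrable.\<close>

definition truncated_fourier :: "real \<Rightarrow> L2 \<Rightarrow> real \<Rightarrow> complex" where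
  "truncated_fourier R f \<xi> =
     1 / sqrt (2 * pi) * (LINT x:{-R..R}|lborel. exp (- \<i> * x * \<xi>) * rep_L2 f x)"

definition has_fourier :: "L2 \<Rightarrow> L2 \<Rightarrow> bool" where
  "has_fourier f g \<longleftrightarrow>
     ((\<lambda>R. \<integral>\<^sup>+\<xi>. ennreal ((cmod (truncated_fourier R f \<xi> - rep_L2 g \<xi>))\<^sup>2) \<partial>lborel) \<longlongrightarrow> 0) at_top"

definition fourier :: "L2 \<Rightarrow> L2" where
  "fourier f = (THE g. has_fourier f g)"

definition sobolev :: "real \<Rightarrow> L2 set" where
  "sobolev s = {f. integrable lborel
     (\<lambda>\<xi>. (1 + \<xi>\<^sup>2) powr s * (cmod (rep_L2 (fourier f) \<xi>))\<^sup>2)}"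

definition sobolev_norm :: "real \<Rightarrow> L2 \<Rightarrow> real" where
  "sobolev_norm s f =
     sqrt (\<integral>\<xi>. (1 + \<xi>\<^sup>2) powr s * (cmod (rep_L2 (fourier f) \<xi>))\<^sup>2 \<partial>lborel)"

text \<open>\<open>schroedinger_group \<tau>\<close> is \<open>exp (\<i> \<tau> \<Delta>)\<close>, the Fourier multiplier with symbol
  \<open>exp (- \<i> \<tau> \<xi>\<^sup>2)\<close>.\<close>

definition schroedinger_group :: "real \<Rightarrow> L2 \<Rightarrow> L2" where
  "schroedinger_group \<tau> f = inv fourier (pointwise_mult (\<lambda>\<xi>. exp (- \<i> * \<tau> * \<xi>\<^sup>2)) (fourier f))"

section \<open>Mild solutions and the phase flow\<close>

text \<open>\<open>|f|\<^bsup>2\<sigma>\<^esup> f\<close>; it is again in \<open>L\<^sup>2\<close> when \<open>f \<in> H\<^sup>s\<close> with \<open>s > 1/2\<close>,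
  and is used for such \<open>f\<close> only.\<close>

definition nonlinearity :: "nat \<Rightarrow> L2 \<Rightarrow> L2" where
  "nonlinearity \<sigma> f = abs_L2 (\<lambda>x. of_real (cmod (rep_L2 f x) ^ (2 * \<sigma>)) * rep_L2 f x)"

text \<open>Membership in \<open>C(\<real>\<^sub>+; H\<^sup>s)\<close>; values at negative times are irrelevant.\<close>

definition sobolev_path :: "real \<Rightarrow> (real \<Rightarrow> L2) \<Rightarrow> bool" where
  "sobolev_path s u \<longleftrightarrow> (\<forall>t\<ge>0. u t \<in> sobolev s) \<and>
     (\<forall>t\<ge>0. ((\<lambda>r. sobolev_norm s (u r - u t)) \<longlongrightarrow> 0) (at t within {0..}))"

text \<open>\<open>mild_solution \<sigma> s w u\<^sub>0 u\<close>: along the driving path \<open>w\<close>, the function \<open>u\<close> is the mild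
  solution in \<open>C(\<real>\<^sub>+; H\<^sup>s)\<close> with \<open>S(t,r) = exp (\<i> (w(t) - w(r)) \<Delta>)\<close>. The time integral is
  \<open>L\<^sup>2\<close>-valued; for continuous \<open>w\<close> its integrand is continuous in \<open>r\<close>.\<close>

definition mild_solution ::
    "nat \<Rightarrow> real \<Rightarrow> (real \<Rightarrow> real) \<Rightarrow> L2 \<Rightarrow> (real \<Rightarrow> L2) \<Rightarrow> bool" where
  "mild_solution \<sigma> s w u\<^sub>0 u \<longleftrightarrow> sobolev_path s u \<and>
     (\<forall>t\<ge>0. \<exists>I. ((\<lambda>r. schroedinger_group (w t - w r) (nonlinearity \<sigma> (u r))) has_integral I) {0..t} \<and>
        u t = schroedinger_group (w t - w 0) u\<^sub>0 + pointwise_mult (\<lambda>x. \<i>) I)"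

text \<open>A random phase flow on \<open>H\<^sup>s\<close>: \<open>\<Phi> \<omega> u\<^sub>0 t\<close> is the value at time \<open>t\<close>, for the outcome
  \<open>\<omega>\<close>, of the solution with initial datum \<open>u\<^sub>0\<close>. The equation is solved path by path, so the
  exceptional null set does not depend on \<open>u\<^sub>0\<close>.\<close>

definition solution_flow ::
    "'w measure \<Rightarrow> (real \<Rightarrow> 'w \<Rightarrow> real) \<Rightarrow> nat \<Rightarrow> real \<Rightarrow> ('w \<Rightarrow> L2 \<Rightarrow> real \<Rightarrow> L2) \<Rightarrow> bool" where
  "solution_flow M W \<sigma> s \<Phi> \<longleftrightarrow>
     (AE \<omega> in M. \<forall>u\<^sub>0\<in>sobolev s. mild_solution \<sigma> s (\<lambda>t. W t \<omega>) u\<^sub>0 (\<Phi> \<omega> u\<^sub>0))"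

section \<open>Differentials with respect to the initial datum\<close>

text \<open>\<open>D \<xi>\<close> is the derivative at \<open>u\<^sub>0\<close>, in the direction \<open>\<xi>\<close>, of the solution map
  \<open>\<phi> : H\<^sup>s \<rightarrow> C(\<real>\<^sub>+; H\<^sup>s)\<close>, whose target carries the topology of locally uniform convergence.\<close>

definition flow_differential ::
    "real \<Rightarrow> (L2 \<Rightarrow> real \<Rightarrow> L2) \<Rightarrow> L2 \<Rightarrow> (L2 \<Rightarrow> real \<Rightarrow> L2) \<Rightarrow> bool" where
  "flow_differential s \<phi> u\<^sub>0 D \<longleftrightarrow> (\<forall>\<xi>\<in>sobolev s. (\<forall>t\<ge>0. D \<xi> t \<in> sobolev s) \<and>
     (\<forall>T\<ge>0. uniform_limit {0..T}
        (\<lambda>h t. sobolev_norm s ((1 / h) *\<^sub>R (\<phi> (u\<^sub>0 + h *\<^sub>R \<xi>) t - \<phi> u\<^sub>0 t) - D \<xi> t)) (\<lambda>t. 0) (at 0)))"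

text \<open>The one-forms \<open>dp(t,x)\<close> and \<open>dq(t,x)\<close> are real and imaginary part of the tangent solution.\<close>

definition dp :: "(L2 \<Rightarrow> real \<Rightarrow> L2) \<Rightarrow> real \<Rightarrow> real \<Rightarrow> L2 \<Rightarrow> real" where
  "dp D t x \<xi> = Re (rep_L2 (D \<xi> t) x)"

definition dq :: "(L2 \<Rightarrow> real \<Rightarrow> L2) \<Rightarrow> real \<Rightarrow> real \<Rightarrow> L2 \<Rightarrow> real" where
  "dq D t x \<xi> = Im (rep_L2 (D \<xi> t) x)"

definition wedge :: "('a \<Rightarrow> real) \<Rightarrow> ('a \<Rightarrow> real) \<Rightarrow> 'a \<Rightarrow> 'a \<Rightarrow> real" where
  "wedge \<alpha> \<beta> \<xi> \<eta> = \<alpha> \<xi> * \<beta> \<eta> - \<alpha> \<eta> * \<beta> \<xi>"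

definition symplectic_structure :: "(L2 \<Rightarrow> real \<Rightarrow> L2) \<Rightarrow> real \<Rightarrow> L2 \<Rightarrow> L2 \<Rightarrow> real" where
  "symplectic_structure D t \<xi> \<eta> = (\<integral>x. wedge (dp D t x) (dq D t x) \<xi> \<eta> \<partial>lborel)"

end

theory Submission
  imports Defs
begin

text \<open>Write \<open>\<langle>f, g\<rangle>\<close> for the real \<open>L\<^sup>2\<close> product, so that the symplectic form is \<open>\<langle>\<i> f, g\<rangle>\<close>. For fixed \<open>\<omega>\<close>, let
  \<open>a\<close> and \<open>b\<close> be the increments of the solution under the perturbations \<open>h \<xi>\<close> and \<open>h \<eta>\<close> of the initial datum.
  After pulling back by the unitary group \<open>S\<close>, which preserves \<open>\<langle>\<i> \<cdot>, \<cdot>\<rangle>\<close>, the time derivative of \<open>\<langle>\<i> a, b\<rangle>\<close>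
  is \<open>\<langle>a, N(u + b) - N(u)\<rangle> - \<langle>N(u + a) - N(u), b\<rangle>\<close>. The nonlinearity \<open>N\<close> is a gradient, hence has symmetric
  derivative, so this is \<open>O(|h|\<^sup>3)\<close> uniformly on bounded time intervals by the embedding
  \<open>H\<^sup>s \<subseteq> L\<^sup>\<infinity>\<close>; dividing by \<open>h\<^sup>2\<close> and letting \<open>h \<rightarrow> 0\<close> gives the claim. This needs Plancherel's theorem,
  which makes \<open>S\<close> unitary and yields the embedding.\<close>

section \<open>Completeness of \<open>L\<^sup>2\<close>\<close>

text \<open>The derivative \<open>D\<close> is given only as a limit of difference quotients. A
  tangent equation for it would require differentiating the mild equation under its time integral.
  Increments of true solutions avoid this: each is a difference of two mild solutions, so its
  integral equation is at hand, and only the final limit mentions \<open>D\<close>. The price is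
  that the symmetry of the linearised nonlinearity holds up to a remainder, which has to be cubic in
  h: two factors are lost to the normalisation and one must survive. Of the three small factors, two
  are measured in the \<open>L2\<close> norm and the third in the sup norm, which is where the
  Sobolev embedding enters. The time derivative is formal too. The time integral is a gauge
  integral, and continuity of its integrand, which would give a derivative at every time, is never
  established; the product rule is replaced by increment bounds on ever finer subdivisions. The
  time-uniform convergence in \<open>flow_differential\<close> makes the increments of order h on
  the whole interval.\<close>

lemma square_integrable_measurable [measurable_dest]:
  "square_integrable f \<Longrightarrow> f \<in> borel_measurable lborel"
  by (simp add: square_integrable_def)

lemma square_integrable_cong_AE:
  assumes "square_integrable f" "g \<in> borel_measurable lborel" "AE x in lborel. f x = g x"
  shows "square_integrable g"
proof -
  have [measurable]: "f \<in> borel_measurable lborel" "g \<in> borel_measurable lborel"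
    using assms by (auto simp: square_integrable_def)
  have "integrable lborel (\<lambda>x. (cmod (f x))\<^sup>2) \<longleftrightarrow> integrable lborel (\<lambda>x. (cmod (g x))\<^sup>2)"
    using assms(3) by (intro integrable_cong_AE) auto
  then show ?thesis using assms by (simp add: square_integrable_def)
qed

lemma square_integrable_bound:
  assumes "square_integrable f" "g \<in> borel_measurable lborel"
    "AE x in lborel. cmod (g x) \<le> K * cmod (f x)"
  shows "square_integrable g"
proof -
  have [measurable]: "f \<in> borel_measurable lborel" "g \<in> borel_measurable lborel"
    using assms by (auto simp: square_integrable_def)
  have "integrable lborel (\<lambda>x. K\<^sup>2 * (cmod (f x))\<^sup>2)"
    using assms(1) by (simp add: square_integrable_def)
  then have "integrable lborel (\<lambda>x. (cmod (g x))\<^sup>2)"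
    by (rule Bochner_Integration.integrable_bound)
       (use assms(3) in \<open>auto simp: power_mult_distrib[symmetric] intro!: power_mono\<close>)
  then show ?thesis using assms by (simp add: square_integrable_def)
qed

lemma square_integrable_iff_nn_integral:
  assumes [measurable]: "f \<in> borel_measurable lborel"
  shows "square_integrable f \<longleftrightarrow> (\<integral>\<^sup>+x. ennreal ((cmod (f x))\<^sup>2) \<partial>lborel) < \<infinity>"
  by (simp add: square_integrable_def integrable_iff_bounded)

lemma square_integrable_rep_L2 [simp]: "square_integrable (rep_L2 f)"
  using Quotient_rep_reflp[OF Quotient_L2] by (simp add: L2_equiv_def)

lemma borel_measurable_rep_L2 [measurable, simp]: "rep_L2 f \<in> borel_measurable borel"
  using square_integrable_rep_L2[of f] by (simp add: square_integrable_def)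

text \<open>The representative chosen by \<open>rep_L2\<close> is fixed but arbitrary, so operations
  on classes are visible on representatives only almost everywhere; most pointwise arguments below
  therefore run under \<open>AE\<close>.\<close>

lemma rep_abs_L2:
  assumes "square_integrable f"
  shows "AE x in lborel. rep_L2 (abs_L2 f) x = f x"
  using Quotient_rep_abs[OF Quotient_L2, of f] assms by (auto simp: L2_equiv_def)

lemma abs_L2_eq_iff:
  assumes "square_integrable f" "square_integrable g"
  shows "abs_L2 f = abs_L2 g \<longleftrightarrow> (AE x in lborel. f x = g x)"
  using Quotient_rel[OF Quotient_L2, of f g] assms by (auto simp: L2_equiv_def)

lemma abs_rep_L2 [simp]: "abs_L2 (rep_L2 f) = f"
  using Quotient_abs_rep[OF Quotient_L2] .

lemma L2_eqI: "(AE x in lborel. rep_L2 f x = rep_L2 g x) \<Longrightarrow> f = g"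
  using abs_L2_eq_iff[of "rep_L2 f" "rep_L2 g"] by simp

lemma abs_L2_eqI:
  assumes "square_integrable f" "AE x in lborel. f x = rep_L2 g x"
  shows "abs_L2 f = g"
  using abs_L2_eq_iff[of f "rep_L2 g"] assms by simp

lemma rep_L2_add: "AE x in lborel. rep_L2 (f + g) x = rep_L2 f x + rep_L2 g x"
  unfolding plus_L2_def map_fun_def comp_def by (intro rep_abs_L2 square_integrable_add) auto

lemma rep_L2_scaleR: "AE x in lborel. rep_L2 (c *\<^sub>R f) x = c *\<^sub>R rep_L2 f x"
  unfolding scaleR_L2_def map_fun_def comp_def id_def
  by (intro rep_abs_L2 square_integrable_scaleR) auto

lemma rep_L2_minus: "AE x in lborel. rep_L2 (f - g) x = rep_L2 f x - rep_L2 g x"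
proof -
  have "AE x in lborel. rep_L2 (f + (-1) *\<^sub>R g) x = rep_L2 f x - rep_L2 g x"
    using rep_L2_add[of f "(-1) *\<^sub>R g"] rep_L2_scaleR[of "-1" g]
    by eventually_elim simp
  then show ?thesis by simp
qed

lemma square_integrable_diff:
  assumes "square_integrable f" "square_integrable g"
  shows "square_integrable (\<lambda>x. f x - g x)"
  using square_integrable_add[OF assms(1) square_integrable_mult[OF assms(2), of "-1"]] by simp

lemma abs_L2_add:
  assumes "square_integrable f" "square_integrable g"
  shows "abs_L2 f + abs_L2 g = abs_L2 (\<lambda>x. f x + g x)"
proof (intro abs_L2_eqI[symmetric] square_integrable_add assms)
  show "AE x in lborel. f x + g x = rep_L2 (abs_L2 f + abs_L2 g) x"
    using rep_L2_add[of "abs_L2 f" "abs_L2 g"] rep_abs_L2[OF assms(1)] rep_abs_L2[OF assms(2)]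
    by eventually_elim simp
qed

lemma abs_L2_diff:
  assumes "square_integrable f" "square_integrable g"
  shows "abs_L2 f - abs_L2 g = abs_L2 (\<lambda>x. f x - g x)"
proof (intro abs_L2_eqI[symmetric] square_integrable_diff assms)
  show "AE x in lborel. f x - g x = rep_L2 (abs_L2 f - abs_L2 g) x"
    using rep_L2_minus[of "abs_L2 f" "abs_L2 g"] rep_abs_L2[OF assms(1)] rep_abs_L2[OF assms(2)]
    by eventually_elim simp
qed

lemma inner_L2_rep: "inner f g = (\<integral>x. rep_L2 f x \<bullet> rep_L2 g x \<partial>lborel)"
  by (simp add: inner_L2_def map_fun_def)

lemma inner_abs_L2:
  assumes "square_integrable f" "square_integrable g"
  shows "inner (abs_L2 f) (abs_L2 g) = (\<integral>x. f x \<bullet> g x \<partial>lborel)"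
proof -
  note [measurable] = assms
  show ?thesis
    unfolding inner_L2_rep
  proof (rule integral_cong_AE)
    show "AE x in lborel. rep_L2 (abs_L2 f) x \<bullet> rep_L2 (abs_L2 g) x = f x \<bullet> g x"
      using rep_abs_L2[OF assms(1)] rep_abs_L2[OF assms(2)] by eventually_elim simp
  qed measurable
qed

lemma norm_abs_L2_sq:
  assumes "square_integrable f"
  shows "(norm (abs_L2 f))\<^sup>2 = (\<integral>x. (cmod (f x))\<^sup>2 \<partial>lborel)"
  using inner_abs_L2[OF assms assms] by (simp add: power2_norm_eq_inner)

lemma norm_L2_sq: "(norm f)\<^sup>2 = (\<integral>x. (cmod (rep_L2 f x))\<^sup>2 \<partial>lborel)"
  using norm_abs_L2_sq[of "rep_L2 f"] by simp

lemma nn_norm_abs_L2_sq: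
  assumes "square_integrable f"
  shows "(\<integral>\<^sup>+x. ennreal ((cmod (f x))\<^sup>2) \<partial>lborel) = ennreal ((norm (abs_L2 f))\<^sup>2)"
  using assms unfolding norm_abs_L2_sq[OF assms] square_integrable_def
  by (intro nn_integral_eq_integral) auto

lemma integrable_cmod_mult:
  assumes "square_integrable f" "square_integrable g"
  shows "integrable lborel (\<lambda>x. cmod (f x) * cmod (g x))"
proof -
  have "square_integrable (\<lambda>x. of_real (cmod (f x)))" "square_integrable (\<lambda>x. of_real (cmod (g x)))"
    using assms by (auto simp: square_integrable_def)
  from square_integrable_inner[OF this] show ?thesis by (simp add: inner_complex_def)
qed

text \<open>Replacing both functions by their moduli keeps the norms and turns the integral into an
  inner product, so Cauchy-Schwarz for \<open>L2\<close> applies.\<close>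

lemma integral_cmod_mult_le:
  assumes "square_integrable f" "square_integrable g"
  shows "(\<integral>x. cmod (f x) * cmod (g x) \<partial>lborel) \<le> norm (abs_L2 f) * norm (abs_L2 g)"
proof -
  have si: "square_integrable (\<lambda>x. of_real (cmod (f x)))" "square_integrable (\<lambda>x. of_real (cmod (g x)))"
    using assms by (auto simp: square_integrable_def)
  have n: "norm (abs_L2 (\<lambda>x. of_real (cmod (f x)))) = norm (abs_L2 f)"
    if "square_integrable f" "square_integrable (\<lambda>x. of_real (cmod (f x)))" for f
    using norm_abs_L2_sq[OF that(1)] norm_abs_L2_sq[OF that(2)]
    by (intro power2_eq_imp_eq[OF _ norm_ge_zero norm_ge_zero]) simp
  have "(\<integral>x. cmod (f x) * cmod (g x) \<partial>lborel)
      = inner (abs_L2 (\<lambda>x. of_real (cmod (f x)))) (abs_L2 (\<lambda>x. of_real (cmod (g x))))"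
    by (subst inner_abs_L2[OF si]) (simp add: inner_complex_def)
  also have "\<dots> \<le> norm (abs_L2 f) * norm (abs_L2 g)"
    using norm_cauchy_schwarz n[OF assms(1) si(1)] n[OF assms(2) si(2)] by metis
  finally show ?thesis .
qed

text \<open>The weight makes an \<open>L\<^sup>2\<close> Cauchy sequence Cauchy in \<open>L\<^sup>1\<close>, where almost everywhere convergent
  subsequences are available; Fatou's lemma then identifies the \<open>L\<^sup>2\<close> limit.\<close>

instance L2 :: complete_space
proof
  fix X :: "nat \<Rightarrow> L2" assume C: "Cauchy X"
  \<comment> \<open>The weight is square integrable, so the products \<open>s n\<close> are
    integrable; it vanishes nowhere, so it can be divided out again once \<open>s (r i) x\<close>
    converges.\<close>
  define w :: "real \<Rightarrow> complex" where "w x = of_real (std_normal_density x)" for x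
  have wpos: "cmod (w x) > 0" for x by (simp add: w_def std_normal_density_def)
  have w1: "std_normal_density x \<le> 1" for x
  proof -
    have "1 \<le> sqrt (2 * pi)" using pi_gt3 by (simp add: real_le_rsqrt)
    moreover have "exp (- x\<^sup>2 / 2) \<le> 1" by simp
    ultimately have "exp (- x\<^sup>2 / 2) \<le> sqrt (2 * pi)" by linarith
    then show ?thesis unfolding std_normal_density_def by (simp add: field_simps)
  qed
  have si: "square_integrable w"
  proof -
    have "integrable lborel (\<lambda>x. (std_normal_density x)\<^sup>2)"
      by (rule Bochner_Integration.integrable_bound[OF integrable_normal_density[of 1 0]])
         (use w1 in \<open>auto simp: power2_eq_square intro!: mult_left_le\<close>)
    then show ?thesis by (simp add: square_integrable_def w_def[abs_def])
  qed
  define s where "s n x = w x * rep_L2 (X n) x" for n x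
  have [measurable]: "w \<in> borel_measurable borel" by (simp add: w_def[abs_def])
  have [measurable]: "s n \<in> borel_measurable borel" for n by (simp add: s_def[abs_def])
  have si_s: "integrable lborel (s n)" for n
    using integrable_cmod_mult[OF si square_integrable_rep_L2[of "X n"]]
    by (subst integrable_norm_iff[symmetric]) (auto simp: s_def norm_mult w_def)
  have L1: "(LINT x|lborel. norm (s i x - s j x)) \<le> norm (abs_L2 w) * norm (X i - X j)" for i j
  proof -
    have "(LINT x|lborel. norm (s i x - s j x))
       = (\<integral>x. cmod (w x) * cmod (rep_L2 (X i - X j) x) \<partial>lborel)"
    proof (rule integral_cong_AE)
      show "AE x in lborel. norm (s i x - s j x) = cmod (w x) * cmod (rep_L2 (X i - X j) x)"
        using rep_L2_minus[of "X i" "X j"]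
        by eventually_elim (simp add: s_def norm_mult flip: right_diff_distrib)
    qed measurable
    also have "\<dots> \<le> norm (abs_L2 w) * norm (X i - X j)"
      using integral_cmod_mult_le[OF si square_integrable_rep_L2[of "X i - X j"]] by simp
    finally show ?thesis .
  qed
  have "\<exists>N. \<forall>i\<ge>N. \<forall>j\<ge>N. (LINT x|lborel. norm (s i x - s j x)) < e" if "e > 0" for e
  proof -
    have "0 < e / (norm (abs_L2 w) + 1)" using that by (simp add: add_nonneg_pos)
    with C obtain N where N: "\<And>i j. i \<ge> N \<Longrightarrow> j \<ge> N \<Longrightarrow> norm (X i - X j) < e / (norm (abs_L2 w) + 1)"
      unfolding Cauchy_def dist_norm by blast
    have "(LINT x|lborel. norm (s i x - s j x)) < e" if "i \<ge> N" "j \<ge> N" for i j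
    proof -
      have "norm (abs_L2 w) * norm (X i - X j) \<le> (norm (abs_L2 w) + 1) * norm (X i - X j)"
        by (simp add: distrib_right)
      also have "\<dots> < e" using N[OF that] by (simp add: pos_less_divide_eq add_nonneg_pos mult.commute)
      finally show ?thesis using L1[of i j] by linarith
    qed
    then show ?thesis by blast
  qed
  then obtain r :: "nat \<Rightarrow> nat" where r: "strict_mono r" "AE x in lborel. Cauchy (\<lambda>i. s (r i) x)"
    using cauchy_L1_AE_cauchy_subseq[of lborel s] si_s by blast
  define f where "f x = lim (\<lambda>i. rep_L2 (X (r i)) x)" for x
  have [measurable]: "f \<in> borel_measurable lborel"
    unfolding f_def by measurable
  have conv: "AE x in lborel. (\<lambda>i. rep_L2 (X (r i)) x) \<longlonglongrightarrow> f x"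
    using r(2)
  proof eventually_elim
    fix x assume "Cauchy (\<lambda>i. s (r i) x)"
    then have "convergent (\<lambda>i. s (r i) x)" by (rule Cauchy_convergent)
    then obtain l where "(\<lambda>i. s (r i) x) \<longlonglongrightarrow> l" by (auto simp: convergent_def)
    then have "(\<lambda>i. s (r i) x / w x) \<longlonglongrightarrow> l / w x"
      using wpos[of x] by (intro tendsto_intros) auto
    then have "(\<lambda>i. rep_L2 (X (r i)) x) \<longlonglongrightarrow> l / w x"
      using wpos[of x] by (simp add: s_def)
    then show "(\<lambda>i. rep_L2 (X (r i)) x) \<longlonglongrightarrow> f x"
      unfolding f_def by (simp add: limI)
  qed
  have fatou: "(\<integral>\<^sup>+x. ennreal ((cmod (f x - rep_L2 (X n) x))\<^sup>2) \<partial>lborel) \<le> ennreal (e\<^sup>2)"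
    if e: "e > 0" and n: "\<And>i. i \<ge> n \<Longrightarrow> norm (X i - X n) \<le> e" for n e
  proof -
    have "(\<integral>\<^sup>+x. ennreal ((cmod (f x - rep_L2 (X n) x))\<^sup>2) \<partial>lborel)
       = (\<integral>\<^sup>+x. liminf (\<lambda>i. ennreal ((cmod (rep_L2 (X (r i)) x - rep_L2 (X n) x))\<^sup>2)) \<partial>lborel)"
    proof (rule nn_integral_cong_AE, use conv in eventually_elim)
      fix x assume "(\<lambda>i. rep_L2 (X (r i)) x) \<longlonglongrightarrow> f x"
      then have "(\<lambda>i. ennreal ((cmod (rep_L2 (X (r i)) x - rep_L2 (X n) x))\<^sup>2))
         \<longlonglongrightarrow> ennreal ((cmod (f x - rep_L2 (X n) x))\<^sup>2)"
        by (intro tendsto_intros)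
      then show "ennreal ((cmod (f x - rep_L2 (X n) x))\<^sup>2)
         = liminf (\<lambda>i. ennreal ((cmod (rep_L2 (X (r i)) x - rep_L2 (X n) x))\<^sup>2))"
        using lim_imp_Liminf trivial_limit_sequentially by metis
    qed
    also have "\<dots> \<le> liminf (\<lambda>i. \<integral>\<^sup>+x. ennreal ((cmod (rep_L2 (X (r i)) x - rep_L2 (X n) x))\<^sup>2) \<partial>lborel)"
      by (rule nn_integral_liminf) measurable
    also have "\<dots> = liminf (\<lambda>i. ennreal ((norm (X (r i) - X n))\<^sup>2))"
      by (subst nn_norm_abs_L2_sq) (auto simp flip: abs_L2_diff intro!: square_integrable_diff)
    also have "\<dots> \<le> ennreal (e\<^sup>2)"
    proof (rule Liminf_le)
      show "\<forall>\<^sub>F i in sequentially. ennreal ((norm (X (r i) - X n))\<^sup>2) \<le> ennreal (e\<^sup>2)"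
        using eventually_ge_at_top[of n]
        by eventually_elim
          (use n seq_suble[OF r(1)] in \<open>auto intro!: ennreal_leI power_mono intro: order_trans\<close>)
    qed simp
    finally show ?thesis .
  qed
  have ex: "\<exists>n. \<forall>i\<ge>n. \<forall>j\<ge>n. norm (X i - X j) \<le> e" if "e > 0" for e
    using C that unfolding Cauchy_def dist_norm by (meson less_imp_le)
  \<comment> \<open>A single distance bound, here 1, already puts \<open>f\<close> into the space:
    \<open>f\<close> is the sum of \<open>f - X n\<close> and \<open>X n\<close>. Smaller bounds
    then give the convergence.\<close>
  from ex[of 1] obtain n where "\<forall>i\<ge>n. norm (X i - X n) \<le> 1" by auto
  with fatou[of 1 n] have "square_integrable (\<lambda>x. f x - rep_L2 (X n) x)"
    by (subst square_integrable_iff_nn_integral) (auto simp: ennreal_one_less_top elim: order_le_less_trans)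
  from square_integrable_add[OF this square_integrable_rep_L2[of "X n"]]
  have sf: "square_integrable f" by simp
  have "X \<longlonglongrightarrow> abs_L2 f"
  proof (rule metric_LIMSEQ_I)
    fix e :: real assume e: "e > 0"
    then obtain N where N: "\<forall>i\<ge>N. \<forall>j\<ge>N. norm (X i - X j) \<le> e / 2" using ex[of "e/2"] by auto
    have "dist (X n) (abs_L2 f) < e" if "n \<ge> N" for n
    proof -
      have "ennreal ((norm (abs_L2 f - X n))\<^sup>2) \<le> ennreal ((e / 2)\<^sup>2)"
        using fatou[of "e/2" n] N that e
          nn_norm_abs_L2_sq[OF square_integrable_diff[OF sf square_integrable_rep_L2[of "X n"]]]
        by (simp add: abs_L2_diff[OF sf square_integrable_rep_L2, symmetric])
      then have "norm (abs_L2 f - X n) \<le> e / 2"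
        using e by (simp add: abs_le_square_iff[symmetric])
      then show ?thesis using e by (simp add: dist_norm norm_minus_commute)
    qed
    then show "\<exists>N. \<forall>n\<ge>N. dist (X n) (abs_L2 f) < e" by blast
  qed
  then show "convergent X" by (auto simp: convergent_def)
qed

instance L2 :: banach ..

section \<open>Plancherel's theorem\<close>

definition fourier_integral :: "(real \<Rightarrow> complex) \<Rightarrow> real \<Rightarrow> complex" where
  "fourier_integral f \<xi> = of_real (1 / sqrt (2 * pi)) * (\<integral>x. exp (- \<i> * x * \<xi>) * f x \<partial>lborel)"

lemma cmod_exp_imaginary [simp]: "cmod (exp (- (\<i> * complex_of_real x * complex_of_real y))) = 1"
  by (metis complex_i_mult_minus minus_mult_left mult.assoc norm_exp_i_times of_real_minus of_real_mult mult_minus_left)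

lemma integrable_exp_imaginary_mult:
  "integrable lborel f \<Longrightarrow> integrable lborel (\<lambda>x. exp (- \<i> * complex_of_real x * complex_of_real \<xi>) * f x)"
  by (frule borel_measurable_integrable, erule Bochner_Integration.integrable_bound) (auto simp: norm_mult)

lemma measurable_fourier_integral [measurable]:
  assumes [measurable]: "f \<in> borel_measurable borel"
  shows "fourier_integral f \<in> borel_measurable borel"
  unfolding fourier_integral_def by measurable

lemma cmod_fourier_integral_le:
  assumes "integrable lborel f"
  shows "cmod (fourier_integral f \<xi>) \<le> 1 / sqrt (2 * pi) * (\<integral>x. cmod (f x) \<partial>lborel)"
proof -
  have "cmod (\<integral>x. exp (- \<i> * x * \<xi>) * f x \<partial>lborel) \<le> (\<integral>x. cmod (exp (- \<i> * x * \<xi>) * f x) \<partial>lborel)"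
    by (rule integral_norm_bound)
  then show ?thesis
    by (auto simp: fourier_integral_def norm_mult norm_divide divide_right_mono)
qed

lemma fourier_integral_diff:
  assumes "integrable lborel f" "integrable lborel g"
  shows "fourier_integral (\<lambda>x. f x - g x) \<xi> = fourier_integral f \<xi> - fourier_integral g \<xi>"
  using integrable_exp_imaginary_mult[OF assms(1), of \<xi>] integrable_exp_imaginary_mult[OF assms(2), of \<xi>]
  by (simp add: fourier_integral_def right_diff_distrib diff_divide_distrib)

lemma fourier_integral_add:
  assumes "integrable lborel f" "integrable lborel g"
  shows "fourier_integral (\<lambda>x. f x + g x) \<xi> = fourier_integral f \<xi> + fourier_integral g \<xi>"
  using integrable_exp_imaginary_mult[OF assms(1), of \<xi>] integrable_exp_imaginary_mult[OF assms(2), of \<xi>]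
  by (simp add: fourier_integral_def distrib_left add_divide_distrib)

lemma fourier_integral_cmult:
  "fourier_integral (\<lambda>x. c * f x) \<xi> = c * fourier_integral f \<xi>"
proof -
  have "(\<lambda>x. exp (- \<i> * x * \<xi>) * (c * f x)) = (\<lambda>x. c * (exp (- \<i> * x * \<xi>) * f x))"
    by (simp add: mult_ac)
  then show ?thesis by (simp add: fourier_integral_def)
qed

text \<open>The kernel is symmetric in \<open>x\<close> and \<open>\<xi>\<close>, so this is Fubini
  for an absolutely integrable function. Both Parseval's identity and the adjoint of the transform
  rest on it.\<close>

lemma fourier_integral_multiplication:
  assumes f: "integrable lborel f" and g: "integrable lborel g"
  shows "(\<integral>\<xi>. fourier_integral f \<xi> * g \<xi> \<partial>lborel) = (\<integral>x. f x * fourier_integral g x \<partial>lborel)"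
proof -
  have [measurable]: "f \<in> borel_measurable borel" "g \<in> borel_measurable borel"
    using f g by auto
  let ?k = "\<lambda>x \<xi>. exp (- \<i> * complex_of_real x * complex_of_real \<xi>) * f x * g \<xi>"
  have "integrable (lborel \<Otimes>\<^sub>M lborel) (\<lambda>(x, \<xi>). ?k x \<xi>)"
  proof (rule lborel_pair.Fubini_integrable)
    have "(\<lambda>x. \<integral>y. norm (case (x, y) of (x, \<xi>) \<Rightarrow> ?k x \<xi>) \<partial>lborel)
       = (\<lambda>x. cmod (f x) * (\<integral>y. cmod (g y) \<partial>lborel))"
      by (simp add: norm_mult)
    then show "integrable lborel (\<lambda>x. \<integral>y. norm (case (x, y) of (x, \<xi>) \<Rightarrow> ?k x \<xi>) \<partial>lborel)"
      using f by simp
    show "AE x in lborel. integrable lborel (\<lambda>y. case (x, y) of (x, \<xi>) \<Rightarrow> ?k x \<xi>)"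
    proof (rule AE_I2)
      fix x :: real
      have "integrable lborel (\<lambda>y. cmod (f x) * cmod (g y))" using g by simp
      then show "integrable lborel (\<lambda>y. case (x, y) of (x, \<xi>) \<Rightarrow> ?k x \<xi>)"
        by (rule Bochner_Integration.integrable_bound) (auto simp: norm_mult)
    qed
  qed measurable
  then have "(\<integral>\<xi>. (\<integral>x. ?k x \<xi> \<partial>lborel) \<partial>lborel) = (\<integral>x. (\<integral>\<xi>. ?k x \<xi> \<partial>lborel) \<partial>lborel)"
    by (rule lborel_pair.Fubini_integral)
  moreover have "fourier_integral f \<xi> * g \<xi> = of_real (1 / sqrt (2 * pi)) * (\<integral>x. ?k x \<xi> \<partial>lborel)" for \<xi>
    by (simp add: fourier_integral_def)
  moreover have "f x * fourier_integral g x = of_real (1 / sqrt (2 * pi)) * (\<integral>\<xi>. ?k x \<xi> \<partial>lborel)" for x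
  proof -
    have "(\<lambda>\<xi>. ?k x \<xi>) = (\<lambda>\<xi>. f x * (exp (- \<i> * complex_of_real \<xi> * complex_of_real x) * g \<xi>))"
      by (simp add: mult_ac)
    then show ?thesis by (simp add: fourier_integral_def)
  qed
  ultimately show ?thesis by simp
qed

text \<open>Rescaling by \<open>n\<close> leaves the characteristic function of the standard normal
  law; the modulation by \<open>x\<close> becomes a translation. The minus sign in \<open>?t\<close>
  converts the kernel of the transform into that of \<open>char\<close>.\<close>

lemma fourier_integral_gaussian:
  assumes "n > 0"
  shows "fourier_integral (\<lambda>\<xi>. exp (- \<i> * x * \<xi>) * of_real (exp (- (\<xi> / n)\<^sup>2 / 2))) y
    = of_real (n * exp (- (n * (x + y))\<^sup>2 / 2))"
proof -
  let ?t = "- (n * (x + y))"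
  have "(\<integral>\<xi>. exp (- \<i> * \<xi> * y) * (exp (- \<i> * x * \<xi>) * of_real (exp (- (\<xi> / n)\<^sup>2 / 2))) \<partial>lborel)
     = n *\<^sub>R (\<integral>\<xi>. exp (- \<i> * of_real (n * \<xi>) * y) * (exp (- \<i> * x * of_real (n * \<xi>)) * of_real (exp (- \<xi>\<^sup>2 / 2))) \<partial>lborel)"
    using assms by (subst lborel_integral_real_affine[where c = n and t = 0]) auto
  also have "\<dots> = n *\<^sub>R (\<integral>\<xi>. of_real (sqrt (2 * pi)) * (std_normal_density \<xi> *\<^sub>R iexp (?t * \<xi>)) \<partial>lborel)"
    by (intro arg_cong[where f = "\<lambda>z. n *\<^sub>R z"] Bochner_Integration.integral_cong refl)
       (simp add: std_normal_density_def scaleR_conv_of_real field_simps flip: exp_add)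
  also have "(\<integral>\<xi>. of_real (sqrt (2 * pi)) * (std_normal_density \<xi> *\<^sub>R iexp (?t * \<xi>)) \<partial>lborel)
     = of_real (sqrt (2 * pi)) * char std_normal_distribution ?t"
    unfolding char_def by (subst integral_density) (auto simp flip: integral_mult_right_zero)
  finally show ?thesis
    unfolding fourier_integral_def char_std_normal_distribution
    by (simp add: scaleR_conv_of_real field_simps power2_eq_square)
qed

section \<open>Parseval's identity for tame functions\<close>

text \<open>A class of functions for which the dominated convergence arguments below are immediate and which
  contains the step functions.\<close>

definition tame :: "(real \<Rightarrow> complex) \<Rightarrow> bool" where
  "tame f \<longleftrightarrow> f \<in> borel_measurable borel \<and> (\<exists>B. \<forall>x. cmod (f x) \<le> B) \<and>
     (\<exists>R. \<forall>x. R < \<bar>x\<bar> \<longrightarrow> f x = 0) \<and> (AE x in lborel. isCont f x)"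

lemma tameI:
  assumes "f \<in> borel_measurable borel" "\<And>x. cmod (f x) \<le> B" "\<And>x. R < \<bar>x\<bar> \<Longrightarrow> f x = 0"
    "AE x in lborel. isCont f x"
  shows "tame f"
  using assms unfolding tame_def by blast

lemma bounded_support_integrable:
  fixes f :: "real \<Rightarrow> 'a::{banach, second_countable_topology}"
  assumes [measurable]: "f \<in> borel_measurable borel"
    and B: "\<And>x. norm (f x) \<le> B" and R: "\<And>x. R < \<bar>x\<bar> \<Longrightarrow> f x = 0"
  shows "integrable lborel f"
proof -
  have "integrable lborel (\<lambda>x. B * indicator {-R..R} x)"
    by (auto simp: integrable_indicator_iff emeasure_lborel_Icc_eq)
  then show ?thesis
    by (rule Bochner_Integration.integrable_bound)
       (use B R in \<open>auto simp: indicator_def intro!: AE_I2 abs_ge_self[THEN order_trans[rotated]]\<close>)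
qed

lemma tame_integrable: "tame f \<Longrightarrow> integrable lborel f"
  by (auto simp: tame_def intro: bounded_support_integrable)

lemma tame_square_integrable:
  assumes "tame f" shows "square_integrable f"
proof -
  from assms obtain B R where *: "f \<in> borel_measurable borel" "\<And>x. cmod (f x) \<le> B" "\<And>x. R < \<bar>x\<bar> \<Longrightarrow> f x = 0"
    by (auto simp: tame_def)
  have "integrable lborel (\<lambda>x. (cmod (f x))\<^sup>2)"
    by (rule bounded_support_integrable[of _ "B\<^sup>2" R]) (use * in \<open>auto intro: power_mono\<close>)
  then show ?thesis using * by (simp add: square_integrable_def)
qed

lemma tame_add:
  assumes "tame f" "tame g" shows "tame (\<lambda>x. f x + g x)"
proof -
  from assms obtain B R B' R' where
    *: "f \<in> borel_measurable borel" "\<And>x. cmod (f x) \<le> B" "\<And>x. R < \<bar>x\<bar> \<Longrightarrow> f x = 0" "AE x in lborel. isCont f x"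
      "g \<in> borel_measurable borel" "\<And>x. cmod (g x) \<le> B'" "\<And>x. R' < \<bar>x\<bar> \<Longrightarrow> g x = 0" "AE x in lborel. isCont g x"
    by (auto simp: tame_def)
  have ac: "AE x in lborel. isCont (\<lambda>x. f x + g x) x"
    using *(4,8) by eventually_elim simp
  have bd: "cmod (f x + g x) \<le> B + B'" for x
    using *(2,6) norm_triangle_mono by blast
  have su: "max R R' < \<bar>x\<bar> \<Longrightarrow> f x + g x = 0" for x using *(3,7) by auto
  show ?thesis
    by (rule tameI[OF _ bd su ac]) (use *(1,5) in measurable)
qed

lemma tame_mult:
  assumes "tame f" "tame g" shows "tame (\<lambda>x. f x * g x)"
proof -
  from assms obtain B R B' where
    *: "f \<in> borel_measurable borel" "\<And>x. cmod (f x) \<le> B" "\<And>x. R < \<bar>x\<bar> \<Longrightarrow> f x = 0" "AE x in lborel. isCont f x"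
      "g \<in> borel_measurable borel" "\<And>x. cmod (g x) \<le> B'" "AE x in lborel. isCont g x"
    by (auto simp: tame_def)
  have ac: "AE x in lborel. isCont (\<lambda>x. f x * g x) x"
    using *(4,7) by eventually_elim simp
  have bd: "cmod (f x * g x) \<le> B * B'" for x
    unfolding norm_mult using *(2,6) by (intro mult_mono order_trans[OF norm_ge_zero *(2)]) auto
  have su: "R < \<bar>x\<bar> \<Longrightarrow> f x * g x = 0" for x using *(3) by auto
  show ?thesis
    by (rule tameI[OF _ bd su ac]) (use *(1,5) in measurable)
qed

lemma tame_cmult:
  assumes "tame f" shows "tame (\<lambda>x. c * f x)"
proof -
  from assms obtain B R where
    *: "f \<in> borel_measurable borel" "\<And>x. cmod (f x) \<le> B" "\<And>x. R < \<bar>x\<bar> \<Longrightarrow> f x = 0" "AE x in lborel. isCont f x"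
    by (auto simp: tame_def)
  have ac: "AE x in lborel. isCont (\<lambda>x. c * f x) x"
    using *(4) by eventually_elim simp
  have bd: "cmod (c * f x) \<le> cmod c * B" for x
    unfolding norm_mult using *(2) by (intro mult_left_mono) auto
  have su: "R < \<bar>x\<bar> \<Longrightarrow> c * f x = 0" for x using *(3) by auto
  show ?thesis
    by (rule tameI[OF _ bd su ac]) (use *(1) in measurable)
qed

lemma tame_indicator: "tame (indicator {a..b})"
proof -
  have "AE x in lborel. x \<notin> {a, b}"
    by (intro AE_not_in finite_imp_null_set_lborel) auto
  then have ac: "AE x in lborel. isCont (indicator {a..b} :: real \<Rightarrow> complex) x"
  proof eventually_elim
    fix x assume "x \<notin> {a, b}"
    then have "x \<notin> frontier {a..b}" by (auto simp: frontier_def)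
    then have "isCont (\<lambda>x. complex_of_real (indicator {a..b} x)) x"
      by (intro isCont_of_real) (simp add: isCont_indicator)
    then show "isCont (indicator {a..b} :: real \<Rightarrow> complex) x"
      by (simp add: of_real_indicator)
  qed
  have bd: "cmod (indicator {a..b} x) \<le> 1" for x by (auto simp: indicator_def)
  have su: "max \<bar>a\<bar> \<bar>b\<bar> < \<bar>x\<bar> \<Longrightarrow> (indicator {a..b} x :: complex) = 0" for x
    by (auto simp: indicator_def)
  have me: "(indicator {a..b} :: real \<Rightarrow> complex) \<in> borel_measurable borel" by measurable
  show ?thesis
    by (rule tameI[OF _ bd su ac]) measurable
qed

lemma tame_zero: "tame (\<lambda>x. 0)"
  using tame_cmult[OF tame_indicator, of 0] by simp

lemma borel_measurable_cnj [measurable]: "cnj \<in> borel_measurable borel"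
  by (intro borel_measurable_continuous_onI continuous_intros)

text \<open>Parseval with the integrand damped by a Gaussian of width \<open>n\<close>; the right-hand side mollifies \<open>f\<close>
  at scale \<open>1 / n\<close>.\<close>

lemma gaussian_parseval:
  assumes f: "tame f" and n: "(n::real) > 0"
  shows "(\<integral>\<xi>. of_real ((cmod (fourier_integral f \<xi>))\<^sup>2 * exp (- (\<xi> / n)\<^sup>2 / 2)) \<partial>lborel)
    = (\<integral>x. f x * (\<integral>z. cnj (f (x - z / n)) * std_normal_density z \<partial>lborel) \<partial>lborel)"
proof -
  have fi: "integrable lborel f" using f by (rule tame_integrable)
  have [measurable]: "f \<in> borel_measurable borel" using f by (simp add: tame_def)
  \<comment> \<open>Conjugation combined with reflection conjugates the transform. Hence the squared
    modulus is a product of two transforms, and the multiplication formula can be used.\<close>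
  define h where "h y = cnj (f (- y))" for y
  have hi: "integrable lborel h"
  proof -
    have "integrable lborel (\<lambda>y. f (0 + (-1) * y))"
      by (rule lborel_integrable_real_affine[OF fi]) simp
    then show ?thesis unfolding h_def by (simp add: integrable_cnj)
  qed
  define \<gamma> where "\<gamma> \<xi> = complex_of_real (exp (- (\<xi> / n)\<^sup>2 / 2))" for \<xi>
  have [measurable]: "\<gamma> \<in> borel_measurable borel" by (simp add: \<gamma>_def[abs_def])
  have \<gamma>i: "integrable lborel \<gamma>"
  proof -
    have "integrable lborel (\<lambda>x. std_normal_density (0 + (1 / n) * x))"
      using n by (intro lborel_integrable_real_affine) auto
    then have "integrable lborel (\<lambda>x. complex_of_real (sqrt (2 * pi) * std_normal_density (0 + (1 / n) * x)))"
      by (intro integrable_of_real integrable_mult_right)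
    also have "(\<lambda>x. complex_of_real (sqrt (2 * pi) * std_normal_density (0 + (1 / n) * x))) = \<gamma>"
      by (auto simp: \<gamma>_def std_normal_density_def fun_eq_iff)
    finally show ?thesis .
  qed
  have fh: "fourier_integral h \<xi> = cnj (fourier_integral f \<xi>)" for \<xi>
  proof -
    have "(\<integral>x. exp (- \<i> * x * \<xi>) * h x \<partial>lborel)
      = (\<integral>x. exp (- \<i> * of_real (- x) * \<xi>) * h (- x) \<partial>lborel)"
      by (subst lborel_integral_real_affine[where c = "-1" and t = 0]) auto
    also have "\<dots> = (\<integral>x. cnj (exp (- \<i> * x * \<xi>) * f x) \<partial>lborel)"
      by (simp add: h_def exp_cnj)
    also have "\<dots> = cnj (\<integral>x. exp (- \<i> * x * \<xi>) * f x \<partial>lborel)"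
      by (rule Bochner_Integration.integral_cnj)
    finally show ?thesis by (simp add: fourier_integral_def)
  qed
  have gi: "integrable lborel (\<lambda>\<xi>. cnj (fourier_integral f \<xi>) * \<gamma> \<xi>)"
  proof (rule Bochner_Integration.integrable_bound)
    show "integrable lborel (\<lambda>\<xi>. 1 / sqrt (2 * pi) * (\<integral>x. cmod (f x) \<partial>lborel) * cmod (\<gamma> \<xi>))"
      using \<gamma>i by auto
    have "cmod (fourier_integral f \<xi>) * cmod (\<gamma> \<xi>)
      \<le> 1 / sqrt (2 * pi) * (\<integral>x. cmod (f x) \<partial>lborel) * cmod (\<gamma> \<xi>)" for \<xi>
      by (intro mult_right_mono cmod_fourier_integral_le fi) auto
    moreover have "0 \<le> (\<integral>x. cmod (f x) \<partial>lborel)" by simp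
    ultimately show "AE \<xi> in lborel. norm (cnj (fourier_integral f \<xi>) * \<gamma> \<xi>)
       \<le> norm (1 / sqrt (2 * pi) * (\<integral>x. cmod (f x) \<partial>lborel) * cmod (\<gamma> \<xi>))"
      by (auto simp: norm_mult abs_mult)
  qed measurable
  \<comment> \<open>The multiplication formula moves the transform from \<open>h\<close> to the
    modulated Gaussian, where it is explicit; the substitution \<open>y = - x + z / n\<close> then
    normalises the width.\<close>
  have inner: "fourier_integral (\<lambda>\<xi>. cnj (fourier_integral f \<xi>) * \<gamma> \<xi>) x
     = (\<integral>z. cnj (f (x - z / n)) * std_normal_density z \<partial>lborel)" for x
  proof -
    have ei: "integrable lborel (\<lambda>\<xi>. exp (- \<i> * complex_of_real x * complex_of_real \<xi>) * \<gamma> \<xi>)"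
      using \<gamma>i by (rule Bochner_Integration.integrable_bound) (auto simp: norm_mult)
    have "fourier_integral (\<lambda>\<xi>. cnj (fourier_integral f \<xi>) * \<gamma> \<xi>) x
       = of_real (1 / sqrt (2 * pi)) * (\<integral>\<xi>. fourier_integral h \<xi> * (exp (- \<i> * x * \<xi>) * \<gamma> \<xi>) \<partial>lborel)"
      unfolding fh fourier_integral_def[of "\<lambda>\<xi>. cnj (fourier_integral f \<xi>) * \<gamma> \<xi>"] by (simp add: mult_ac)
    also have "\<dots> = of_real (1 / sqrt (2 * pi)) *
        (\<integral>y. h y * of_real (n * exp (- (n * (x + y))\<^sup>2 / 2)) \<partial>lborel)"
      unfolding fourier_integral_multiplication[OF hi ei]
      unfolding \<gamma>_def fourier_integral_gaussian[OF n] ..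
    also have "\<dots> = of_real (1 / sqrt (2 * pi)) * ((1 / n) *\<^sub>R
        (\<integral>z. h (- x + 1 / n * z) * of_real (n * exp (- (n * (x + (- x + 1 / n * z)))\<^sup>2 / 2)) \<partial>lborel))"
      using n by (subst lborel_integral_real_affine[where c = "1 / n" and t = "- x"]) auto
    also have "\<dots> = (\<integral>z. of_real (1 / sqrt (2 * pi)) * ((1 / n) *\<^sub>R
        (h (- x + 1 / n * z) * of_real (n * exp (- (n * (x + (- x + 1 / n * z)))\<^sup>2 / 2)))) \<partial>lborel)"
      by simp
    also have "\<dots> = (\<integral>z. cnj (f (x - z / n)) * std_normal_density z \<partial>lborel)"
      using n by (intro Bochner_Integration.integral_cong refl)
        (simp add: h_def std_normal_density_def scaleR_conv_of_real)
    finally show ?thesis .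
  qed
  have "(\<integral>\<xi>. of_real ((cmod (fourier_integral f \<xi>))\<^sup>2 * exp (- (\<xi> / n)\<^sup>2 / 2)) \<partial>lborel)
     = (\<integral>\<xi>. fourier_integral f \<xi> * (cnj (fourier_integral f \<xi>) * \<gamma> \<xi>) \<partial>lborel)"
    by (simp only: \<gamma>_def complex_norm_square mult.assoc of_real_mult)
  also have "\<dots> = (\<integral>x. f x * fourier_integral (\<lambda>\<xi>. cnj (fourier_integral f \<xi>) * \<gamma> \<xi>) x \<partial>lborel)"
    by (rule fourier_integral_multiplication[OF fi gi])
  finally show ?thesis unfolding inner .
qed

text \<open>The mollified function converges at each continuity point of \<open>f\<close>, hence
  almost everywhere, and is bounded by \<open>B\<close>. The remaining factor \<open>f\<close> is
  integrable, so dominated convergence applies inside and outside.\<close>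

lemma gaussian_parseval_limit:
  assumes f: "tame f"
  shows "(\<lambda>n. \<integral>x. f x * (\<integral>z. cnj (f (x - z / real (Suc n))) * std_normal_density z \<partial>lborel) \<partial>lborel)
     \<longlonglongrightarrow> (\<integral>x. of_real ((cmod (f x))\<^sup>2) \<partial>lborel)"
proof -
  from f obtain B where *: "\<And>x. cmod (f x) \<le> B" by (auto simp: tame_def)
  have [measurable]: "f \<in> borel_measurable borel" using f by (simp add: tame_def)
  have ib: "integrable lborel (\<lambda>z. B * std_normal_density z)"
    by (intro integrable_mult_right integrable_normal_density) auto
  have inner: "(\<lambda>n. \<integral>z. cnj (f (x - z / real (Suc n))) * std_normal_density z \<partial>lborel)
     \<longlonglongrightarrow> (\<integral>z. cnj (f x) * std_normal_density z \<partial>lborel)" if "isCont f x" for x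
  proof (rule integral_dominated_convergence[OF _ _ ib])
    show "AE z in lborel. (\<lambda>n. cnj (f (x - z / real (Suc n))) * std_normal_density z)
        \<longlonglongrightarrow> cnj (f x) * std_normal_density z"
    proof (rule AE_I2)
      fix z
      have "(\<lambda>n. x - z * inverse (real (Suc n))) \<longlonglongrightarrow> x - z * 0"
        by (intro tendsto_intros LIMSEQ_inverse_real_of_nat)
      then have "(\<lambda>n. x - z / real (Suc n)) \<longlonglongrightarrow> x" by (simp add: divide_inverse)
      then have "(\<lambda>n. f (x - z / real (Suc n))) \<longlonglongrightarrow> f x"
        using that by (rule isCont_tendsto_compose[rotated])
      then show "(\<lambda>n. cnj (f (x - z / real (Suc n))) * std_normal_density z)
        \<longlonglongrightarrow> cnj (f x) * std_normal_density z"
        by (intro tendsto_intros)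
    qed
    show "AE z in lborel. norm (cnj (f (x - z / real (Suc n))) * std_normal_density z)
        \<le> B * std_normal_density z" for n
      using * by (intro AE_I2) (simp add: norm_mult mult_right_mono)
  qed (auto intro!: borel_measurable_times)
  have "(\<lambda>n. \<integral>x. f x * (\<integral>z. cnj (f (x - z / real (Suc n))) * std_normal_density z \<partial>lborel) \<partial>lborel)
     \<longlonglongrightarrow> (\<integral>x. f x * cnj (f x) \<partial>lborel)"
  proof (rule integral_dominated_convergence)
    show "integrable lborel (\<lambda>x. cmod (f x) * B)"
      using tame_integrable[OF f] by auto
    show "AE x in lborel. (\<lambda>n. f x * (\<integral>z. cnj (f (x - z / real (Suc n))) * std_normal_density z \<partial>lborel))
        \<longlonglongrightarrow> f x * cnj (f x)"
    proof -
      have "AE x in lborel. isCont f x" using f by (simp add: tame_def)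
      then show ?thesis
      proof eventually_elim
        fix x assume "isCont f x"
        then have "(\<lambda>n. f x * (\<integral>z. cnj (f (x - z / real (Suc n))) * std_normal_density z \<partial>lborel))
          \<longlonglongrightarrow> f x * (\<integral>z. cnj (f x) * std_normal_density z \<partial>lborel)"
          by (intro tendsto_mult_left inner)
        moreover have "(\<integral>z. complex_of_real (std_normal_density z) \<partial>lborel) = 1"
          using integral_normal_density[of 1 0] by simp
        ultimately show "(\<lambda>n. f x * (\<integral>z. cnj (f (x - z / real (Suc n))) * std_normal_density z \<partial>lborel))
          \<longlonglongrightarrow> f x * cnj (f x)" by simp
      qed
    qed
    show "AE x in lborel. norm (f x * (\<integral>z. cnj (f (x - z / real (Suc n))) * std_normal_density z \<partial>lborel))
       \<le> cmod (f x) * B" for n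
    proof (rule AE_I2)
      fix x
      have "cmod (\<integral>z. cnj (f (x - z / real (Suc n))) * std_normal_density z \<partial>lborel)
        \<le> (\<integral>z. B * std_normal_density z \<partial>lborel)"
        by (rule Bochner_Integration.integral_norm_bound_integral[OF
              Bochner_Integration.integrable_bound[OF ib] ib])
           (use * order_trans[OF norm_ge_zero *] in \<open>auto simp: norm_mult abs_mult intro!: mult_right_mono\<close>)
      also have "\<dots> = B" using integral_normal_density[of 1 0] by simp
      finally show "norm (f x * (\<integral>z. cnj (f (x - z / real (Suc n))) * std_normal_density z \<partial>lborel))
         \<le> cmod (f x) * B"
        unfolding norm_mult by (intro mult_left_mono) auto
    qed
  qed measurable
  then show ?thesis by (simp only: complex_norm_square)
qed

text \<open>The Gaussian factor increases to 1 with \<open>n\<close>. Monotone convergence therefore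
  yields square integrability of the transform and the value of its norm at once, with no prior
  knowledge of decay.\<close>

lemma tame_parseval:
  assumes f: "tame f"
  shows "square_integrable (fourier_integral f)"
    and "norm (abs_L2 (fourier_integral f)) = norm (abs_L2 f)"
proof -
  have [measurable]: "f \<in> borel_measurable borel" using f by (simp add: tame_def)
  let ?F = "\<lambda>n \<xi>. (cmod (fourier_integral f \<xi>))\<^sup>2 * exp (- (\<xi> / real (Suc n))\<^sup>2 / 2)"
  have lim: "(\<lambda>n. complex_of_real (\<integral>\<xi>. ?F n \<xi> \<partial>lborel)) \<longlonglongrightarrow> of_real (\<integral>x. (cmod (f x))\<^sup>2 \<partial>lborel)"
    using gaussian_parseval_limit[OF f] gaussian_parseval[OF f, of "real (Suc n)" for n, symmetric]
    by (simp del: of_real_mult of_nat_Suc of_real_power)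
  then have lim': "(\<lambda>n. \<integral>\<xi>. ?F n \<xi> \<partial>lborel) \<longlonglongrightarrow> (\<integral>x. (cmod (f x))\<^sup>2 \<partial>lborel)"
    by (simp only: tendsto_of_real_iff)
  have Fi: "integrable lborel (?F n)" for n
  proof (rule Bochner_Integration.integrable_bound)
    let ?K = "(1 / sqrt (2 * pi) * (\<integral>x. cmod (f x) \<partial>lborel))\<^sup>2"
    have "integrable lborel (\<lambda>x. std_normal_density (0 + (1 / real (Suc n)) * x))"
      by (intro lborel_integrable_real_affine) auto
    then have "integrable lborel (\<lambda>x. ?K * (sqrt (2 * pi) * std_normal_density (0 + (1 / real (Suc n)) * x)))"
      by (intro integrable_mult_right)
    also have "(\<lambda>x. ?K * (sqrt (2 * pi) * std_normal_density (0 + (1 / real (Suc n)) * x)))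
       = (\<lambda>x. ?K * exp (- (x / real (Suc n))\<^sup>2 / 2))"
      by (auto simp: std_normal_density_def fun_eq_iff)
    finally show "integrable lborel (\<lambda>x. ?K * exp (- (x / real (Suc n))\<^sup>2 / 2))" .
    have "(cmod (fourier_integral f \<xi>))\<^sup>2 \<le> ?K" for \<xi>
      by (intro power_mono cmod_fourier_integral_le tame_integrable f) auto
    then show "AE x in lborel. norm (?F n x) \<le> norm (?K * exp (- (x / real (Suc n))\<^sup>2 / 2))"
      by (intro AE_I2) (simp add: abs_mult mult_right_mono)
  qed measurable
  have mono: "AE x in lborel. mono (\<lambda>n. ?F n x)"
  proof (intro AE_I2 monoI mult_left_mono)
    fix x and m n :: nat assume "m \<le> n"
    then have "(x / real (Suc n))\<^sup>2 \<le> (x / real (Suc m))\<^sup>2"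
      unfolding power_divide by (intro divide_left_mono power_mono) auto
    then show "exp (- (x / real (Suc m))\<^sup>2 / 2) \<le> exp (- (x / real (Suc n))\<^sup>2 / 2)" by simp
  qed auto
  have conv: "AE x in lborel. (\<lambda>n. ?F n x) \<longlonglongrightarrow> (cmod (fourier_integral f x))\<^sup>2"
  proof (rule AE_I2)
    fix x
    have "(\<lambda>n. x / real (Suc n)) \<longlonglongrightarrow> 0"
      using LIMSEQ_Suc[OF lim_const_over_n[of x]] by simp
    then have "(\<lambda>n. ?F n x) \<longlonglongrightarrow> (cmod (fourier_integral f x))\<^sup>2 * exp (- 0\<^sup>2 / 2)"
      by (intro tendsto_mult tendsto_exp tendsto_divide tendsto_minus tendsto_power tendsto_const) simp_all
    then show "(\<lambda>n. ?F n x) \<longlonglongrightarrow> (cmod (fourier_integral f x))\<^sup>2" by simp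
  qed
  have meas: "(\<lambda>x. (cmod (fourier_integral f x))\<^sup>2) \<in> borel_measurable lborel" by measurable
  show si: "square_integrable (fourier_integral f)"
    using integrable_monotone_convergence[OF Fi mono conv lim' meas]
    by (simp add: square_integrable_def)
  have "(norm (abs_L2 (fourier_integral f)))\<^sup>2 = (norm (abs_L2 f))\<^sup>2"
    unfolding norm_abs_L2_sq[OF si] norm_abs_L2_sq[OF tame_square_integrable[OF f]]
    using integral_monotone_convergence[OF Fi mono conv lim' meas] .
  then show "norm (abs_L2 (fourier_integral f)) = norm (abs_L2 f)" by simp
qed

section \<open>Density of the tame functions\<close>

definition approximable :: "(real \<Rightarrow> complex) \<Rightarrow> bool" where
  "approximable f \<longleftrightarrow> square_integrable f \<and> abs_L2 f \<in> closure (abs_L2 ` Collect tame)"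

lemma approximable_tame: "tame f \<Longrightarrow> approximable f"
  by (auto simp: approximable_def tame_square_integrable intro: closure_subset[THEN subsetD])

lemma approximable_add:
  assumes "approximable f" "approximable g"
  shows "approximable (\<lambda>x. f x + g x)"
proof -
  from assms obtain X Y where X: "\<And>n. X n \<in> abs_L2 ` Collect tame" "X \<longlonglongrightarrow> abs_L2 f"
    and Y: "\<And>n. Y n \<in> abs_L2 ` Collect tame" "Y \<longlonglongrightarrow> abs_L2 g"
    unfolding approximable_def closure_sequential by blast
  have "X n + Y n \<in> abs_L2 ` Collect tame" for n
  proof -
    from X(1)[of n] Y(1)[of n] obtain a b where "tame a" "X n = abs_L2 a" "tame b" "Y n = abs_L2 b" by auto
    then show ?thesis by (auto simp: abs_L2_add tame_square_integrable intro!: imageI tame_add)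
  qed
  moreover have "(\<lambda>n. X n + Y n) \<longlonglongrightarrow> abs_L2 (\<lambda>x. f x + g x)"
    using tendsto_add[OF X(2) Y(2)] assms by (simp add: abs_L2_add approximable_def)
  ultimately have "abs_L2 (\<lambda>x. f x + g x) \<in> closure (abs_L2 ` Collect tame)"
    unfolding closure_sequential by (intro exI[of _ "\<lambda>n. X n + Y n"]) auto
  then show ?thesis
    using assms unfolding approximable_def by (auto intro: square_integrable_add)
qed

lemma norm_abs_L2_cmult:
  assumes "square_integrable f"
  shows "norm (abs_L2 (\<lambda>x. c * f x)) = cmod c * norm (abs_L2 f)"
proof -
  have "(norm (abs_L2 (\<lambda>x. c * f x)))\<^sup>2 = (cmod c * norm (abs_L2 f))\<^sup>2"
    unfolding norm_abs_L2_sq[OF square_integrable_mult[OF assms]] power_mult_distrib norm_abs_L2_sq[OF assms]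
    by (simp add: norm_mult power_mult_distrib)
  then show ?thesis by (rule power2_eq_imp_eq) auto
qed

lemma approximable_iff:
  "approximable f \<longleftrightarrow> square_integrable f \<and> (\<forall>e>0. \<exists>g. tame g \<and> norm (abs_L2 (\<lambda>x. f x - g x)) < e)"
proof -
  have "norm (abs_L2 (\<lambda>x. f x - g x)) = dist (abs_L2 g) (abs_L2 f)" if "square_integrable f" "tame g" for g
    using abs_L2_diff[OF that(1) tame_square_integrable[OF that(2)]] dist_commute dist_norm by metis
  then show ?thesis
    unfolding approximable_def closure_approachable by fastforce
qed

lemma approximable_cmult:
  assumes "approximable f"
  shows "approximable (\<lambda>x. c * f x)"
proof -
  have si: "square_integrable f" using assms by (simp add: approximable_def)
  have "\<exists>g. tame g \<and> norm (abs_L2 (\<lambda>x. c * f x - g x)) < e" if e: "e > 0" for e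
  proof -
    have "0 < e / (cmod c + 1)" using e by (simp add: add_nonneg_pos)
    with assms obtain g where g: "tame g" "norm (abs_L2 (\<lambda>x. f x - g x)) < e / (cmod c + 1)"
      unfolding approximable_iff by blast
    have "norm (abs_L2 (\<lambda>x. c * f x - c * g x)) = cmod c * norm (abs_L2 (\<lambda>x. f x - g x))"
      using norm_abs_L2_cmult[OF square_integrable_diff[OF si tame_square_integrable[OF g(1)]], of c]
      by (simp add: right_diff_distrib)
    also have "\<dots> \<le> (cmod c + 1) * norm (abs_L2 (\<lambda>x. f x - g x))" by (simp add: distrib_right)
    also have "\<dots> < e" using g(2) by (simp add: pos_less_divide_eq add_nonneg_pos mult.commute)
    finally show ?thesis using tame_cmult[OF g(1), of c] by blast
  qed
  then show ?thesis unfolding approximable_iff using square_integrable_mult[OF si] by blast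
qed

lemma approximable_sum:
  assumes "finite I" "\<And>i. i \<in> I \<Longrightarrow> approximable (f i)"
  shows "approximable (\<lambda>x. \<Sum>i\<in>I. f i x)"
  using assms by (induction I rule: finite_induct) (auto intro: approximable_tame tame_zero approximable_add)

text \<open>The limit inherits the bound \<open>K * cmod (g x)\<close>, so the squared differences
  are dominated by \<open>(2 * K)\<^sup>2 * (cmod (g x))\<^sup>2\<close>.\<close>

lemma L2_dominated_convergence:
  assumes g: "square_integrable g" and [measurable]: "\<And>n. h n \<in> borel_measurable borel" "f \<in> borel_measurable borel"
    and bd: "\<And>n x. cmod (h n x) \<le> K * cmod (g x)" and conv: "AE x in lborel. (\<lambda>n. h n x) \<longlonglongrightarrow> f x"
  shows "square_integrable f" "(\<lambda>n. abs_L2 (h n)) \<longlonglongrightarrow> abs_L2 f"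
proof -
  have sh: "square_integrable (h n)" for n
    by (rule square_integrable_bound[OF g, of _ K]) (use bd in auto)
  have fb: "AE x in lborel. cmod (f x) \<le> K * cmod (g x)"
    using conv by eventually_elim (rule LIMSEQ_le_const2[OF tendsto_norm], use bd in auto)
  show sf: "square_integrable f"
    by (rule square_integrable_bound[OF g _ fb]) auto
  have gi: "integrable lborel (\<lambda>x. (2 * K)\<^sup>2 * (cmod (g x))\<^sup>2)" using g by (simp add: square_integrable_def)
  have "(\<lambda>n. \<integral>x. (cmod (h n x - f x))\<^sup>2 \<partial>lborel) \<longlonglongrightarrow> (\<integral>x. 0 \<partial>(lborel::real measure))"
  proof (rule integral_dominated_convergence[OF _ _ gi])
    show "AE x in lborel. (\<lambda>n. (cmod (h n x - f x))\<^sup>2) \<longlonglongrightarrow> 0"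
      using conv
    proof eventually_elim
      fix x assume "(\<lambda>n. h n x) \<longlonglongrightarrow> f x"
      then have "(\<lambda>n. (cmod (h n x - f x))\<^sup>2) \<longlonglongrightarrow> (cmod (f x - f x))\<^sup>2" by (intro tendsto_intros)
      then show "(\<lambda>n. (cmod (h n x - f x))\<^sup>2) \<longlonglongrightarrow> 0" by simp
    qed
    show "AE x in lborel. norm ((cmod (h n x - f x))\<^sup>2) \<le> (2 * K)\<^sup>2 * (cmod (g x))\<^sup>2" for n
      using fb
    proof eventually_elim
      fix x assume "cmod (f x) \<le> K * cmod (g x)"
      then have "cmod (h n x - f x) \<le> 2 * K * cmod (g x)"
        using bd[of n x] norm_triangle_ineq4[of "h n x" "f x"] by linarith
      then have "(cmod (h n x - f x))\<^sup>2 \<le> (2 * K * cmod (g x))\<^sup>2" by (intro power_mono) auto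
      then show "norm ((cmod (h n x - f x))\<^sup>2) \<le> (2 * K)\<^sup>2 * (cmod (g x))\<^sup>2"
        by (simp add: power_mult_distrib)
    qed
  qed measurable
  then have "(\<lambda>n. (norm (abs_L2 (h n) - abs_L2 f))\<^sup>2) \<longlonglongrightarrow> 0"
    by (simp add: abs_L2_diff[OF sh sf] norm_abs_L2_sq[OF square_integrable_diff[OF sh sf]])
  then have "(\<lambda>n. sqrt ((norm (abs_L2 (h n) - abs_L2 f))\<^sup>2)) \<longlonglongrightarrow> sqrt 0" by (intro tendsto_intros)
  then show "(\<lambda>n. abs_L2 (h n)) \<longlonglongrightarrow> abs_L2 f"
    by (simp add: LIM_zero_iff tendsto_norm_zero_iff)
qed

lemma approximable_dominated_limit:
  assumes "square_integrable g" "\<And>n. approximable (h n)" "f \<in> borel_measurable borel"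
    and "\<And>n x. cmod (h n x) \<le> K * cmod (g x)" "\<And>x. (\<lambda>n. h n x) \<longlonglongrightarrow> f x"
  shows "approximable f"
proof -
  have m: "h n \<in> borel_measurable borel" for n
    using assms(2)[of n] by (auto simp: approximable_def square_integrable_def)
  have *: "square_integrable f" "(\<lambda>n. abs_L2 (h n)) \<longlonglongrightarrow> abs_L2 f"
    by (rule L2_dominated_convergence[OF assms(1) m assms(3) assms(4) AE_I2[OF assms(5)]])+
  moreover have "abs_L2 f \<in> closure (abs_L2 ` Collect tame)"
    by (rule Lim_in_closed_set[OF closed_closure _ _ *(2)]) (use assms(2) in \<open>auto simp: approximable_def\<close>)
  ultimately show ?thesis by (simp add: approximable_def)
qed

text \<open>Induction over the Borel sets, generated by closed intervals. The fixed window
  \<open>{-m..m}\<close> makes the complement step possible, since complements are then taken inside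
  a set of finite measure, and its indicator dominates the partial sums in the union step.\<close>

lemma approximable_indicator:
  assumes "A \<in> sets borel"
  shows "approximable (indicator (A \<inter> {-m..m}))"
  using assms
proof (induction rule: borel_set_induct)
  case empty
  then show ?case by (simp add: approximable_tame tame_zero)
next
  case (interval a b)
  then show ?case by (auto simp: Int_atLeastAtMost intro: approximable_tame tame_indicator)
next
  case (compl A)
  have "(\<lambda>x. indicator {-m..m} x + (-1) * indicator (A \<inter> {-m..m}) x :: complex) = indicator (- A \<inter> {-m..m})"
    by (auto simp: indicator_def fun_eq_iff)
  moreover have "approximable (\<lambda>x. indicator {-m..m} x + (-1) * indicator (A \<inter> {-m..m}) x)"
    by (intro approximable_add approximable_cmult compl approximable_tame tame_indicator)
  ultimately show ?case by simp
next
  case (union A)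
  have [measurable]: "A i \<in> sets borel" for i using union by auto
  have dis: "disjoint_family (\<lambda>i. A i \<inter> {-m..m})"
    using union(1) by (auto simp: disjoint_family_on_def)
  show ?case
  proof (rule approximable_dominated_limit[where g = "indicator {-m..m}" and K = 1
        and h = "\<lambda>n x. \<Sum>i<n. indicator (A i \<inter> {-m..m}) x"])
    show "square_integrable (indicator {-m..m})" by (intro tame_square_integrable tame_indicator)
    show "approximable (\<lambda>x. \<Sum>i<n. indicator (A i \<inter> {-m..m}) x)" for n
      by (intro approximable_sum union) auto
    have eq: "(\<Sum>i<n. indicator (A i \<inter> {-m..m}) x) = (indicator (\<Union>i<n. A i \<inter> {-m..m}) x :: complex)" for n x
      by (rule indicator_UN_disjoint[symmetric]) (use dis in \<open>auto simp: disjoint_family_on_def\<close>)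
    show "cmod (\<Sum>i<n. indicator (A i \<inter> {-m..m}) x) \<le> 1 * cmod (indicator {-m..m} x)" for n x
      unfolding eq by (auto simp: indicator_def)
    show "(\<lambda>n. \<Sum>i<n. indicator (A i \<inter> {-m..m}) x) \<longlonglongrightarrow> (indicator (\<Union> (range A) \<inter> {-m..m}) x :: complex)" for x
    proof (cases "\<exists>k. x \<in> A k \<inter> {-m..m}")
      case True
      then obtain k where k: "x \<in> A k \<inter> {-m..m}" by blast
      have "\<forall>\<^sub>F n in sequentially. (\<Sum>i<n. indicator (A i \<inter> {-m..m}) x) = (indicator (\<Union> (range A) \<inter> {-m..m}) x :: complex)"
        using eventually_gt_at_top[of k]
      proof eventually_elim
        case (elim n)
        then show ?case unfolding eq using k by (subst indicator_simps(1), blast, subst indicator_simps(1), blast) simp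
      qed
      then show ?thesis by (rule tendsto_eventually)
    next
      case False
      then have "\<And>n. (\<Sum>i<n. indicator (A i \<inter> {-m..m}) x) = (0::complex)"
        by (auto intro!: sum.neutral simp: indicator_def)
      moreover have "(indicator (\<Union> (range A) \<inter> {-m..m}) x :: complex) = 0"
        using False by (auto simp: indicator_def)
      ultimately show ?thesis by simp
    qed
  qed measurable
qed

lemma square_integrable_approximable:
  assumes f: "square_integrable f"
  shows "approximable f"
proof -
  have [measurable]: "f \<in> borel_measurable borel" using f by (simp add: square_integrable_def)
  obtain s where s: "\<And>i. simple_function borel (s i)" "\<And>x. (\<lambda>i. s i x) \<longlonglongrightarrow> f x"
      "\<And>i x. norm (s i x) \<le> 2 * norm (f x)"
    using borel_measurable_implies_sequence_metric[of f borel 0] by (auto simp: dist_norm)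
  \<comment> \<open>A simple function is a finite combination of indicators of its level sets. The
    window makes these bounded, as \<open>approximable_indicator\<close> requires; since it grows
    with \<open>n\<close>, it eventually contains any given point.\<close>
  define h where "h n x = (\<Sum>y\<in>range (s n). y * indicator (s n -` {y} \<inter> {- real n..real n}) x)" for n x
  have h: "h n x = s n x * indicator {- real n..real n} x" for n x
  proof -
    have "h n x = (\<Sum>y\<in>range (s n). if y = s n x then y * indicator {- real n..real n} x else 0)"
      unfolding h_def by (intro sum.cong) (auto simp: indicator_def)
    also have "\<dots> = s n x * indicator {- real n..real n} x"
      using s(1)[of n, THEN simple_functionD(1)] by (subst sum.delta) auto
    finally show ?thesis .
  qed
  show ?thesis
  proof (rule approximable_dominated_limit[OF f])
    show "approximable (h n)" for n
      unfolding h_def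
    proof (intro approximable_sum approximable_cmult approximable_indicator)
      show "finite (range (s n))" using s(1)[of n, THEN simple_functionD(1)] by simp
      show "s n -` {y} \<in> sets borel" for y using s(1)[of n, THEN simple_functionD(2), of "{y}"] by simp
    qed
    show "cmod (h n x) \<le> 2 * cmod (f x)" for n x
      using s(3)[of n x] by (auto simp: h indicator_def)
    show "(\<lambda>n. h n x) \<longlonglongrightarrow> f x" for x
    proof (rule Lim_transform_eventually[OF s(2)])
      show "\<forall>\<^sub>F n in sequentially. s n x = h n x"
        using eventually_ge_at_top[of "nat \<lceil>\<bar>x\<bar>\<rceil>"]
      proof eventually_elim
        fix n assume "nat \<lceil>\<bar>x\<bar>\<rceil> \<le> n"
        then have "\<bar>x\<bar> \<le> real n" by linarith
        then show "s n x = h n x" by (auto simp: h indicator_def)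
      qed
    qed
  qed measurable
qed

section \<open>Multiplication operators and conjugation\<close>

text \<open>The bound on \<open>m\<close> keeps the product square integrable; outside that range
  \<open>abs_L2\<close> says nothing about its argument. This is why the multiplier lemmas carry a
  constant \<open>K\<close>.\<close>

lemma rep_pointwise_mult:
  assumes "m \<in> borel_measurable borel" "\<And>x. cmod (m x) \<le> K"
  shows "square_integrable (\<lambda>x. m x * rep_L2 f x)"
    and "AE x in lborel. rep_L2 (pointwise_mult m f) x = m x * rep_L2 f x"
proof -
  show si: "square_integrable (\<lambda>x. m x * rep_L2 f x)"
    by (rule square_integrable_bound[OF square_integrable_rep_L2[of f], of _ K])
       (use assms in \<open>auto simp: norm_mult intro!: mult_right_mono\<close>)
  show "AE x in lborel. rep_L2 (pointwise_mult m f) x = m x * rep_L2 f x"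
    unfolding pointwise_mult_def by (rule rep_abs_L2[OF si])
qed

lemma pointwise_mult_add:
  assumes "m \<in> borel_measurable borel" "\<And>x. cmod (m x) \<le> K"
  shows "pointwise_mult m (f + g) = pointwise_mult m f + pointwise_mult m g"
  by (rule L2_eqI, use rep_pointwise_mult(2)[OF assms, of "f + g"] rep_pointwise_mult(2)[OF assms, of f]
      rep_pointwise_mult(2)[OF assms, of g] rep_L2_add[of f g]
      rep_L2_add[of "pointwise_mult m f" "pointwise_mult m g"] in eventually_elim) (simp add: distrib_left)

lemma pointwise_mult_scaleR:
  assumes "m \<in> borel_measurable borel" "\<And>x. cmod (m x) \<le> K"
  shows "pointwise_mult m (c *\<^sub>R f) = c *\<^sub>R pointwise_mult m f"
  by (rule L2_eqI, use rep_pointwise_mult(2)[OF assms, of "c *\<^sub>R f"] rep_pointwise_mult(2)[OF assms, of f]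
      rep_L2_scaleR[of c f] rep_L2_scaleR[of c "pointwise_mult m f"] in eventually_elim) simp

lemma pointwise_mult_pointwise_mult:
  assumes "m \<in> borel_measurable borel" "\<And>x. cmod (m x) \<le> K"
    and "m' \<in> borel_measurable borel" "\<And>x. cmod (m' x) \<le> K'"
  shows "pointwise_mult m (pointwise_mult m' f) = pointwise_mult (\<lambda>x. m x * m' x) f"
proof -
  have bd: "cmod (m x * m' x) \<le> K * K'" for x
    unfolding norm_mult using assms(2,4) by (intro mult_mono order_trans[OF norm_ge_zero assms(2)]) auto
  show ?thesis
    by (rule L2_eqI, use rep_pointwise_mult(2)[OF assms(1,2), of "pointwise_mult m' f"]
        rep_pointwise_mult(2)[OF assms(3,4), of f]
        rep_pointwise_mult(2)[OF borel_measurable_times[OF assms(1,3)] bd, of f] in eventually_elim) simp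
qed

lemma norm_pointwise_mult_le:
  assumes "m \<in> borel_measurable borel" "\<And>x. cmod (m x) \<le> K"
  shows "norm (pointwise_mult m f) \<le> K * norm f"
proof (rule power2_le_imp_le)
  have "(norm (pointwise_mult m f))\<^sup>2 = (\<integral>x. (cmod (m x * rep_L2 f x))\<^sup>2 \<partial>lborel)"
    unfolding pointwise_mult_def by (rule norm_abs_L2_sq[OF rep_pointwise_mult(1)[OF assms]])
  also have "\<dots> \<le> (\<integral>x. K\<^sup>2 * (cmod (rep_L2 f x))\<^sup>2 \<partial>lborel)"
  proof (rule integral_mono)
    show "(cmod (m x * rep_L2 f x))\<^sup>2 \<le> K\<^sup>2 * (cmod (rep_L2 f x))\<^sup>2" for x
      unfolding norm_mult power_mult_distrib using assms(2) by (intro mult_right_mono power_mono) auto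
  qed (use rep_pointwise_mult(1)[OF assms, of f] square_integrable_rep_L2[of f] in
        \<open>auto simp: square_integrable_def\<close>)
  also have "\<dots> = (K * norm f)\<^sup>2" by (simp add: norm_L2_sq power_mult_distrib)
  finally show "(norm (pointwise_mult m f))\<^sup>2 \<le> (K * norm f)\<^sup>2" .
  show "0 \<le> K * norm f" using order_trans[OF norm_ge_zero assms(2)] by auto
qed

text \<open>A factor of modulus 1 rotates the plane, so the real product is already preserved
  pointwise.\<close>

lemma inner_pointwise_mult:
  assumes "m \<in> borel_measurable borel" "\<And>x. cmod (m x) = 1"
  shows "inner (pointwise_mult m f) (pointwise_mult m g) = inner f g"
proof -
  have K: "cmod (m x) \<le> 1" for x using assms(2) by simp
  have "(m x * a) \<bullet> (m x * b) = a \<bullet> b" for x a b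
  proof -
    have "(m x * a) \<bullet> (m x * b) = ((Re (m x))\<^sup>2 + (Im (m x))\<^sup>2) * (a \<bullet> b)"
      by (simp add: inner_complex_def algebra_simps power2_eq_square)
    also have "(Re (m x))\<^sup>2 + (Im (m x))\<^sup>2 = 1" using assms(2)[of x] by (simp add: cmod_power2[symmetric])
    finally show ?thesis by simp
  qed
  then show ?thesis
    unfolding pointwise_mult_def
    by (simp add: inner_abs_L2 rep_pointwise_mult(1)[OF assms(1) K] inner_L2_rep[of f g])
qed

text \<open>The type \<open>L2\<close> is only a real vector space, so multiplication by the
  imaginary unit has to be an operator of its own.\<close>

abbreviation imult :: "L2 \<Rightarrow> L2" where
  "imult \<equiv> pointwise_mult (\<lambda>x. \<i>)"

lemma imult_imult [simp]: "imult (imult f) = - f"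
proof -
  have "imult (imult f) = pointwise_mult (\<lambda>x. -1) f"
    by (subst pointwise_mult_pointwise_mult[where K = 1 and K' = 1]) auto
  also have "\<dots> = - f"
    by (rule L2_eqI, use rep_pointwise_mult(2)[of "\<lambda>x. -1" 1 f, simplified] rep_L2_scaleR[of "-1" f]
      in eventually_elim) simp
  finally show ?thesis .
qed

lemma linear_imult: "linear imult"
  by (intro linearI pointwise_mult_add[where K = 1] pointwise_mult_scaleR[where K = 1]) auto

lemma bounded_linear_imult: "bounded_linear imult"
  using linear_imult norm_pointwise_mult_le[of "\<lambda>x. \<i>" 1]
  by (intro bounded_linear_intro[where K = 1]) (auto simp: linear_add linear_scale)

lemma inner_imult: "inner (imult f) (imult g) = inner f g"
  by (intro inner_pointwise_mult) auto

text \<open>Conjugating one argument turns the real inner product into the real part of the bilinear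
  pairing, the integral of \<open>f x * g x\<close>, with respect to which the Fourier transform is
  symmetric.\<close>

definition cnj_L2 :: "L2 \<Rightarrow> L2" where
  "cnj_L2 f = abs_L2 (\<lambda>x. cnj (rep_L2 f x))"

lemma square_integrable_cnj: "square_integrable f \<Longrightarrow> square_integrable (\<lambda>x. cnj (f x))"
  by (auto simp: square_integrable_def)

lemma rep_cnj_L2: "AE x in lborel. rep_L2 (cnj_L2 f) x = cnj (rep_L2 f x)"
  unfolding cnj_L2_def by (intro rep_abs_L2 square_integrable_cnj) simp

lemma cnj_L2_abs_L2:
  assumes "square_integrable f" shows "cnj_L2 (abs_L2 f) = abs_L2 (\<lambda>x. cnj (f x))"
  by (rule L2_eqI, use rep_cnj_L2[of "abs_L2 f"] rep_abs_L2[OF assms] rep_abs_L2[OF square_integrable_cnj[OF assms]]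
      in eventually_elim) simp

lemma cnj_L2_cnj_L2 [simp]: "cnj_L2 (cnj_L2 f) = f"
  by (rule L2_eqI, use rep_cnj_L2[of f] rep_cnj_L2[of "cnj_L2 f"] in eventually_elim) simp

lemma linear_cnj_L2: "linear cnj_L2"
proof (rule linearI)
  show "cnj_L2 (f + g) = cnj_L2 f + cnj_L2 g" for f g
    by (rule L2_eqI, use rep_cnj_L2[of f] rep_cnj_L2[of g] rep_cnj_L2[of "f + g"] rep_L2_add[of f g]
        rep_L2_add[of "cnj_L2 f" "cnj_L2 g"] in eventually_elim) simp
  show "cnj_L2 (c *\<^sub>R f) = c *\<^sub>R cnj_L2 f" for c f
    by (rule L2_eqI, use rep_cnj_L2[of f] rep_cnj_L2[of "c *\<^sub>R f"] rep_L2_scaleR[of c f]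
        rep_L2_scaleR[of c "cnj_L2 f"] in eventually_elim) simp
qed

lemma inner_cnj_L2: "inner (cnj_L2 f) (cnj_L2 g) = inner f g"
  unfolding cnj_L2_def
  by (subst inner_abs_L2) (auto intro!: square_integrable_cnj simp: inner_L2_rep inner_complex_def)

lemma norm_cnj_L2 [simp]: "norm (cnj_L2 f) = norm f"
  by (simp add: norm_eq_sqrt_inner inner_cnj_L2)

section \<open>Extension of the transform to all of \<open>L2\<close>\<close>

text \<open>Cauchy-Schwarz against the indicator of the support. It turns convergence in
  \<open>L2\<close> into convergence in mean, and hence into pointwise convergence of the Fourier
  integrals.\<close>

lemma compact_support_integrable:
  assumes f: "square_integrable f" and R: "\<And>x. R < \<bar>x\<bar> \<Longrightarrow> f x = 0"
  shows "integrable lborel f"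
    and "(\<integral>x. cmod (f x) \<partial>lborel) \<le> norm (abs_L2 (indicator {-R..R})) * norm (abs_L2 f)"
proof -
  have si: "square_integrable (indicator {-R..R})" by (intro tame_square_integrable tame_indicator)
  have eq: "(\<lambda>x. cmod (indicator {-R..R} x) * cmod (f x)) = (\<lambda>x. cmod (f x))"
  proof
    fix x show "cmod (indicator {-R..R} x) * cmod (f x) = cmod (f x)"
      using R[of x] by (cases "\<bar>x\<bar> \<le> R") (auto simp: indicator_def)
  qed
  have "f \<in> borel_measurable lborel" using f by (simp add: square_integrable_def)
  then show "integrable lborel f"
    using integrable_cmod_mult[OF si f] unfolding eq by (subst integrable_norm_iff[symmetric]) 
  show "(\<integral>x. cmod (f x) \<partial>lborel) \<le> norm (abs_L2 (indicator {-R..R})) * norm (abs_L2 f)"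
    using integral_cmod_mult_le[OF si f] unfolding eq .
qed

text \<open>Tame approximants with a common support have pointwise convergent transforms, and
  Fatou's lemma passes their norm identity to the limit. Fatou yields only an inequality; it is
  enough to define the transform by continuity, and equality returns in
  \<open>norm_fourier\<close>.\<close>

lemma compact_support_bessel:
  assumes f: "square_integrable f" and R: "\<And>x. R < \<bar>x\<bar> \<Longrightarrow> f x = 0"
  shows "square_integrable (fourier_integral f)" "norm (abs_L2 (fourier_integral f)) \<le> norm (abs_L2 f)"
proof -
  have [measurable]: "f \<in> borel_measurable borel" using f by (simp add: square_integrable_def)
  have "\<exists>g. tame g \<and> (\<forall>x. R < \<bar>x\<bar> \<longrightarrow> g x = 0) \<and> norm (abs_L2 (\<lambda>x. f x - g x)) < inverse (real (Suc n))" for n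
  proof -
    obtain g where g: "tame g" "norm (abs_L2 (\<lambda>x. f x - g x)) < inverse (real (Suc n))"
      using square_integrable_approximable[OF f] unfolding approximable_iff
      by (metis inverse_positive_iff_positive of_nat_0_less_iff zero_less_Suc)
    \<comment> \<open>Cutting the approximant to the support of \<open>f\<close> gives all
      approximants the same support and can only decrease the error, because \<open>f\<close>
      vanishes elsewhere.\<close>
    let ?g = "\<lambda>x. indicator {-R..R} x * g x"
    have tg: "tame ?g" by (intro tame_mult tame_indicator g)
    have eq: "f x - ?g x = indicator {-R..R} x * (f x - g x)" for x
      using R[of x] by (cases "\<bar>x\<bar> \<le> R") (auto simp: indicator_def)
    have s1: "square_integrable (\<lambda>x. f x - g x)" "square_integrable (\<lambda>x. f x - ?g x)"
      by (intro square_integrable_diff f tame_square_integrable g tg)+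
    have "(norm (abs_L2 (\<lambda>x. f x - ?g x)))\<^sup>2 \<le> (norm (abs_L2 (\<lambda>x. f x - g x)))\<^sup>2"
      unfolding norm_abs_L2_sq[OF s1(1)] norm_abs_L2_sq[OF s1(2)]
    proof (rule integral_mono)
      show "(cmod (f x - ?g x))\<^sup>2 \<le> (cmod (f x - g x))\<^sup>2" for x
        unfolding eq by (auto simp: indicator_def)
    qed (use s1 in \<open>auto simp: square_integrable_def\<close>)
    then have "norm (abs_L2 (\<lambda>x. f x - ?g x)) \<le> norm (abs_L2 (\<lambda>x. f x - g x))"
      by (rule power2_le_imp_le) simp
    with g(2) tg show ?thesis by (intro exI[of _ ?g]) (auto simp: indicator_def)
  qed
  then obtain g where g: "\<And>n. tame (g n)" "\<And>n x. R < \<bar>x\<bar> \<Longrightarrow> g n x = 0"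
      "\<And>n. norm (abs_L2 (\<lambda>x. f x - g n x)) < inverse (real (Suc n))" by metis
  have sd: "square_integrable (\<lambda>x. f x - g n x)" for n
    by (intro square_integrable_diff f tame_square_integrable g)
  have n0: "(\<lambda>n. norm (abs_L2 (\<lambda>x. f x - g n x))) \<longlonglongrightarrow> 0"
    by (rule real_tendsto_sandwich[OF _ _ tendsto_const LIMSEQ_inverse_real_of_nat])
       (use g(3) less_imp_le in \<open>auto intro!: always_eventually\<close>)
  have "(\<lambda>n. abs_L2 (g n)) \<longlonglongrightarrow> abs_L2 f"
  proof (rule tendsto_dist_iff[THEN iffD2])
    have "dist (abs_L2 (g n)) (abs_L2 f) = norm (abs_L2 (\<lambda>x. f x - g n x))" for n
      using abs_L2_diff[OF f tame_square_integrable[OF g(1)[of n]]] dist_commute dist_norm by metis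
    then show "(\<lambda>n. dist (abs_L2 (g n)) (abs_L2 f)) \<longlonglongrightarrow> 0" using n0 by simp
  qed
  then have "(\<lambda>n. ennreal ((norm (abs_L2 (g n)))\<^sup>2)) \<longlonglongrightarrow> ennreal ((norm (abs_L2 f))\<^sup>2)"
    by (intro tendsto_intros)
  then have nl: "liminf (\<lambda>n. ennreal ((norm (abs_L2 (g n)))\<^sup>2)) = ennreal ((norm (abs_L2 f))\<^sup>2)"
    by (intro lim_imp_Liminf) auto
  have fi: "integrable lborel f" by (rule compact_support_integrable[OF f R])
  have pt: "(\<lambda>n. fourier_integral (g n) \<xi>) \<longlonglongrightarrow> fourier_integral f \<xi>" for \<xi>
  proof (rule LIM_zero_cancel, rule tendsto_norm_zero_cancel, rule real_tendsto_sandwich[OF _ _ tendsto_const])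
    let ?K = "1 / sqrt (2 * pi) * norm (abs_L2 (indicator {-R..R}))"
    have "norm (fourier_integral (g n) \<xi> - fourier_integral f \<xi>) \<le> ?K * norm (abs_L2 (\<lambda>x. f x - g n x))" for n
    proof -
      have "norm (fourier_integral (g n) \<xi> - fourier_integral f \<xi>) = cmod (fourier_integral (\<lambda>x. f x - g n x) \<xi>)"
        by (simp add: fourier_integral_diff[OF fi tame_integrable[OF g(1)]] norm_minus_commute)
      also have "\<dots> \<le> 1 / sqrt (2 * pi) * (\<integral>x. cmod (f x - g n x) \<partial>lborel)"
        by (intro cmod_fourier_integral_le Bochner_Integration.integrable_diff fi tame_integrable g)
      also have "\<dots> \<le> 1 / sqrt (2 * pi) * (norm (abs_L2 (indicator {-R..R})) * norm (abs_L2 (\<lambda>x. f x - g n x)))"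
        by (intro mult_left_mono compact_support_integrable[OF sd]) (auto simp: R g(2))
      finally show ?thesis by (simp add: mult.assoc)
    qed
    then show "\<forall>\<^sub>F n in sequentially. norm (fourier_integral (g n) \<xi> - fourier_integral f \<xi>)
       \<le> ?K * norm (abs_L2 (\<lambda>x. f x - g n x))" by (intro always_eventually) auto
    show "(\<lambda>n. ?K * norm (abs_L2 (\<lambda>x. f x - g n x))) \<longlonglongrightarrow> 0"
      using tendsto_mult_left[OF n0, of ?K] by simp
  qed auto
  have "(\<integral>\<^sup>+\<xi>. ennreal ((cmod (fourier_integral f \<xi>))\<^sup>2) \<partial>lborel)
     = (\<integral>\<^sup>+\<xi>. liminf (\<lambda>n. ennreal ((cmod (fourier_integral (g n) \<xi>))\<^sup>2)) \<partial>lborel)"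
  proof (rule nn_integral_cong)
    fix \<xi>
    have "(\<lambda>n. ennreal ((cmod (fourier_integral (g n) \<xi>))\<^sup>2)) \<longlonglongrightarrow> ennreal ((cmod (fourier_integral f \<xi>))\<^sup>2)"
      by (intro tendsto_intros pt)
    then show "ennreal ((cmod (fourier_integral f \<xi>))\<^sup>2) = liminf (\<lambda>n. ennreal ((cmod (fourier_integral (g n) \<xi>))\<^sup>2))"
      by (intro lim_imp_Liminf[symmetric]) auto
  qed
  also have "\<dots> \<le> liminf (\<lambda>n. \<integral>\<^sup>+\<xi>. ennreal ((cmod (fourier_integral (g n) \<xi>))\<^sup>2) \<partial>lborel)"
  proof (rule nn_integral_liminf)
    fix n
    have [measurable]: "g n \<in> borel_measurable borel" using g(1)[of n] by (simp add: tame_def)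
    show "(\<lambda>\<xi>. ennreal ((cmod (fourier_integral (g n) \<xi>))\<^sup>2)) \<in> borel_measurable lborel" by measurable
  qed
  also have "\<dots> = ennreal ((norm (abs_L2 f))\<^sup>2)"
    unfolding nl[symmetric] nn_norm_abs_L2_sq[OF tame_parseval(1)[OF g(1)]] tame_parseval(2)[OF g(1)] ..
  finally have le: "(\<integral>\<^sup>+\<xi>. ennreal ((cmod (fourier_integral f \<xi>))\<^sup>2) \<partial>lborel) \<le> ennreal ((norm (abs_L2 f))\<^sup>2)" .
  then show si: "square_integrable (fourier_integral f)"
    by (subst square_integrable_iff_nn_integral) (auto elim: order_le_less_trans)
  have "(norm (abs_L2 (fourier_integral f)))\<^sup>2 \<le> (norm (abs_L2 f))\<^sup>2"
    using le unfolding nn_norm_abs_L2_sq[OF si] by (rule ennreal_le_iff[THEN iffD1, rotated]) simp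
  then show "norm (abs_L2 (fourier_integral f)) \<le> norm (abs_L2 f)"
    by (rule power2_le_imp_le) simp
qed

abbreviation cutoff :: "real \<Rightarrow> L2 \<Rightarrow> real \<Rightarrow> complex" where
  "cutoff R f x \<equiv> indicator {-R..R} x * rep_L2 f x"

lemma cmod_indicator_le: "cmod (indicator A x) \<le> 1"
  by (auto simp: indicator_def)

lemma square_integrable_cutoff: "square_integrable (cutoff R f)"
  by (rule rep_pointwise_mult(1)[of _ 1]) (auto simp: cmod_indicator_le)

lemma cutoff_support: "R < \<bar>x\<bar> \<Longrightarrow> cutoff R f x = 0"
  by (auto simp: indicator_def)

lemma integrable_cutoff: "integrable lborel (cutoff R f)"
  by (rule compact_support_integrable(1)[OF square_integrable_cutoff cutoff_support])

lemma truncated_fourier_eq: "truncated_fourier R f = fourier_integral (cutoff R f)"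
proof
  fix \<xi> :: real
  have "(LINT x:{-R..R}|lborel. exp (- \<i> * x * \<xi>) * rep_L2 f x) = (\<integral>x. exp (- \<i> * x * \<xi>) * cutoff R f x \<partial>lborel)"
    unfolding set_lebesgue_integral_def
    by (intro Bochner_Integration.integral_cong refl) (auto simp: indicator_def)
  then show "truncated_fourier R f \<xi> = fourier_integral (cutoff R f) \<xi>"
    by (simp add: truncated_fourier_def fourier_integral_def)
qed

lemma square_integrable_truncated_fourier: "square_integrable (truncated_fourier R f)"
  unfolding truncated_fourier_eq by (rule compact_support_bessel(1)[OF square_integrable_cutoff cutoff_support])

lemma cutoff_tendsto: "((\<lambda>R. abs_L2 (cutoff R f)) \<longlongrightarrow> f) at_top"
proof (rule tendsto_at_topI_sequentially)
  fix X :: "nat \<Rightarrow> real" assume X: "filterlim X at_top sequentially"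
  have "(\<lambda>n. abs_L2 (cutoff (X n) f)) \<longlonglongrightarrow> abs_L2 (rep_L2 f)"
  proof (rule L2_dominated_convergence(2)[OF square_integrable_rep_L2[of f], where K = 1])
    show "cmod (cutoff (X n) f x) \<le> 1 * cmod (rep_L2 f x)" for n x by (auto simp: indicator_def)
    show "AE x in lborel. (\<lambda>n. cutoff (X n) f x) \<longlonglongrightarrow> rep_L2 f x"
    proof (rule AE_I2, rule tendsto_eventually)
      fix x
      show "\<forall>\<^sub>F n in sequentially. cutoff (X n) f x = rep_L2 f x"
        using X[unfolded filterlim_at_top, rule_format, of "\<bar>x\<bar>"]
        by eventually_elim (auto simp: indicator_def)
    qed
  qed measurable
  then show "(\<lambda>n. abs_L2 (cutoff (X n) f)) \<longlonglongrightarrow> f" by simp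
qed

lemma norm_truncated_fourier_diff:
  "norm (abs_L2 (truncated_fourier R f) - abs_L2 (truncated_fourier R' f))
    \<le> norm (abs_L2 (cutoff R f) - abs_L2 (cutoff R' f))"
proof -
  let ?d = "\<lambda>x. cutoff R f x - cutoff R' f x"
  have si: "square_integrable ?d" by (intro square_integrable_diff square_integrable_cutoff)
  have sup: "?d x = 0" if "max R R' < \<bar>x\<bar>" for x using that by (auto simp: indicator_def)
  have "(\<lambda>\<xi>. truncated_fourier R f \<xi> - truncated_fourier R' f \<xi>) = fourier_integral ?d"
    unfolding truncated_fourier_eq
    by (intro ext fourier_integral_diff[symmetric] integrable_cutoff)
  then show ?thesis
    using compact_support_bessel(2)[where R = "max R R'", OF si sup]
    by (simp add: abs_L2_diff square_integrable_truncated_fourier square_integrable_cutoff)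
qed

text \<open>Truncated transforms are square integrable, so the extended integral in
  \<open>has_fourier\<close> is a finite squared norm. From here on uniqueness and algebra of limits
  are those of a normed space.\<close>

lemma has_fourier_iff: "has_fourier f g \<longleftrightarrow> ((\<lambda>R. abs_L2 (truncated_fourier R f)) \<longlongrightarrow> g) at_top"
proof -
  have "(\<integral>\<^sup>+\<xi>. ennreal ((cmod (truncated_fourier R f \<xi> - rep_L2 g \<xi>))\<^sup>2) \<partial>lborel)
      = ennreal ((norm (abs_L2 (truncated_fourier R f) - g))\<^sup>2)" for R
    using nn_norm_abs_L2_sq[OF square_integrable_diff[OF square_integrable_truncated_fourier[of R f] square_integrable_rep_L2[of g]]]
    by (simp flip: abs_L2_diff[OF square_integrable_truncated_fourier square_integrable_rep_L2])
  then have "has_fourier f g \<longleftrightarrow> ((\<lambda>R. ennreal ((norm (abs_L2 (truncated_fourier R f) - g))\<^sup>2)) \<longlongrightarrow> ennreal 0) at_top"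
    by (simp add: has_fourier_def)
  also have "\<dots> \<longleftrightarrow> ((\<lambda>R. (norm (abs_L2 (truncated_fourier R f) - g))\<^sup>2) \<longlongrightarrow> 0) at_top"
    by (subst tendsto_ennreal_iff) auto
  also have "\<dots> \<longleftrightarrow> ((\<lambda>R. norm (abs_L2 (truncated_fourier R f) - g)) \<longlongrightarrow> 0) at_top"
  proof
    assume "((\<lambda>R. (norm (abs_L2 (truncated_fourier R f) - g))\<^sup>2) \<longlongrightarrow> 0) at_top"
    from tendsto_real_sqrt[OF this]
    show "((\<lambda>R. norm (abs_L2 (truncated_fourier R f) - g)) \<longlongrightarrow> 0) at_top" by simp
  next
    assume "((\<lambda>R. norm (abs_L2 (truncated_fourier R f) - g)) \<longlongrightarrow> 0) at_top"
    from tendsto_power[OF this, of 2]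
    show "((\<lambda>R. (norm (abs_L2 (truncated_fourier R f) - g))\<^sup>2) \<longlongrightarrow> 0) at_top" by simp
  qed
  finally show ?thesis unfolding tendsto_dist_iff[of _ g] dist_norm .
qed

text \<open>By \<open>norm_truncated_fourier_diff\<close> the transforms inherit the Cauchy property
  of the cutoffs, and completeness gives a limit along the integers. Comparing an arbitrary sequence
  of radii with the integers extends it to real \<open>R\<close>.\<close>

lemma has_fourier_ex: "\<exists>g. has_fourier f g"
proof -
  have cut: "(\<lambda>n. abs_L2 (cutoff (X n) f)) \<longlonglongrightarrow> f" if "filterlim X at_top sequentially" for X
    using cutoff_tendsto that by (rule filterlim_compose)
  have C: "Cauchy (\<lambda>n. abs_L2 (cutoff (real n) f))"
    using cut[OF filterlim_real_sequentially] by (rule LIMSEQ_imp_Cauchy)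
  have "Cauchy (\<lambda>n. abs_L2 (truncated_fourier (real n) f))"
  proof (rule CauchyI)
    fix e :: real assume "e > 0"
    from CauchyD[OF C this] obtain N where
      N: "\<forall>m\<ge>N. \<forall>n\<ge>N. norm (abs_L2 (cutoff (real m) f) - abs_L2 (cutoff (real n) f)) < e" by auto
    show "\<exists>N. \<forall>m\<ge>N. \<forall>n\<ge>N. norm (abs_L2 (truncated_fourier (real m) f) - abs_L2 (truncated_fourier (real n) f)) < e"
      by (rule exI[of _ N], intro allI impI)
         (rule order_le_less_trans[OF norm_truncated_fourier_diff], use N in simp)
  qed
  then obtain g where g: "(\<lambda>n. abs_L2 (truncated_fourier (real n) f)) \<longlonglongrightarrow> g"
    using Cauchy_convergent convergent_def by blast
  have "((\<lambda>R. abs_L2 (truncated_fourier R f)) \<longlongrightarrow> g) at_top"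
  proof (rule tendsto_at_topI_sequentially)
    fix X :: "nat \<Rightarrow> real" assume X: "filterlim X at_top sequentially"
    have "(\<lambda>n. abs_L2 (cutoff (X n) f) - abs_L2 (cutoff (real n) f)) \<longlonglongrightarrow> f - f"
      by (intro tendsto_diff cut X filterlim_real_sequentially)
    then have "(\<lambda>n. norm (abs_L2 (cutoff (X n) f) - abs_L2 (cutoff (real n) f))) \<longlonglongrightarrow> 0"
      by (simp add: tendsto_norm_zero_iff)
    then have "(\<lambda>n. abs_L2 (truncated_fourier (X n) f) - abs_L2 (truncated_fourier (real n) f)) \<longlonglongrightarrow> 0"
      by (rule Lim_null_comparison[rotated]) (intro always_eventually allI norm_truncated_fourier_diff)
    from tendsto_add[OF this g] show "(\<lambda>n. abs_L2 (truncated_fourier (X n) f)) \<longlonglongrightarrow> g" by simp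
  qed
  then show ?thesis unfolding has_fourier_iff by blast
qed

lemma fourier_eqI: "has_fourier f g \<Longrightarrow> fourier f = g"
  unfolding fourier_def by (rule the_equality) (auto simp: has_fourier_iff intro: tendsto_unique[OF trivial_limit_at_top_linorder])

lemma truncated_fourier_tendsto: "((\<lambda>R. abs_L2 (truncated_fourier R f)) \<longlongrightarrow> fourier f) at_top"
  using has_fourier_ex[of f] fourier_eqI by (auto simp: has_fourier_iff)

lemma fourier_integral_cong_AE:
  assumes "AE x in lborel. f x = g x" "f \<in> borel_measurable borel" "g \<in> borel_measurable borel"
  shows "fourier_integral f = fourier_integral g"
proof
  fix \<xi> :: real
  have "AE x in lborel. exp (- \<i> * complex_of_real x * complex_of_real \<xi>) * f x = exp (- \<i> * x * \<xi>) * g x"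
    using assms(1) by eventually_elim simp
  then show "fourier_integral f \<xi> = fourier_integral g \<xi>"
    unfolding fourier_integral_def using assms(2,3)
    by (intro arg_cong2[where f = "(*)"] integral_cong_AE refl) auto
qed

lemma fourier_add: "fourier (f + g) = fourier f + fourier g"
proof (rule fourier_eqI, unfold has_fourier_iff)
  have "truncated_fourier R (f + g) = (\<lambda>\<xi>. truncated_fourier R f \<xi> + truncated_fourier R g \<xi>)" for R
  proof -
    have "AE x in lborel. cutoff R (f + g) x = cutoff R f x + cutoff R g x"
      using rep_L2_add[of f g] by eventually_elim (simp add: distrib_left)
    then have "truncated_fourier R (f + g) = fourier_integral (\<lambda>x. cutoff R f x + cutoff R g x)"
      unfolding truncated_fourier_eq by (rule fourier_integral_cong_AE) auto
    also have "\<dots> = (\<lambda>\<xi>. truncated_fourier R f \<xi> + truncated_fourier R g \<xi>)"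
      unfolding truncated_fourier_eq
      by (intro ext fourier_integral_add integrable_cutoff)
    finally show ?thesis .
  qed
  then show "((\<lambda>R. abs_L2 (truncated_fourier R (f + g))) \<longlongrightarrow> fourier f + fourier g) at_top"
    using tendsto_add[OF truncated_fourier_tendsto[of f] truncated_fourier_tendsto[of g]]
    by (simp add: abs_L2_add square_integrable_truncated_fourier)
qed

lemma truncated_fourier_pointwise_mult_const:
  "truncated_fourier R (pointwise_mult (\<lambda>x. c) f) = (\<lambda>\<xi>. c * truncated_fourier R f \<xi>)"
proof -
  have "AE x in lborel. cutoff R (pointwise_mult (\<lambda>x. c) f) x = c * cutoff R f x"
    using rep_pointwise_mult(2)[of "\<lambda>x. c" "cmod c" f, simplified] by eventually_elim simp
  then have "truncated_fourier R (pointwise_mult (\<lambda>x. c) f) = fourier_integral (\<lambda>x. c * cutoff R f x)"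
    unfolding truncated_fourier_eq by (rule fourier_integral_cong_AE) auto
  then show ?thesis unfolding truncated_fourier_eq by (simp add: fourier_integral_cmult fun_eq_iff)
qed

lemma abs_L2_cmult:
  assumes "square_integrable f"
  shows "abs_L2 (\<lambda>x. c * f x) = pointwise_mult (\<lambda>x. c) (abs_L2 f)"
  by (rule abs_L2_eqI[OF square_integrable_mult[OF assms]],
      use rep_abs_L2[OF assms] rep_pointwise_mult(2)[of "\<lambda>x. c" "cmod c" "abs_L2 f", simplified]
      in eventually_elim) simp

lemma tendsto_pointwise_mult:
  assumes "m \<in> borel_measurable borel" "\<And>x. cmod (m x) \<le> K" "(X \<longlongrightarrow> f) F"
  shows "((\<lambda>n. pointwise_mult m (X n)) \<longlongrightarrow> pointwise_mult m f) F"
proof -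
  have "bounded_linear (pointwise_mult m)"
    by (intro bounded_linear_intro[where K = K] pointwise_mult_add[OF assms(1,2)] pointwise_mult_scaleR[OF assms(1,2)])
       (metis assms(1,2) norm_pointwise_mult_le mult.commute)
  then show ?thesis using assms(3) by (rule bounded_linear.tendsto)
qed

text \<open>The predicate \<open>linear\<close> covers real scalars only; complex homogeneity,
  needed for \<open>imult\<close>, is stated through multiplication by a constant function.\<close>

lemma fourier_const_mult: "fourier (pointwise_mult (\<lambda>x. c) f) = pointwise_mult (\<lambda>x. c) (fourier f)"
proof (rule fourier_eqI, unfold has_fourier_iff)
  show "((\<lambda>R. abs_L2 (truncated_fourier R (pointwise_mult (\<lambda>x. c) f))) \<longlongrightarrow> pointwise_mult (\<lambda>x. c) (fourier f)) at_top"
    unfolding truncated_fourier_pointwise_mult_const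
    using tendsto_pointwise_mult[OF _ _ truncated_fourier_tendsto[of f], of "\<lambda>x. c" "cmod c"]
    by (simp add: abs_L2_cmult[OF square_integrable_truncated_fourier])
qed

lemma pointwise_mult_of_real: "pointwise_mult (\<lambda>x. of_real c) f = c *\<^sub>R f"
  by (rule L2_eqI, use rep_pointwise_mult(2)[of "\<lambda>x. of_real c" "\<bar>c\<bar>" f, simplified] rep_L2_scaleR[of c f]
      in eventually_elim) (simp add: scaleR_conv_of_real)

lemma linear_fourier: "linear fourier"
  using fourier_add fourier_const_mult[of "of_real c" for c] unfolding pointwise_mult_of_real by (intro linearI)

lemma norm_fourier_le: "norm (fourier f) \<le> norm f"
proof (rule tendsto_le[OF _ tendsto_norm[OF cutoff_tendsto] tendsto_norm[OF truncated_fourier_tendsto]])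
  show "\<forall>\<^sub>F R in at_top. norm (abs_L2 (truncated_fourier R f)) \<le> norm (abs_L2 (cutoff R f))"
    unfolding truncated_fourier_eq
    by (intro always_eventually allI compact_support_bessel(2)[OF square_integrable_cutoff cutoff_support])
qed simp

lemma bounded_linear_fourier: "bounded_linear fourier"
  using norm_fourier_le linear_fourier
  by (intro bounded_linear_intro[where K = 1]) (auto simp: linear_add linear_scale)

lemma fourier_compact_support:
  assumes f: "square_integrable f" and R: "\<And>x. R < \<bar>x\<bar> \<Longrightarrow> f x = 0"
  shows "fourier (abs_L2 f) = abs_L2 (fourier_integral f)"
proof (rule fourier_eqI, unfold has_fourier_iff, rule tendsto_eventually)
  have [measurable]: "f \<in> borel_measurable borel" using f by (simp add: square_integrable_def)
  show "\<forall>\<^sub>F R' in at_top. abs_L2 (truncated_fourier R' (abs_L2 f)) = abs_L2 (fourier_integral f)"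
    using eventually_ge_at_top[of R]
  proof eventually_elim
    fix R' assume "R \<le> R'"
    have "AE x in lborel. cutoff R' (abs_L2 f) x = f x"
      using rep_abs_L2[OF f]
    proof eventually_elim
      fix x assume "rep_L2 (abs_L2 f) x = f x"
      then show "cutoff R' (abs_L2 f) x = f x"
        using R[of x] \<open>R \<le> R'\<close> by (cases "\<bar>x\<bar> \<le> R'") (auto simp: indicator_def)
    qed
    then show "abs_L2 (truncated_fourier R' (abs_L2 f)) = abs_L2 (fourier_integral f)"
      unfolding truncated_fourier_eq by (subst fourier_integral_cong_AE[of _ f]) auto
  qed
qed

section \<open>Isometry, adjoint and inverse of the transform\<close>

text \<open>The inequality \<open>norm_fourier_le\<close> makes the transform continuous, so
  equality of norms is a closed condition; it holds on the dense set of tame functions.\<close>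

lemma norm_fourier [simp]: "norm (fourier f) = norm f"
proof -
  have "closed {f. norm (fourier f) = norm f}"
    by (intro closed_Collect_eq continuous_intros linear_continuous_on bounded_linear_fourier)
  moreover have "abs_L2 ` Collect tame \<subseteq> {f. norm (fourier f) = norm f}"
  proof clarify
    fix g assume g: "tame g"
    then obtain R where "\<And>x. R < \<bar>x\<bar> \<Longrightarrow> g x = 0" by (auto simp: tame_def)
    then have "fourier (abs_L2 g) = abs_L2 (fourier_integral g)"
      by (rule fourier_compact_support[OF tame_square_integrable[OF g]])
    then show "norm (fourier (abs_L2 g)) = norm (abs_L2 g)" by (simp add: tame_parseval(2)[OF g])
  qed
  ultimately have "closure (abs_L2 ` Collect tame) \<subseteq> {f. norm (fourier f) = norm f}"
    by (rule closure_minimal[rotated])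
  moreover have "f \<in> closure (abs_L2 ` Collect tame)"
    using square_integrable_approximable[OF square_integrable_rep_L2[of f]] by (simp add: approximable_def)
  ultimately show ?thesis by blast
qed

lemma inner_fourier: "inner (fourier f) (fourier g) = inner f g"
  by (simp add: dot_norm linear_add[OF linear_fourier, symmetric])

text \<open>For cutoffs both functions are integrable, and the claim is the real part of the
  multiplication formula. Both sides are continuous in the cutoffs and their transforms, so
  \<open>R\<close> can go to infinity.\<close>

lemma fourier_adjoint: "inner (fourier f) (cnj_L2 g) = inner f (cnj_L2 (fourier g))"
proof -
  have blc: "bounded_linear cnj_L2"
    using linear_cnj_L2 by (intro bounded_linear_intro[where K = 1]) (auto simp: linear_add linear_scale)
  have eq: "inner (abs_L2 (truncated_fourier R f)) (cnj_L2 (abs_L2 (cutoff R g)))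
     = inner (abs_L2 (cutoff R f)) (cnj_L2 (abs_L2 (truncated_fourier R g)))" for R
  proof -
    note [simp] = square_integrable_truncated_fourier square_integrable_cutoff
    have i: "integrable lborel (cutoff R f)" "integrable lborel (cutoff R g)"
      by (rule integrable_cutoff)+
    have Re: "(\<integral>x. a x \<bullet> cnj (b x) \<partial>lborel) = Re (\<integral>x. a x * b x \<partial>lborel)"
      if "square_integrable a" "square_integrable b" for a b
    proof -
      have [measurable]: "a \<in> borel_measurable borel" "b \<in> borel_measurable borel"
        using that by (auto simp: square_integrable_def)
      have "integrable lborel (\<lambda>x. a x * b x)"
        using integrable_cmod_mult[OF that] by (subst integrable_norm_iff[symmetric]) (auto simp: norm_mult)
      then show ?thesis by (subst integral_Re[symmetric]) (auto simp: inner_complex_def)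
    qed
    have "inner (abs_L2 (truncated_fourier R f)) (cnj_L2 (abs_L2 (cutoff R g)))
       = Re (\<integral>\<xi>. truncated_fourier R f \<xi> * cutoff R g \<xi> \<partial>lborel)"
      by (subst cnj_L2_abs_L2, simp, subst inner_abs_L2, simp, intro square_integrable_cnj, simp, rule Re, simp, simp)
    also have "\<dots> = Re (\<integral>x. cutoff R f x * truncated_fourier R g x \<partial>lborel)"
      unfolding truncated_fourier_eq fourier_integral_multiplication[OF i] ..
    also have "\<dots> = inner (abs_L2 (cutoff R f)) (cnj_L2 (abs_L2 (truncated_fourier R g)))"
      by (subst cnj_L2_abs_L2, simp, subst inner_abs_L2, simp, intro square_integrable_cnj, simp,
          rule Re[symmetric], simp, simp)
    finally show ?thesis .
  qed
  have "((\<lambda>R. inner (abs_L2 (truncated_fourier R f)) (cnj_L2 (abs_L2 (cutoff R g))))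
      \<longlongrightarrow> inner (fourier f) (cnj_L2 g)) at_top"
    by (intro tendsto_inner truncated_fourier_tendsto bounded_linear.tendsto[OF blc] cutoff_tendsto)
  moreover have "((\<lambda>R. inner (abs_L2 (truncated_fourier R f)) (cnj_L2 (abs_L2 (cutoff R g))))
      \<longlongrightarrow> inner f (cnj_L2 (fourier g))) at_top"
    unfolding eq
    by (intro tendsto_inner truncated_fourier_tendsto bounded_linear.tendsto[OF blc] cutoff_tendsto)
  ultimately show ?thesis by (rule tendsto_unique[rotated]) simp
qed

text \<open>The inverse transform is the adjoint \<open>f \<mapsto> cnj (\<F> (cnj f))\<close>; as it is isometric as well, it is a
  two-sided inverse and no inversion formula is needed.\<close>

definition inverse_fourier :: "L2 \<Rightarrow> L2" where
  "inverse_fourier f = cnj_L2 (fourier (cnj_L2 f))"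

lemma norm_inverse_fourier [simp]: "norm (inverse_fourier f) = norm f"
  by (simp add: inverse_fourier_def)

lemma linear_inverse_fourier: "linear inverse_fourier"
  unfolding inverse_fourier_def[abs_def]
  by (intro linearI) (simp_all add: linear_add[OF linear_fourier] linear_add[OF linear_cnj_L2]
      linear_scale[OF linear_fourier] linear_scale[OF linear_cnj_L2])

lemma inner_inverse_fourier: "inner (inverse_fourier f) (inverse_fourier g) = inner f g"
  by (simp add: inverse_fourier_def inner_cnj_L2 inner_fourier)

lemma inner_fourier_left: "inner (fourier f) g = inner f (inverse_fourier g)"
  using fourier_adjoint[of f "cnj_L2 g"] by (simp add: inverse_fourier_def)

lemma inverse_fourier_fourier [simp]: "inverse_fourier (fourier f) = f"
  by (rule vector_eq_ldot[THEN iffD1]) (metis inner_fourier_left inner_fourier)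

lemma fourier_inverse_fourier [simp]: "fourier (inverse_fourier f) = f"
  by (rule vector_eq_rdot[THEN iffD1]) (metis inner_fourier_left inner_inverse_fourier)

lemma inv_fourier: "inv fourier = inverse_fourier"
  by (rule inv_unique_comp) (auto simp: fun_eq_iff)

lemma inverse_fourier_imult: "inverse_fourier (imult f) = imult (inverse_fourier f)"
  by (metis fourier_const_mult fourier_inverse_fourier inverse_fourier_fourier)

section \<open>Sup bounds for transforms of integrable functions\<close>

text \<open>The bound \<open>?B\<close> holds everywhere for every truncated transform. The part of
  the limit exceeding \<open>?B\<close> is thus dominated by its distance to each truncated
  transform, whose square integral tends to 0.\<close>

lemma cmod_fourier_le:
  assumes "integrable lborel (rep_L2 f)"
  shows "AE \<xi> in lborel. cmod (rep_L2 (fourier f) \<xi>) \<le> 1 / sqrt (2 * pi) * (\<integral>x. cmod (rep_L2 f x) \<partial>lborel)"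
    (is "AE \<xi> in lborel. _ \<le> ?B")
proof -
  let ?g = "rep_L2 (fourier f)"
  have bd: "cmod (truncated_fourier R f \<xi>) \<le> ?B" for R \<xi>
  proof -
    have "cmod (truncated_fourier R f \<xi>) \<le> 1 / sqrt (2 * pi) * (\<integral>x. cmod (cutoff R f x) \<partial>lborel)"
      unfolding truncated_fourier_eq
      by (intro cmod_fourier_integral_le integrable_cutoff)
    also have "\<dots> \<le> ?B"
      by (intro mult_left_mono integral_mono integrable_norm assms
          integrable_cutoff)
         (auto simp: indicator_def)
    finally show ?thesis .
  qed
  let ?I = "\<integral>\<^sup>+\<xi>. ennreal ((max 0 (cmod (?g \<xi>) - ?B))\<^sup>2) \<partial>lborel"
  have le: "?I \<le> (\<integral>\<^sup>+\<xi>. ennreal ((cmod (truncated_fourier R f \<xi> - ?g \<xi>))\<^sup>2) \<partial>lborel)" for R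
  proof (rule nn_integral_mono, rule ennreal_leI, rule power_mono)
    fix \<xi>
    have "cmod (?g \<xi>) - cmod (truncated_fourier R f \<xi>) \<le> cmod (truncated_fourier R f \<xi> - ?g \<xi>)"
      by (metis norm_minus_commute norm_triangle_ineq2)
    then show "max 0 (cmod (?g \<xi>) - ?B) \<le> cmod (truncated_fourier R f \<xi> - ?g \<xi>)"
      using bd[of R \<xi>] by simp
  qed simp
  have "((\<lambda>R. \<integral>\<^sup>+\<xi>. ennreal ((cmod (truncated_fourier R f \<xi> - ?g \<xi>))\<^sup>2) \<partial>lborel) \<longlongrightarrow> 0) at_top"
    using truncated_fourier_tendsto[of f] by (simp add: has_fourier_iff[symmetric] has_fourier_def)
  then have "?I \<le> 0"
    by (rule tendsto_lowerbound) (intro always_eventually allI le, simp)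
  then have "AE \<xi> in lborel. ennreal ((max 0 (cmod (?g \<xi>) - ?B))\<^sup>2) = 0"
    by (subst (asm) le_zero_eq, subst (asm) nn_integral_0_iff_AE) auto
  then show ?thesis by eventually_elim (auto simp: max_def split: if_splits)
qed

lemma cmod_inverse_fourier_le:
  assumes "integrable lborel (rep_L2 f)"
  shows "AE x in lborel. cmod (rep_L2 (inverse_fourier f) x) \<le> 1 / sqrt (2 * pi) * (\<integral>\<xi>. cmod (rep_L2 f \<xi>) \<partial>lborel)"
proof -
  have c: "AE x in lborel. cmod (rep_L2 (cnj_L2 g) x) = cmod (rep_L2 g x)" for g
    using rep_cnj_L2[of g] by eventually_elim simp
  have "integrable lborel (\<lambda>x. cmod (rep_L2 f x))" using assms by simp
  then have "integrable lborel (\<lambda>x. cmod (rep_L2 (cnj_L2 f) x))"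
    by (subst integrable_cong_AE[OF _ _ c]) auto
  then have "integrable lborel (rep_L2 (cnj_L2 f))" by (subst (asm) integrable_norm_iff) auto
  from cmod_fourier_le[OF this] have "AE x in lborel. cmod (rep_L2 (fourier (cnj_L2 f)) x)
      \<le> 1 / sqrt (2 * pi) * (\<integral>\<xi>. cmod (rep_L2 f \<xi>) \<partial>lborel)"
    by (subst (asm) integral_cong_AE[OF _ _ c]) auto
  then show ?thesis
    unfolding inverse_fourier_def using c[of "fourier (cnj_L2 f)"] by eventually_elim simp
qed

section \<open>The unitary group and the Sobolev embedding\<close>

definition schroedinger_symbol :: "real \<Rightarrow> real \<Rightarrow> complex" where
  "schroedinger_symbol \<tau> \<xi> = cis (- (\<tau> * \<xi>\<^sup>2))"

lemma cmod_schroedinger_symbol: "cmod (schroedinger_symbol \<tau> \<xi>) = 1"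
  by (simp add: schroedinger_symbol_def)

lemma measurable_schroedinger_symbol [measurable]: "schroedinger_symbol \<tau> \<in> borel_measurable borel"
  unfolding schroedinger_symbol_def[abs_def] by (intro borel_measurable_continuous_onI continuous_intros)

lemmas schroedinger_symbol = measurable_schroedinger_symbol eq_refl[OF cmod_schroedinger_symbol]

lemma schroedinger_group_eq:
  "schroedinger_group \<tau> f = inverse_fourier (pointwise_mult (schroedinger_symbol \<tau>) (fourier f))"
  by (simp add: schroedinger_group_def inv_fourier schroedinger_symbol_def[abs_def] cis_conv_exp mult.assoc)

lemma linear_schroedinger_group: "linear (schroedinger_group \<tau>)"
  unfolding schroedinger_group_eq[abs_def]
  by (intro linearI)
     (simp_all only: linear_add[OF linear_fourier] linear_scale[OF linear_fourier]
      pointwise_mult_add[OF schroedinger_symbol] pointwise_mult_scaleR[OF schroedinger_symbol]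
      linear_add[OF linear_inverse_fourier] linear_scale[OF linear_inverse_fourier])

lemma inner_schroedinger_group: "inner (schroedinger_group \<tau> f) (schroedinger_group \<tau> g) = inner f g"
  by (simp only: schroedinger_group_eq inner_inverse_fourier inner_fourier
      inner_pointwise_mult[OF measurable_schroedinger_symbol cmod_schroedinger_symbol])

lemma norm_schroedinger_group [simp]: "norm (schroedinger_group \<tau> f) = norm f"
  by (simp add: norm_eq_sqrt_inner inner_schroedinger_group)

lemma bounded_linear_schroedinger_group: "bounded_linear (schroedinger_group \<tau>)"
  using linear_schroedinger_group[of \<tau>]
  by (intro bounded_linear_intro[where K = 1]) (auto simp: linear_add linear_scale)

lemma schroedinger_group_add:
  "schroedinger_group \<tau> (schroedinger_group \<tau>' f) = schroedinger_group (\<tau> + \<tau>') f"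
  unfolding schroedinger_group_eq fourier_inverse_fourier
    pointwise_mult_pointwise_mult[OF schroedinger_symbol schroedinger_symbol]
  by (simp add: schroedinger_symbol_def[abs_def] cis_mult algebra_simps)

lemma schroedinger_group_imult: "schroedinger_group \<tau> (imult f) = imult (schroedinger_group \<tau> f)"
proof -
  have "pointwise_mult (schroedinger_symbol \<tau>) (imult g) = imult (pointwise_mult (schroedinger_symbol \<tau>) g)" for g
    by (subst (1 2) pointwise_mult_pointwise_mult[where K = 1 and K' = 1])
       (auto simp: mult.commute cmod_schroedinger_symbol)
  then show ?thesis
    unfolding schroedinger_group_eq fourier_const_mult by (simp add: inverse_fourier_imult)
qed

section \<open>Sobolev norms as weighted \<open>L2\<close> norms\<close>

text \<open>On the Fourier side this is the Bessel potential of order \<open>s\<close>, the operator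
  (1 - Laplacian) to the power \<open>s / 2\<close>. It carries the Sobolev norm to the
  \<open>L2\<close> norm, so norm properties can be transferred.\<close>

definition bessel_fourier :: "real \<Rightarrow> L2 \<Rightarrow> real \<Rightarrow> complex" where
  "bessel_fourier s f \<xi> = of_real ((1 + \<xi>\<^sup>2) powr (s / 2)) * rep_L2 (fourier f) \<xi>"

lemma one_plus_square_pos: "0 < 1 + (x::real)\<^sup>2"
  by (simp add: add_pos_nonneg)

lemma cmod_bessel_fourier_sq:
  "(cmod (bessel_fourier s f \<xi>))\<^sup>2 = (1 + \<xi>\<^sup>2) powr s * (cmod (rep_L2 (fourier f) \<xi>))\<^sup>2"
  using one_plus_square_pos[of \<xi>]
  by (simp add: bessel_fourier_def norm_mult power_mult_distrib power2_eq_square[of "_ powr _"] flip: powr_add)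

lemma sobolev_iff: "f \<in> sobolev s \<longleftrightarrow> square_integrable (bessel_fourier s f)"
  unfolding square_integrable_def sobolev_def cmod_bessel_fourier_sq
  by (auto simp: bessel_fourier_def[abs_def])

text \<open>Membership matters: for any other \<open>f\<close> the integral in
  \<open>sobolev_norm\<close> takes the default value 0. Hence the norm estimates below also track
  membership in \<open>sobolev s\<close>.\<close>

lemma sobolev_norm_eq: "f \<in> sobolev s \<Longrightarrow> sobolev_norm s f = norm (abs_L2 (bessel_fourier s f))"
  unfolding sobolev_iff sobolev_norm_def cmod_bessel_fourier_sq[symmetric]
  by (simp flip: norm_abs_L2_sq)

lemma sobolev_norm_nonneg: "0 \<le> sobolev_norm s f"
  by (simp add: sobolev_norm_def)

lemma bessel_fourier_add: "AE \<xi> in lborel. bessel_fourier s (f + g) \<xi> = bessel_fourier s f \<xi> + bessel_fourier s g \<xi>"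
  using rep_L2_add[of "fourier f" "fourier g"]
  by eventually_elim (simp add: bessel_fourier_def linear_add[OF linear_fourier] distrib_left)

lemma bessel_fourier_scaleR: "AE \<xi> in lborel. bessel_fourier s (c *\<^sub>R f) \<xi> = of_real c * bessel_fourier s f \<xi>"
  using rep_L2_scaleR[of c "fourier f"]
  by eventually_elim (simp add: bessel_fourier_def linear_scale[OF linear_fourier] scaleR_conv_of_real mult_ac)

lemma borel_measurable_bessel_fourier [measurable]: "bessel_fourier s f \<in> borel_measurable borel"
  unfolding bessel_fourier_def[abs_def] by measurable

lemma sobolev_add:
  assumes "f \<in> sobolev s" "g \<in> sobolev s"
  shows "f + g \<in> sobolev s" "sobolev_norm s (f + g) \<le> sobolev_norm s f + sobolev_norm s g"
proof -
  have si: "square_integrable (bessel_fourier s f)" "square_integrable (bessel_fourier s g)"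
    using assms by (simp_all add: sobolev_iff)
  have eq: "AE \<xi> in lborel. bessel_fourier s f \<xi> + bessel_fourier s g \<xi> = bessel_fourier s (f + g) \<xi>"
    using bessel_fourier_add[of s f g] by eventually_elim simp
  have sa: "square_integrable (bessel_fourier s (f + g))"
    by (rule square_integrable_cong_AE[OF square_integrable_add[OF si] _ eq]) simp
  then show in_s: "f + g \<in> sobolev s" by (simp add: sobolev_iff)
  have "abs_L2 (bessel_fourier s (f + g)) = abs_L2 (bessel_fourier s f) + abs_L2 (bessel_fourier s g)"
    unfolding abs_L2_add[OF si] abs_L2_eq_iff[OF sa square_integrable_add[OF si]] by (rule bessel_fourier_add)
  then show "sobolev_norm s (f + g) \<le> sobolev_norm s f + sobolev_norm s g"
    using assms in_s by (simp add: sobolev_norm_eq norm_triangle_ineq)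
qed

lemma sobolev_scaleR:
  assumes "f \<in> sobolev s"
  shows "c *\<^sub>R f \<in> sobolev s" "sobolev_norm s (c *\<^sub>R f) = \<bar>c\<bar> * sobolev_norm s f"
proof -
  have si: "square_integrable (bessel_fourier s f)"
    using assms by (simp add: sobolev_iff)
  have eq: "AE \<xi> in lborel. of_real c * bessel_fourier s f \<xi> = bessel_fourier s (c *\<^sub>R f) \<xi>"
    using bessel_fourier_scaleR[of s c f] by eventually_elim simp
  have sa: "square_integrable (bessel_fourier s (c *\<^sub>R f))"
    by (rule square_integrable_cong_AE[OF square_integrable_mult[OF si] _ eq]) simp
  then show in_s: "c *\<^sub>R f \<in> sobolev s" by (simp add: sobolev_iff)
  have "abs_L2 (bessel_fourier s (c *\<^sub>R f)) = abs_L2 (\<lambda>\<xi>. of_real c * bessel_fourier s f \<xi>)"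
    unfolding abs_L2_eq_iff[OF sa square_integrable_mult[OF si]] by (rule bessel_fourier_scaleR)
  then show "sobolev_norm s (c *\<^sub>R f) = \<bar>c\<bar> * sobolev_norm s f"
    using assms in_s by (simp add: sobolev_norm_eq norm_abs_L2_cmult[OF si])
qed

lemma sobolev_diff:
  assumes "f \<in> sobolev s" "g \<in> sobolev s"
  shows "f - g \<in> sobolev s" "sobolev_norm s (f - g) \<le> sobolev_norm s f + sobolev_norm s g"
  using sobolev_add[OF assms(1) sobolev_scaleR(1)[OF assms(2), of "-1"]] sobolev_scaleR(2)[OF assms(2), of "-1"]
  by simp_all

text \<open>By Plancherel the left side is the norm of the transform, and the Sobolev weight is at
  least 1.\<close>

lemma norm_le_sobolev_norm:
  assumes f: "f \<in> sobolev s" and s: "0 \<le> s"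
  shows "norm f \<le> sobolev_norm s f"
proof (rule power2_le_imp_le)
  have si: "square_integrable (bessel_fourier s f)" using f by (simp add: sobolev_iff)
  have "(norm f)\<^sup>2 = (\<integral>\<xi>. (cmod (rep_L2 (fourier f) \<xi>))\<^sup>2 \<partial>lborel)"
    using norm_L2_sq[of "fourier f"] by simp
  also have "\<dots> \<le> (\<integral>\<xi>. (cmod (bessel_fourier s f \<xi>))\<^sup>2 \<partial>lborel)"
  proof (rule integral_mono)
    show "(cmod (rep_L2 (fourier f) \<xi>))\<^sup>2 \<le> (cmod (bessel_fourier s f \<xi>))\<^sup>2" for \<xi>
    proof -
      have "1 \<le> (1 + \<xi>\<^sup>2) powr s" using s by (intro ge_one_powr_ge_zero) auto
      then have "1 * (cmod (rep_L2 (fourier f) \<xi>))\<^sup>2 \<le> (1 + \<xi>\<^sup>2) powr s * (cmod (rep_L2 (fourier f) \<xi>))\<^sup>2"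
        by (intro mult_right_mono) auto
      then show ?thesis by (simp add: cmod_bessel_fourier_sq)
    qed
  qed (use si square_integrable_rep_L2[of "fourier f"] in \<open>auto simp: square_integrable_def\<close>)
  also have "\<dots> = (sobolev_norm s f)\<^sup>2" by (simp add: sobolev_norm_eq[OF f] norm_abs_L2_sq[OF si])
  finally show "(norm f)\<^sup>2 \<le> (sobolev_norm s f)\<^sup>2" .
qed (rule sobolev_norm_nonneg)

text \<open>The transform of \<open>f\<close> is its weighted version times \<open>w\<close>. Since
  \<open>w\<close> is square integrable, Cauchy-Schwarz makes the transform integrable, and the
  inverse transform of an integrable function is bounded. For \<open>1 \<le> s\<close> the square of
  \<open>w\<close> is dominated by \<open>inverse (1 + \<xi>\<^sup>2)\<close>.\<close>

lemma sobolev_embedding: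
  assumes s: "1 \<le> s"
  obtains K where "K > 0" "\<And>f. f \<in> sobolev s \<Longrightarrow> AE x in lborel. cmod (rep_L2 f x) \<le> K * sobolev_norm s f"
proof -
  define w where "w \<xi> = complex_of_real ((1 + \<xi>\<^sup>2) powr (- s / 2))" for \<xi> :: real
  have [measurable]: "w \<in> borel_measurable borel" unfolding w_def[abs_def] by measurable
  have "integrable lborel (\<lambda>x::real. inverse (1 + x\<^sup>2))"
    using integrable_inverse_1_plus_square by (simp add: set_integrable_def einterval_eq_UNIV)
  then have "integrable lborel (\<lambda>\<xi>. (cmod (w \<xi>))\<^sup>2)"
  proof (rule Bochner_Integration.integrable_bound)
    show "AE \<xi> in lborel. norm ((cmod (w \<xi>))\<^sup>2) \<le> norm (inverse (1 + \<xi>\<^sup>2))"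
    proof (rule AE_I2)
      fix \<xi> :: real
      have "(cmod (w \<xi>))\<^sup>2 = (1 + \<xi>\<^sup>2) powr (- s)"
        by (simp add: w_def power2_eq_square flip: powr_add)
      also have "\<dots> \<le> (1 + \<xi>\<^sup>2) powr (-1)" using s by (intro powr_mono) auto
      also have "\<dots> = inverse (1 + \<xi>\<^sup>2)" using one_plus_square_pos[of \<xi>] by (simp add: powr_minus)
      finally show "norm ((cmod (w \<xi>))\<^sup>2) \<le> norm (inverse (1 + \<xi>\<^sup>2))" by simp
    qed
  qed measurable
  then have sw: "square_integrable w" by (simp add: square_integrable_def)
  let ?K = "1 / sqrt (2 * pi) * norm (abs_L2 w)"
  \<comment> \<open>Adding 1 to \<open>?K\<close> gives a positive constant without a proof that
    \<open>w\<close> has nonzero norm.\<close>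
  have "AE x in lborel. cmod (rep_L2 f x) \<le> (?K + 1) * sobolev_norm s f" if f: "f \<in> sobolev s" for f
  proof -
    have si: "square_integrable (bessel_fourier s f)" using f by (simp add: sobolev_iff)
    have eq: "cmod (w \<xi>) * cmod (bessel_fourier s f \<xi>) = cmod (rep_L2 (fourier f) \<xi>)" for \<xi>
    proof -
      have "(1 + \<xi>\<^sup>2) powr (- s / 2) * (1 + \<xi>\<^sup>2) powr (s / 2) = 1"
        using one_plus_square_pos[of \<xi>] by (simp flip: powr_add)
      then show ?thesis by (simp add: w_def bessel_fourier_def norm_mult flip: mult.assoc)
    qed
    have int: "integrable lborel (rep_L2 (fourier f))"
      using integrable_cmod_mult[OF sw si] unfolding eq by (subst integrable_norm_iff[symmetric]) auto
    have "1 / sqrt (2 * pi) * (\<integral>\<xi>. cmod (rep_L2 (fourier f) \<xi>) \<partial>lborel)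
       \<le> 1 / sqrt (2 * pi) * (norm (abs_L2 w) * sobolev_norm s f)"
      using integral_cmod_mult_le[OF sw si] unfolding eq sobolev_norm_eq[OF f, symmetric]
      by (intro mult_left_mono) auto
    also have "\<dots> \<le> (?K + 1) * sobolev_norm s f"
      using sobolev_norm_nonneg[of s f] by (simp add: distrib_right)
    finally show ?thesis
      using cmod_inverse_fourier_le[OF int] by (auto elim!: eventually_mono)
  qed
  moreover have "0 < ?K + 1" by (intro add_nonneg_pos) auto
  ultimately show ?thesis using that by blast
qed

section \<open>Symmetry of the nonlinearity\<close>

definition power_nonlinearity :: "nat \<Rightarrow> complex \<Rightarrow> complex" where
  "power_nonlinearity \<sigma> z = of_real (cmod z ^ (2 * \<sigma>)) * z"

lemma measurable_power_nonlinearity [measurable]: "power_nonlinearity \<sigma> \<in> borel_measurable borel"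
  unfolding power_nonlinearity_def[abs_def] by measurable

text \<open>An essential bound on \<open>f\<close> makes the nonlinearity a bounded multiple of
  \<open>f\<close> in modulus, so the class formed by \<open>nonlinearity\<close> is
  meaningful.\<close>

lemma nonlinearity_bounded:
  assumes "AE x in lborel. cmod (rep_L2 f x) \<le> B"
  shows "square_integrable (\<lambda>x. power_nonlinearity \<sigma> (rep_L2 f x))"
    and "AE x in lborel. rep_L2 (nonlinearity \<sigma> f) x = power_nonlinearity \<sigma> (rep_L2 f x)"
    and "norm (nonlinearity \<sigma> f) \<le> B ^ (2 * \<sigma>) * norm f"
proof -
  have bd: "AE x in lborel. cmod (power_nonlinearity \<sigma> (rep_L2 f x)) \<le> B ^ (2 * \<sigma>) * cmod (rep_L2 f x)"
    using assms
    by eventually_elim (auto simp: power_nonlinearity_def norm_mult norm_power intro!: mult_right_mono power_mono)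
  show si: "square_integrable (\<lambda>x. power_nonlinearity \<sigma> (rep_L2 f x))"
    by (rule square_integrable_bound[OF square_integrable_rep_L2[of f] _ bd]) measurable
  have eq: "nonlinearity \<sigma> f = abs_L2 (\<lambda>x. power_nonlinearity \<sigma> (rep_L2 f x))"
    by (simp add: nonlinearity_def power_nonlinearity_def)
  show "AE x in lborel. rep_L2 (nonlinearity \<sigma> f) x = power_nonlinearity \<sigma> (rep_L2 f x)"
    unfolding eq by (rule rep_abs_L2[OF si])
  have B: "0 \<le> B ^ (2 * \<sigma>)" by simp
  have "(norm (nonlinearity \<sigma> f))\<^sup>2 \<le> (B ^ (2 * \<sigma>) * norm f)\<^sup>2"
  proof -
    have "(norm (nonlinearity \<sigma> f))\<^sup>2 = (\<integral>x. (cmod (power_nonlinearity \<sigma> (rep_L2 f x)))\<^sup>2 \<partial>lborel)"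
      unfolding eq by (rule norm_abs_L2_sq[OF si])
    also have "\<dots> \<le> (\<integral>x. (B ^ (2 * \<sigma>))\<^sup>2 * (cmod (rep_L2 f x))\<^sup>2 \<partial>lborel)"
    proof (rule integral_mono_AE)
      show "AE x in lborel. (cmod (power_nonlinearity \<sigma> (rep_L2 f x)))\<^sup>2 \<le> (B ^ (2 * \<sigma>))\<^sup>2 * (cmod (rep_L2 f x))\<^sup>2"
        using bd by eventually_elim (auto simp flip: power_mult_distrib intro: power_mono)
    qed (use si square_integrable_rep_L2[of f] in \<open>auto simp: square_integrable_def\<close>)
    finally show ?thesis by (simp add: norm_L2_sq power_mult_distrib)
  qed
  then show "norm (nonlinearity \<sigma> f) \<le> B ^ (2 * \<sigma>) * norm f"
    by (rule power2_le_imp_le) (simp add: B)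
qed

text \<open>Here \<open>2 * c * (u \<bullet> a)\<close> is the derivative of
  \<open>cmod z ^ (2 * \<sigma>)\<close> at \<open>u\<close> in direction \<open>a\<close>. With
  \<open>\<rho>\<close> and \<open>\<delta>\<close> the increment is \<open>\<delta>\<close> or
  \<open>2 * \<rho> * \<delta> + \<delta>\<^sup>2\<close>, and
  \<open>\<bar>\<delta>\<bar> \<le> 3 * B * cmod a\<close>. The constant \<open>C\<close> adds up
  all coefficients that occur: 1 (remainder) and \<open>3 * B\<close> (increment) for exponent 1,
  \<open>(2 + 9) * B\<^sup>2\<close> and \<open>(6 + 9) * B ^ 3\<close> for exponent 2.\<close>

lemma power_increment_bound:
  fixes u a :: complex
  assumes \<sigma>: "0 < \<sigma>" "\<sigma> \<le> 2" and B: "cmod u \<le> B" "cmod a \<le> B"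
  defines "\<theta> \<equiv> cmod (u + a) ^ (2 * \<sigma>) - cmod u ^ (2 * \<sigma>)"
    and "c \<equiv> real \<sigma> * cmod u ^ (2 * (\<sigma> - 1))" and "C \<equiv> 1 + 3 * B + 11 * B\<^sup>2 + 15 * B ^ 3"
  shows "\<bar>\<theta> - 2 * c * (u \<bullet> a)\<bar> \<le> C * (cmod a)\<^sup>2" "\<bar>\<theta>\<bar> \<le> C * cmod a"
proof -
  define \<rho> where "\<rho> = (cmod u)\<^sup>2"
  define \<delta> where "\<delta> = 2 * (u \<bullet> a) + (cmod a)\<^sup>2"
  have B0: "0 \<le> B" using order_trans[OF norm_ge_zero B(1)] .
  have ua: "(cmod (u + a))\<^sup>2 = \<rho> + \<delta>"
    by (simp add: \<rho>_def \<delta>_def power2_norm_eq_inner inner_add_left inner_add_right inner_commute)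
  have \<rho>: "0 \<le> \<rho>" "\<rho> \<le> B\<^sup>2" using B by (auto simp: \<rho>_def power_mono)
  have a2: "(cmod a)\<^sup>2 \<le> B * cmod a"
    unfolding power2_eq_square using B(2) by (intro mult_right_mono) auto
  have "\<bar>u \<bullet> a\<bar> \<le> cmod u * cmod a" by (rule Cauchy_Schwarz_ineq2)
  also have "\<dots> \<le> B * cmod a" using B(1) by (intro mult_right_mono) auto
  finally have "\<bar>u \<bullet> a\<bar> \<le> B * cmod a" .
  moreover have "0 \<le> (cmod a)\<^sup>2" by simp
  ultimately have \<delta>: "\<bar>\<delta>\<bar> \<le> 3 * B * cmod a" using a2 unfolding \<delta>_def by linarith
  have \<delta>2: "\<delta>\<^sup>2 \<le> 9 * B\<^sup>2 * (cmod a)\<^sup>2"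
    using power_mono[OF \<delta>, of 2] by (simp add: power_mult_distrib)
  consider "\<sigma> = 1" | "\<sigma> = 2" using \<sigma> by linarith
  then have "\<bar>\<theta> - 2 * c * (u \<bullet> a)\<bar> \<le> C * (cmod a)\<^sup>2 \<and> \<bar>\<theta>\<bar> \<le> C * cmod a"
  proof cases
    case 1
    then have \<theta>: "\<theta> = \<delta>" and c: "c = 1" using ua by (simp_all add: \<theta>_def c_def \<rho>_def)
    have "1 * (cmod a)\<^sup>2 \<le> C * (cmod a)\<^sup>2"
      using B0 unfolding C_def by (intro mult_right_mono) auto
    moreover have "3 * B * cmod a \<le> C * cmod a"
      using B0 unfolding C_def by (intro mult_right_mono) auto
    ultimately show ?thesis using \<delta> unfolding \<theta> c by (simp add: \<delta>_def)
  next
    case 2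
    have "cmod (u + a) ^ 4 = (\<rho> + \<delta>)\<^sup>2" "cmod u ^ 4 = \<rho>\<^sup>2"
      unfolding ua[symmetric] by (simp_all add: \<rho>_def flip: power_mult)
    then have \<theta>: "\<theta> = 2 * \<rho> * \<delta> + \<delta>\<^sup>2" and c: "c = 2 * \<rho>"
      using 2 by (simp_all add: \<theta>_def c_def \<rho>_def power2_eq_square algebra_simps)
    have "\<bar>\<theta> - 2 * c * (u \<bullet> a)\<bar> = 2 * \<rho> * (cmod a)\<^sup>2 + \<delta>\<^sup>2"
      using \<rho>(1) unfolding \<theta> c by (subst abs_of_nonneg) (auto simp: \<delta>_def algebra_simps)
    also have "\<dots> \<le> 2 * B\<^sup>2 * (cmod a)\<^sup>2 + 9 * B\<^sup>2 * (cmod a)\<^sup>2"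
      using \<rho>(2) \<delta>2 by (intro add_mono mult_right_mono) auto
    also have "\<dots> = 11 * B\<^sup>2 * (cmod a)\<^sup>2" by simp
    also have "\<dots> \<le> C * (cmod a)\<^sup>2"
      using B0 unfolding C_def by (intro mult_right_mono) auto
    finally have "\<bar>\<theta> - 2 * c * (u \<bullet> a)\<bar> \<le> C * (cmod a)\<^sup>2" .
    moreover have "\<bar>\<theta>\<bar> \<le> C * cmod a"
    proof -
      have "\<bar>\<theta>\<bar> \<le> 2 * \<rho> * \<bar>\<delta>\<bar> + \<delta>\<^sup>2"
        using \<rho>(1) abs_triangle_ineq[of "2 * \<rho> * \<delta>" "\<delta>\<^sup>2"] unfolding \<theta> by (simp add: abs_mult)
      also have "2 * \<rho> * \<bar>\<delta>\<bar> \<le> 2 * B\<^sup>2 * (3 * B * cmod a)"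
        using \<rho> \<delta> by (intro mult_mono) auto
      also have "\<delta>\<^sup>2 \<le> 9 * B\<^sup>2 * (B * cmod a)"
        by (rule order_trans[OF \<delta>2], rule mult_left_mono[OF a2]) simp
      also have "2 * B\<^sup>2 * (3 * B * cmod a) + 9 * B\<^sup>2 * (B * cmod a) = 15 * B ^ 3 * cmod a"
        by (simp add: power2_eq_square power3_eq_cube)
      also have "\<dots> \<le> C * cmod a"
        using B0 unfolding C_def by (intro mult_right_mono) auto
      finally show ?thesis by simp
    qed
    ultimately show ?thesis by simp
  qed
  then show "\<bar>\<theta> - 2 * c * (u \<bullet> a)\<bar> \<le> C * (cmod a)\<^sup>2" "\<bar>\<theta>\<bar> \<le> C * cmod a" by auto
qed

text \<open>The nonlinearity is the gradient of \<open>|z|\<^bsup>2\<sigma>+2\<^esup> / (2\<sigma> + 2)\<close>, so its derivative is symmetric: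
  the second-order terms cancel.\<close>

lemma power_nonlinearity_symmetric:
  fixes u a b :: complex
  assumes \<sigma>: "0 < \<sigma>" "\<sigma> \<le> 2" and B: "cmod u \<le> B" "cmod a \<le> B" "cmod b \<le> B"
  shows "\<bar>(power_nonlinearity \<sigma> (u + a) - power_nonlinearity \<sigma> u) \<bullet> b
      - (power_nonlinearity \<sigma> (u + b) - power_nonlinearity \<sigma> u) \<bullet> a\<bar>
    \<le> (1 + 3 * B + 11 * B\<^sup>2 + 15 * B ^ 3) * (B + 1) * (cmod a + cmod b) * (cmod a * cmod b)"
proof -
  define C where "C = 1 + 3 * B + 11 * B\<^sup>2 + 15 * B ^ 3"
  define c where "c = real \<sigma> * cmod u ^ (2 * (\<sigma> - 1))"
  define \<theta> where "\<theta> a = cmod (u + a) ^ (2 * \<sigma>) - cmod u ^ (2 * \<sigma>)" for a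
  have \<theta>: "\<bar>\<theta> x - 2 * c * (u \<bullet> x)\<bar> \<le> C * (cmod x)\<^sup>2" "\<bar>\<theta> x\<bar> \<le> C * cmod x" if "cmod x \<le> B" for x
    using power_increment_bound[OF \<sigma> B(1) that] unfolding C_def \<theta>_def c_def by auto
  \<comment> \<open>The difference is \<open>cmod u ^ (2 * \<sigma>)\<close> times \<open>x\<close>,
    plus \<open>\<theta> x\<close> times \<open>u + x\<close>. The first part is symmetric under
    exchange of \<open>x\<close> and \<open>y\<close>.\<close>
  have e: "(power_nonlinearity \<sigma> (u + x) - power_nonlinearity \<sigma> u) \<bullet> y
      = cmod u ^ (2 * \<sigma>) * (x \<bullet> y) + \<theta> x * (u \<bullet> y + x \<bullet> y)" for x y
    unfolding power_nonlinearity_def scaleR_conv_of_real[symmetric] inner_diff_left inner_scaleR_left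
      inner_add_left \<theta>_def by (simp add: algebra_simps)
  \<comment> \<open>The symmetric term \<open>2 * c * (u \<bullet> a) * (u \<bullet> b)\<close> is
    subtracted from both halves; every surviving product is of third order in \<open>a\<close> and
    \<open>b\<close>.\<close>
  have "(power_nonlinearity \<sigma> (u + a) - power_nonlinearity \<sigma> u) \<bullet> b
      - (power_nonlinearity \<sigma> (u + b) - power_nonlinearity \<sigma> u) \<bullet> a
     = (\<theta> a - 2 * c * (u \<bullet> a)) * (u \<bullet> b) - (\<theta> b - 2 * c * (u \<bullet> b)) * (u \<bullet> a) + (\<theta> a - \<theta> b) * (a \<bullet> b)"
    unfolding e by (simp add: algebra_simps inner_commute)
  also have "\<bar>\<dots>\<bar> \<le> \<bar>\<theta> a - 2 * c * (u \<bullet> a)\<bar> * \<bar>u \<bullet> b\<bar> + \<bar>\<theta> b - 2 * c * (u \<bullet> b)\<bar> * \<bar>u \<bullet> a\<bar>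
      + (\<bar>\<theta> a\<bar> + \<bar>\<theta> b\<bar>) * \<bar>a \<bullet> b\<bar>"
    unfolding abs_mult[symmetric]
    by (intro order_trans[OF abs_triangle_ineq] add_mono abs_triangle_ineq4)
       (auto simp: abs_mult intro!: mult_right_mono abs_triangle_ineq4)
  also have "\<dots> \<le> (C * (cmod a)\<^sup>2) * (B * cmod b) + (C * (cmod b)\<^sup>2) * (B * cmod a)
      + (C * cmod a + C * cmod b) * (cmod a * cmod b)"
  proof -
    have i: "\<bar>u \<bullet> x\<bar> \<le> B * cmod x" for x
      using order_trans[OF Cauchy_Schwarz_ineq2 mult_right_mono[OF B(1) norm_ge_zero]] .
    have "0 \<le> C" using order_trans[OF norm_ge_zero B(1)] by (simp add: C_def)
    then show ?thesis
      using \<theta>[OF B(2)] \<theta>[OF B(3)] i Cauchy_Schwarz_ineq2[of a b]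
      by (intro add_mono mult_mono) (auto intro: add_mono)
  qed
  also have "\<dots> = C * (B + 1) * (cmod a + cmod b) * (cmod a * cmod b)"
    by (simp add: algebra_simps power2_eq_square)
  finally show ?thesis unfolding C_def .
qed

text \<open>Lebesgue measure is not zero. This turns an almost everywhere bound on a modulus into
  nonnegativity of the bounding constant.\<close>

lemma AE_lborel_ex:
  assumes "AE x in lborel. P x" shows "\<exists>x::real. P x"
  using assms by (rule eventually_happens'[rotated]) (simp add: ae_filter_eq_bot_iff)

text \<open>The pointwise estimate is integrated. Its factor \<open>cmod a + cmod b\<close> is
  bounded by \<open>2 * m\<close> in sup norm, and the product of the two moduli by
  Cauchy-Schwarz.\<close>

lemma nonlinearity_symmetric:
  assumes \<sigma>: "0 < \<sigma>" "\<sigma> \<le> 2" and m: "m \<le> B"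
    and u: "AE x in lborel. cmod (rep_L2 u x) \<le> B"
    and a: "AE x in lborel. cmod (rep_L2 a x) \<le> m" and b: "AE x in lborel. cmod (rep_L2 b x) \<le> m"
  shows "\<bar>inner (nonlinearity \<sigma> (u + a) - nonlinearity \<sigma> u) b - inner (nonlinearity \<sigma> (u + b) - nonlinearity \<sigma> u) a\<bar>
    \<le> (1 + 3 * B + 11 * B\<^sup>2 + 15 * B ^ 3) * (B + 1) * (2 * m) * (norm a * norm b)"
proof -
  let ?n = "power_nonlinearity \<sigma>"
  let ?C = "(1 + 3 * B + 11 * B\<^sup>2 + 15 * B ^ 3) * (B + 1)"
  have "\<exists>x::real. cmod (rep_L2 u x) \<le> B"
    using AE_lborel_ex[OF u] by blast
  then have "0 \<le> B" using norm_ge_zero order_trans by blast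
  then have C: "0 \<le> ?C" by simp
  have sum: "AE x in lborel. cmod (rep_L2 (u + y) x) \<le> B + m" if "AE x in lborel. cmod (rep_L2 y x) \<le> m" for y
    using u that rep_L2_add[of u y] by eventually_elim (auto intro: norm_triangle_mono)
  have repd: "AE x in lborel. rep_L2 (nonlinearity \<sigma> (u + y) - nonlinearity \<sigma> u) x
      = ?n (rep_L2 u x + rep_L2 y x) - ?n (rep_L2 u x)" if "AE x in lborel. cmod (rep_L2 y x) \<le> m" for y
    using nonlinearity_bounded(2)[OF sum[OF that], of \<sigma>] nonlinearity_bounded(2)[OF u, of \<sigma>]
      rep_L2_minus[of "nonlinearity \<sigma> (u + y)" "nonlinearity \<sigma> u"] rep_L2_add[of u y]
    by eventually_elim simp
  let ?Na = "rep_L2 (nonlinearity \<sigma> (u + a) - nonlinearity \<sigma> u)"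
  let ?Nb = "rep_L2 (nonlinearity \<sigma> (u + b) - nonlinearity \<sigma> u)"
  have i: "integrable lborel (\<lambda>x. ?Na x \<bullet> rep_L2 b x)" "integrable lborel (\<lambda>x. ?Nb x \<bullet> rep_L2 a x)"
    by (intro square_integrable_inner square_integrable_rep_L2)+
  have eq: "inner (nonlinearity \<sigma> (u + a) - nonlinearity \<sigma> u) b - inner (nonlinearity \<sigma> (u + b) - nonlinearity \<sigma> u) a
     = (\<integral>x. ?Na x \<bullet> rep_L2 b x - ?Nb x \<bullet> rep_L2 a x \<partial>lborel)"
    unfolding inner_L2_rep using i by simp
  have "\<bar>\<integral>x. ?Na x \<bullet> rep_L2 b x - ?Nb x \<bullet> rep_L2 a x \<partial>lborel\<bar>
      \<le> (\<integral>x. ?C * (2 * m) * (cmod (rep_L2 a x) * cmod (rep_L2 b x)) \<partial>lborel)"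
  proof (rule order_trans[OF integral_abs_bound], rule integral_mono_AE)
    show "integrable lborel (\<lambda>x. \<bar>?Na x \<bullet> rep_L2 b x - ?Nb x \<bullet> rep_L2 a x\<bar>)" using i by simp
    show "integrable lborel (\<lambda>x. ?C * (2 * m) * (cmod (rep_L2 a x) * cmod (rep_L2 b x)))"
      by (intro integrable_mult_right integrable_cmod_mult square_integrable_rep_L2)
    show "AE x in lborel. \<bar>?Na x \<bullet> rep_L2 b x - ?Nb x \<bullet> rep_L2 a x\<bar>
        \<le> ?C * (2 * m) * (cmod (rep_L2 a x) * cmod (rep_L2 b x))"
      using repd[OF a] repd[OF b] u a b
    proof eventually_elim
      case (elim x)
      have "\<bar>?Na x \<bullet> rep_L2 b x - ?Nb x \<bullet> rep_L2 a x\<bar>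
        \<le> ?C * (cmod (rep_L2 a x) + cmod (rep_L2 b x)) * (cmod (rep_L2 a x) * cmod (rep_L2 b x))"
        unfolding elim(1,2)
        by (rule power_nonlinearity_symmetric[OF \<sigma>]) (use elim m in linarith)+
      also have "\<dots> \<le> ?C * (2 * m) * (cmod (rep_L2 a x) * cmod (rep_L2 b x))"
        using C elim by (intro mult_right_mono mult_left_mono) auto
      finally show ?case .
    qed
  qed
  also have "\<dots> = ?C * (2 * m) * (\<integral>x. cmod (rep_L2 a x) * cmod (rep_L2 b x) \<partial>lborel)" by simp
  also have "\<dots> \<le> ?C * (2 * m) * (norm a * norm b)"
  proof (rule mult_left_mono)
    have "\<exists>x::real. cmod (rep_L2 a x) \<le> m"
      using AE_lborel_ex[OF a] by blast
    then have "0 \<le> m" using norm_ge_zero order_trans by blast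
    then show "0 \<le> ?C * (2 * m)" by (intro mult_nonneg_nonneg[OF C]) simp
    show "(\<integral>x. cmod (rep_L2 a x) * cmod (rep_L2 b x) \<partial>lborel) \<le> norm a * norm b"
      using integral_cmod_mult_le[OF square_integrable_rep_L2 square_integrable_rep_L2, of a b] by simp
  qed
  finally show ?thesis unfolding eq .
qed

section \<open>Conservation of the symplectic form\<close>

text \<open>Over \<open>Suc n\<close> equal steps the linear errors add up to
  \<open>\<kappa> * (b - a)\<close>, while the quadratic ones total
  \<open>K * (b - a)\<^sup>2 / Suc n\<close> and vanish. This replaces the mean value theorem when
  no derivative is at hand.\<close>

lemma subdivision_bound:
  fixes y :: "real \<Rightarrow> real"
  assumes "a \<le> b"
    and step: "\<And>t t'. a \<le> t \<Longrightarrow> t \<le> t' \<Longrightarrow> t' \<le> b \<Longrightarrow> \<bar>y t' - y t\<bar> \<le> \<kappa> * (t' - t) + K * (t' - t)\<^sup>2"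
  shows "\<bar>y b - y a\<bar> \<le> \<kappa> * (b - a)"
proof -
  have n: "\<bar>y b - y a\<bar> \<le> \<kappa> * (b - a) + K * (b - a)\<^sup>2 / real (Suc n)" for n
  proof -
    define \<delta> where "\<delta> = (b - a) / real (Suc n)"
    have \<delta>: "0 \<le> \<delta>" "real (Suc n) * \<delta> = b - a" using assms(1) by (simp_all add: \<delta>_def)
    have "\<bar>y (a + real k * \<delta>) - y a\<bar> \<le> real k * (\<kappa> * \<delta> + K * \<delta>\<^sup>2)" if "k \<le> Suc n" for k
      using that
    proof (induction k)
      case (Suc k)
      have "real (Suc k) * \<delta> \<le> real (Suc n) * \<delta>" using Suc.prems \<delta>(1) by (intro mult_right_mono) auto
      then have "\<bar>y (a + real (Suc k) * \<delta>) - y (a + real k * \<delta>)\<bar>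
         \<le> \<kappa> * ((a + real (Suc k) * \<delta>) - (a + real k * \<delta>)) + K * ((a + real (Suc k) * \<delta>) - (a + real k * \<delta>))\<^sup>2"
        using \<delta> by (intro step) (auto intro!: mult_right_mono)
      also have "(a + real (Suc k) * \<delta>) - (a + real k * \<delta>) = \<delta>" by (simp add: algebra_simps)
      finally show ?case using Suc by (simp add: distrib_right)
    qed simp
    from this[of "Suc n"] have "\<bar>y b - y a\<bar> \<le> real (Suc n) * (\<kappa> * \<delta> + K * \<delta>\<^sup>2)"
      using \<delta>(2) by (simp del: of_nat_Suc)
    also have "\<dots> = \<kappa> * (b - a) + K * (b - a)\<^sup>2 / real (Suc n)"
      by (simp add: \<delta>_def field_simps power2_eq_square del: of_nat_Suc)
    finally show ?thesis .
  qed
  have "(\<lambda>n. \<kappa> * (b - a) + K * (b - a)\<^sup>2 / real (Suc n)) \<longlonglongrightarrow> \<kappa> * (b - a) + 0"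
    by (intro tendsto_add tendsto_const LIMSEQ_Suc[OF lim_const_over_n])
  then show ?thesis
    by (intro LIMSEQ_le_const[of _ "\<kappa> * (b - a)"]) (use n in auto)
qed

lemma has_integral_tail:
  fixes f :: "real \<Rightarrow> 'a::banach"
  assumes "a \<le> b" "b \<le> c" "(f has_integral i) {a..b}" "(f has_integral j) {a..c}"
  shows "(f has_integral (j - i)) {b..c}"
proof -
  have "f integrable_on {b..c}"
    by (rule integrable_subinterval_real[of f a c]) (use assms in \<open>auto simp: integrable_on_def\<close>)
  then obtain k where k: "(f has_integral k) {b..c}" by (auto simp: integrable_on_def)
  from has_integral_combine[OF assms(1,2,3) k] have "(f has_integral i + k) {a..c}" .
  with assms(4) have "j = i + k" by (rule has_integral_unique)
  with k show ?thesis by simp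
qed

text \<open>A product rule in integrated form: \<open>P\<close> and \<open>Q\<close> act as the
  derivatives of \<open>A\<close> and \<open>B\<close>, but are only integrable and bounded. The
  crude bound \<open>C\<close> enters quadratic errors alone, so it does not affect the rate
  \<open>\<kappa>\<close>.\<close>

lemma inner_increment_bound:
  fixes A B P Q :: "real \<Rightarrow> 'a::{banach, real_inner}"
  assumes ab: "a \<le> b"
    and P: "\<And>t t'. a \<le> t \<Longrightarrow> t \<le> t' \<Longrightarrow> t' \<le> b \<Longrightarrow> (P has_integral (A t' - A t)) {t..t'}"
    and Q: "\<And>t t'. a \<le> t \<Longrightarrow> t \<le> t' \<Longrightarrow> t' \<le> b \<Longrightarrow> (Q has_integral (B t' - B t)) {t..t'}"
    and C: "0 \<le> C" "\<And>t. a \<le> t \<Longrightarrow> t \<le> b \<Longrightarrow> norm (P t) \<le> C" "\<And>t. a \<le> t \<Longrightarrow> t \<le> b \<Longrightarrow> norm (Q t) \<le> C"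
    and \<kappa>: "\<And>t. a \<le> t \<Longrightarrow> t \<le> b \<Longrightarrow> \<bar>inner (P t) (B t) + inner (A t) (Q t)\<bar> \<le> \<kappa>"
  shows "\<bar>inner (A b) (B b) - inner (A a) (B a)\<bar> \<le> \<kappa> * (b - a)"
proof (rule subdivision_bound[OF ab, of _ _ "3 * C\<^sup>2"])
  fix t t' assume t: "a \<le> t" "t \<le> t'" "t' \<le> b"
  have dA: "norm (A r - A t) \<le> C * (r - t)" if "t \<le> r" "r \<le> t'" for r
    using has_integral_bound_real[OF C(1) finite.emptyI P[of t r]] C(2) that t by auto
  have dB: "norm (B r - B t) \<le> C * (r - t)" if "t \<le> r" "r \<le> t'" for r
    using has_integral_bound_real[OF C(1) finite.emptyI Q[of t r]] C(3) that t by auto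
  have t0: "0 \<le> t' - t" using t by simp
  have \<kappa>0: "0 \<le> \<kappa>" using \<kappa>[of t] t abs_ge_zero order_trans by (metis order.trans)
  \<comment> \<open>Freezing \<open>A\<close> and \<open>B\<close> at the left endpoint makes the
    integrand linear in \<open>P\<close> and \<open>Q\<close>, hence integrable. Freezing costs at
    most \<open>2 * C\<^sup>2 * (t' - t)\<close> in the integrand, and the product of the two
    increments adds \<open>C\<^sup>2 * (t' - t)\<^sup>2\<close>; together these give the factor
    3.\<close>
  let ?f = "\<lambda>r. inner (P r) (B t) + inner (A t) (Q r)"
  have "(?f has_integral (inner (A t' - A t) (B t) + inner (A t) (B t' - B t))) {t..t'}"
    using has_integral_linear[OF P[OF t] bounded_linear_inner_left[of "B t"]]
      has_integral_linear[OF Q[OF t] bounded_linear_inner_right[of "A t"]]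
    by (intro has_integral_add) (simp_all add: o_def)
  then have "norm (inner (A t' - A t) (B t) + inner (A t) (B t' - B t)) \<le> (\<kappa> + 2 * C\<^sup>2 * (t' - t)) * measure lborel {t..t'}"
  proof (rule has_integral_bound_real[OF _ finite.emptyI, of "\<kappa> + 2 * C\<^sup>2 * (t' - t)" ?f, rotated])
    show "0 \<le> \<kappa> + 2 * C\<^sup>2 * (t' - t)" using \<kappa>0 t0 by simp
    fix r assume "r \<in> {t..t'} - {}"
    then have r: "t \<le> r" "r \<le> t'" "a \<le> r" "r \<le> b" using t by auto
    have C2: "C * (C * (r - t)) \<le> C\<^sup>2 * (t' - t)"
      using r C(1) by (auto simp: power2_eq_square mult.assoc intro!: mult_left_mono)
    have "\<bar>inner (P r) (B r - B t)\<bar> \<le> C * (C * (r - t))"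
      by (rule order_trans[OF Cauchy_Schwarz_ineq2], intro mult_mono C dB r) (use C(1) r in auto)
    moreover have "\<bar>inner (A r - A t) (Q r)\<bar> \<le> (C * (r - t)) * C"
      by (rule order_trans[OF Cauchy_Schwarz_ineq2], intro mult_mono C dA r) (use C(1) r in auto)
    moreover have "?f r = (inner (P r) (B r) + inner (A r) (Q r)) - inner (P r) (B r - B t) - inner (A r - A t) (Q r)"
      by (simp add: inner_diff_left inner_diff_right)
    ultimately show "norm (?f r) \<le> \<kappa> + 2 * C\<^sup>2 * (t' - t)"
      using \<kappa>[OF r(3,4)] C2 by (simp add: mult_ac)
  qed
  then have "\<bar>inner (A t' - A t) (B t) + inner (A t) (B t' - B t)\<bar> \<le> (\<kappa> + 2 * C\<^sup>2 * (t' - t)) * (t' - t)"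
    using t by simp
  moreover have "\<bar>inner (A t' - A t) (B t' - B t)\<bar> \<le> (C * (t' - t)) * (C * (t' - t))"
    by (rule order_trans[OF Cauchy_Schwarz_ineq2], intro mult_mono dA dB) (use C(1) t in auto)
  moreover have "inner (A t') (B t') - inner (A t) (B t)
      = (inner (A t' - A t) (B t) + inner (A t) (B t' - B t)) + inner (A t' - A t) (B t' - B t)"
    by (simp add: inner_diff_left inner_diff_right)
  ultimately show "\<bar>inner (A t') (B t') - inner (A t) (B t)\<bar> \<le> \<kappa> * (t' - t) + 3 * C\<^sup>2 * (t' - t)\<^sup>2"
    by (simp add: algebra_simps power2_eq_square)
qed

section \<open>Mild solutions and increments of the flow\<close>

text \<open>The interaction picture \<open>S(0, t) u(t)\<close> turns the mild equation into an ordinary integral equation.\<close>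

lemma mild_solution_interaction:
  assumes m: "mild_solution \<sigma> s w u\<^sub>0 u" and t: "0 \<le> t" "t \<le> t'"
  shows "((\<lambda>r. imult (schroedinger_group (w 0 - w r) (nonlinearity \<sigma> (u r)))) has_integral
    (schroedinger_group (w 0 - w t') (u t') - schroedinger_group (w 0 - w t) (u t))) {t..t'}"
proof -
  let ?G = "\<lambda>r. imult (schroedinger_group (w 0 - w r) (nonlinearity \<sigma> (u r)))"
  \<comment> \<open>Applying \<open>schroedinger_group (w 0 - w t)\<close> removes \<open>t\<close>
    from the integrand. The term \<open>schroedinger_group 0 u\<^sub>0\<close> may stay unevaluated:
    it cancels when the values at two times are subtracted.\<close>
  have *: "(?G has_integral (schroedinger_group (w 0 - w t) (u t) - schroedinger_group 0 u\<^sub>0)) {0..t}" if "0 \<le> t" for t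
  proof -
    from m that obtain I where I: "((\<lambda>r. schroedinger_group (w t - w r) (nonlinearity \<sigma> (u r))) has_integral I) {0..t}"
      and u: "u t = schroedinger_group (w t - w 0) u\<^sub>0 + imult I"
      unfolding mild_solution_def by blast
    have "schroedinger_group (w 0 - w t) (u t) - schroedinger_group 0 u\<^sub>0 = imult (schroedinger_group (w 0 - w t) I)"
      unfolding u linear_add[OF linear_schroedinger_group] schroedinger_group_add schroedinger_group_imult by simp
    moreover have "((imult \<circ> (schroedinger_group (w 0 - w t) \<circ> (\<lambda>r. schroedinger_group (w t - w r) (nonlinearity \<sigma> (u r)))))
        has_integral imult (schroedinger_group (w 0 - w t) I)) {0..t}"
      by (intro has_integral_linear bounded_linear_imult bounded_linear_schroedinger_group I)
    ultimately show ?thesis by (simp add: o_def schroedinger_group_add)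
  qed
  show ?thesis
    using has_integral_tail[OF t *[OF t(1)] *[of t']] t by simp
qed

text \<open>The Sobolev space is a set without a topology of its own here, so compactness is applied
  to the real function \<open>sobolev_norm s (u t)\<close>, which is continuous by the reverse
  triangle inequality.\<close>

lemma sobolev_path_bounded:
  assumes u: "sobolev_path s u"
  obtains B where "\<And>t. 0 \<le> t \<Longrightarrow> t \<le> T \<Longrightarrow> sobolev_norm s (u t) \<le> B"
proof -
  have in_s: "u t \<in> sobolev s" if "0 \<le> t" for t using u that by (simp add: sobolev_path_def)
  have lip: "\<bar>sobolev_norm s (u r) - sobolev_norm s (u t)\<bar> \<le> sobolev_norm s (u r - u t)" if "0 \<le> t" "0 \<le> r" for r t
  proof -
    note d = sobolev_diff(1)[OF in_s[OF that(2)] in_s[OF that(1)]]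
    have "sobolev_norm s (u r) \<le> sobolev_norm s (u r - u t) + sobolev_norm s (u t)"
      using sobolev_add(2)[OF d in_s[OF that(1)]] by simp
    moreover have "sobolev_norm s (u t) \<le> sobolev_norm s (u r) + sobolev_norm s (u r - u t)"
      using sobolev_diff(2)[OF in_s[OF that(2)] d] by simp
    ultimately show ?thesis by linarith
  qed
  have "continuous_on {0..} (\<lambda>t. sobolev_norm s (u t))"
    unfolding continuous_on_def
  proof
    fix t :: real assume t: "t \<in> {0..}"
    then have "((\<lambda>r. sobolev_norm s (u r - u t)) \<longlongrightarrow> 0) (at t within {0..})"
      using u by (simp add: sobolev_path_def)
    moreover have "\<forall>\<^sub>F r in at t within {0..}. norm (sobolev_norm s (u r) - sobolev_norm s (u t)) \<le> sobolev_norm s (u r - u t)"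
      using t lip by (auto simp: eventually_at_filter)
    ultimately have "((\<lambda>r. sobolev_norm s (u r) - sobolev_norm s (u t)) \<longlongrightarrow> 0) (at t within {0..})"
      by (rule Lim_null_comparison[rotated])
    then show "((\<lambda>t. sobolev_norm s (u t)) \<longlongrightarrow> sobolev_norm s (u t)) (at t within {0..})"
      by (rule LIM_zero_cancel)
  qed
  then have "continuous_on {0..T} (\<lambda>t. sobolev_norm s (u t))" by (rule continuous_on_subset) auto
  then have "bounded ((\<lambda>t. sobolev_norm s (u t)) ` {0..T})"
    by (intro compact_imp_bounded compact_continuous_image) auto
  then obtain B where "\<forall>x\<in>(\<lambda>t. sobolev_norm s (u t)) ` {0..T}. norm x \<le> B" unfolding bounded_iff ..
  then show ?thesis by (intro that[of B]) (auto intro: order_trans[OF abs_ge_self])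
qed

lemma symplectic_structure_eq: "symplectic_structure D t \<xi> \<eta> = inner (imult (D \<xi> t)) (D \<eta> t)"
  unfolding symplectic_structure_def inner_L2_rep
proof (rule integral_cong_AE)
  show "AE x in lborel. wedge (dp D t x) (dq D t x) \<xi> \<eta> = rep_L2 (imult (D \<xi> t)) x \<bullet> rep_L2 (D \<eta> t) x"
    using rep_pointwise_mult(2)[of "\<lambda>x. \<i>" 1 "D \<xi> t", simplified]
    by eventually_elim (simp add: wedge_def dp_def dq_def inner_complex_def)
qed (simp_all add: wedge_def dp_def dq_def)

text \<open>The definition of \<open>flow_differential\<close> bounds \<open>D \<xi>\<close> in time
  only indirectly: one quotient, at \<open>h\<^sub>0\<close>, stays within distance 1 of it, and
  this quotient is bounded because the two solution paths are. All nearby quotients are then bounded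
  by \<open>1 + M\<close>.\<close>

lemma flow_differential_difference_bound:
  assumes \<phi>: "\<And>u\<^sub>0. u\<^sub>0 \<in> sobolev s \<Longrightarrow> mild_solution \<sigma> s w u\<^sub>0 (\<phi> u\<^sub>0)"
    and u\<^sub>0: "u\<^sub>0 \<in> sobolev s" and D: "flow_differential s \<phi> u\<^sub>0 D" and \<xi>: "\<xi> \<in> sobolev s" and T: "0 \<le> T"
  obtains M where "\<forall>\<^sub>F h in at 0. \<forall>t\<in>{0..T}. sobolev_norm s (\<phi> (u\<^sub>0 + h *\<^sub>R \<xi>) t - \<phi> u\<^sub>0 t) \<le> \<bar>h\<bar> * M"
proof -
  have uh: "u\<^sub>0 + h *\<^sub>R \<xi> \<in> sobolev s" for h by (intro sobolev_add(1) sobolev_scaleR(1) u\<^sub>0 \<xi>)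
  have path: "sobolev_path s (\<phi> v)" if "v \<in> sobolev s" for v using \<phi>[OF that] by (simp add: mild_solution_def)
  have in_s: "\<phi> v t \<in> sobolev s" if "v \<in> sobolev s" "0 \<le> t" for v t using path[OF that(1)] that(2) by (simp add: sobolev_path_def)
  let ?a = "\<lambda>h t. \<phi> (u\<^sub>0 + h *\<^sub>R \<xi>) t - \<phi> u\<^sub>0 t"
  have a: "?a h t \<in> sobolev s" if "0 \<le> t" for h t by (intro sobolev_diff(1) in_s uh u\<^sub>0 that)
  have Ds: "D \<xi> t \<in> sobolev s" if "0 \<le> t" for t using D \<xi> that by (simp add: flow_differential_def)
  have "uniform_limit {0..T} (\<lambda>h t. sobolev_norm s ((1 / h) *\<^sub>R ?a h t - D \<xi> t)) (\<lambda>t. 0) (at 0)"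
    using D \<xi> T by (simp add: flow_differential_def)
  from uniform_limitD[OF this, of 1]
  have ev: "\<forall>\<^sub>F h in at 0. \<forall>t\<in>{0..T}. sobolev_norm s ((1 / h) *\<^sub>R ?a h t - D \<xi> t) < 1"
    by (simp add: sobolev_norm_nonneg)
  then obtain h\<^sub>0 where h\<^sub>0: "\<forall>t\<in>{0..T}. sobolev_norm s ((1 / h\<^sub>0) *\<^sub>R ?a h\<^sub>0 t - D \<xi> t) < 1"
    using eventually_happens'[OF at_neq_bot ev] by blast
  obtain B\<^sub>1 where B\<^sub>1: "\<And>t. 0 \<le> t \<Longrightarrow> t \<le> T \<Longrightarrow> sobolev_norm s (\<phi> (u\<^sub>0 + h\<^sub>0 *\<^sub>R \<xi>) t) \<le> B\<^sub>1"
    by (rule sobolev_path_bounded[OF path[OF uh]]) blast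
  obtain B\<^sub>0 where B\<^sub>0: "\<And>t. 0 \<le> t \<Longrightarrow> t \<le> T \<Longrightarrow> sobolev_norm s (\<phi> u\<^sub>0 t) \<le> B\<^sub>0"
    by (rule sobolev_path_bounded[OF path[OF u\<^sub>0]]) blast
  define M where "M = \<bar>1 / h\<^sub>0\<bar> * (B\<^sub>1 + B\<^sub>0) + 1"
  have DM: "sobolev_norm s (D \<xi> t) \<le> M" if t: "t \<in> {0..T}" for t
  proof -
    have t0: "0 \<le> t" using t by simp
    have sc: "(1 / h\<^sub>0) *\<^sub>R ?a h\<^sub>0 t \<in> sobolev s" by (intro sobolev_scaleR(1) a t0)
    have "sobolev_norm s (?a h\<^sub>0 t) \<le> B\<^sub>1 + B\<^sub>0"
      using sobolev_diff(2)[OF in_s[OF uh t0] in_s[OF u\<^sub>0 t0], of h\<^sub>0] B\<^sub>1[of t] B\<^sub>0[of t] t by auto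
    then have "sobolev_norm s ((1 / h\<^sub>0) *\<^sub>R ?a h\<^sub>0 t) \<le> \<bar>1 / h\<^sub>0\<bar> * (B\<^sub>1 + B\<^sub>0)"
      unfolding sobolev_scaleR(2)[OF a[OF t0]] by (intro mult_left_mono) auto
    moreover have "sobolev_norm s (D \<xi> t)
       \<le> sobolev_norm s ((1 / h\<^sub>0) *\<^sub>R ?a h\<^sub>0 t) + sobolev_norm s ((1 / h\<^sub>0) *\<^sub>R ?a h\<^sub>0 t - D \<xi> t)"
      using sobolev_diff(2)[OF sc sobolev_diff(1)[OF sc Ds[OF t0]]] by simp
    ultimately show ?thesis using bspec[OF h\<^sub>0 t] by (simp add: M_def)
  qed
  have "\<forall>\<^sub>F h in at 0. \<forall>t\<in>{0..T}. sobolev_norm s (?a h t) \<le> \<bar>h\<bar> * (1 + M)"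
    using ev eventually_neq_at_within[of 0 0 UNIV]
  proof eventually_elim
    case (elim h)
    show ?case
    proof
      fix t assume t: "t \<in> {0..T}"
      then have t0: "0 \<le> t" by simp
      have sc: "(1 / h) *\<^sub>R ?a h t \<in> sobolev s" by (intro sobolev_scaleR(1) a t0)
      have "sobolev_norm s (?a h t) = \<bar>h\<bar> * sobolev_norm s ((1 / h) *\<^sub>R ?a h t)"
        using sobolev_scaleR(2)[OF sc, of h] elim(2) by simp
      also have "sobolev_norm s ((1 / h) *\<^sub>R ?a h t) \<le> 1 + M"
        using sobolev_add(2)[OF sobolev_diff(1)[OF sc Ds[OF t0]] Ds[OF t0]] elim(1) t DM[OF t] by force
      finally show "sobolev_norm s (?a h t) \<le> \<bar>h\<bar> * (1 + M)" by (simp add: mult_left_mono)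
    qed
  qed
  then show ?thesis by (rule that)
qed

text \<open>The bound is cubic in \<open>e\<close>: the factor \<open>K * e\<close> is the sup norm
  of an increment via the embedding, and \<open>e * e\<close> bounds the two \<open>L2\<close>
  norms. This surplus over the quadratic size of the form is what makes the limit work.\<close>

lemma symplectic_difference_bound:
  assumes \<sigma>: "0 < \<sigma>" "\<sigma> \<le> 2" and s: "0 \<le> s" and t: "0 \<le> t\<^sub>0" "t\<^sub>0 \<le> t\<^sub>1"
    and m: "mild_solution \<sigma> s w u\<^sub>0 u" "mild_solution \<sigma> s w v\<^sub>0 v" "mild_solution \<sigma> s w z\<^sub>0 z"
    and K: "0 \<le> K" "\<And>f. f \<in> sobolev s \<Longrightarrow> AE x in lborel. cmod (rep_L2 f x) \<le> K * sobolev_norm s f"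
    and N: "\<And>t. 0 \<le> t \<Longrightarrow> t \<le> t\<^sub>1 \<Longrightarrow> sobolev_norm s (u t) \<le> N"
    and e: "\<And>t. 0 \<le> t \<Longrightarrow> t \<le> t\<^sub>1 \<Longrightarrow> sobolev_norm s (v t - u t) \<le> e"
      "\<And>t. 0 \<le> t \<Longrightarrow> t \<le> t\<^sub>1 \<Longrightarrow> sobolev_norm s (z t - u t) \<le> e"
    and B: "K * N \<le> B" "K * e \<le> B"
  shows "\<bar>inner (imult (v t\<^sub>1 - u t\<^sub>1)) (z t\<^sub>1 - u t\<^sub>1) - inner (imult (v t\<^sub>0 - u t\<^sub>0)) (z t\<^sub>0 - u t\<^sub>0)\<bar>
    \<le> (1 + 3 * B + 11 * B\<^sup>2 + 15 * B ^ 3) * (B + 1) * (2 * (K * e)) * (e * e) * (t\<^sub>1 - t\<^sub>0)"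
proof -
  let ?S = "\<lambda>t. schroedinger_group (w 0 - w t)"
  let ?N = "nonlinearity \<sigma>"
  let ?C = "(1 + 3 * B + 11 * B\<^sup>2 + 15 * B ^ 3) * (B + 1)"
  have in_s: "u t \<in> sobolev s" "v t \<in> sobolev s" "z t \<in> sobolev s" if "0 \<le> t" for t
    using m that by (auto simp: mild_solution_def sobolev_path_def)
  have N0: "0 \<le> N" using N[of 0] t sobolev_norm_nonneg[of s "u 0"] by simp
  have e0: "0 \<le> e" using e(1)[of 0] t sobolev_norm_nonneg[of s "v 0 - u 0"] by simp
  have B0: "0 \<le> B" using B(1) K(1) N0 by (meson mult_nonneg_nonneg order_trans)
  have C0: "0 \<le> ?C" using B0 by simp
  have bd: "AE x in lborel. cmod (rep_L2 f x) \<le> K * b" if "f \<in> sobolev s" "sobolev_norm s f \<le> b" for f b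
    using K(2)[OF that(1)] by eventually_elim (rule order_trans[OF _ mult_left_mono[OF that(2) K(1)]])
  have Nb: "norm (?N f) \<le> (K * (N + e)) ^ (2 * \<sigma>) * (N + e)" if "f \<in> sobolev s" "sobolev_norm s f \<le> N + e" for f
  proof -
    have "norm (?N f) \<le> (K * (N + e)) ^ (2 * \<sigma>) * norm f" by (rule nonlinearity_bounded(3)[OF bd[OF that]])
    also have "\<dots> \<le> (K * (N + e)) ^ (2 * \<sigma>) * (N + e)"
      using order_trans[OF norm_le_sobolev_norm[OF that(1) s] that(2)] by (intro mult_left_mono) auto
    finally show ?thesis .
  qed
  have big: "sobolev_norm s f \<le> N + e"
    if "0 \<le> t" "t \<le> t\<^sub>1" "f \<in> sobolev s" "sobolev_norm s (f - u t) \<le> e" for f t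
    using sobolev_add(2)[OF sobolev_diff(1)[OF that(3) in_s(1)[OF that(1)]] in_s(1)[OF that(1)]] N[OF that(1,2)] that(4) by simp
  \<comment> \<open>A crude bound, of order 0 in \<open>e\<close>, suffices for the size of the
    integrands: it enters only the errors that disappear under subdivision.\<close>
  define L where "L = 2 * ((K * (N + e)) ^ (2 * \<sigma>) * (N + e))"
  have L0: "0 \<le> L" using N0 e0 K(1) by (simp add: L_def)
  have dN: "norm (?N f - ?N (u t)) \<le> L"
    if "0 \<le> t" "t \<le> t\<^sub>1" "f \<in> sobolev s" "sobolev_norm s (f - u t) \<le> e" for f t
  proof -
    have "norm (?N (u t)) \<le> (K * (N + e)) ^ (2 * \<sigma>) * (N + e)"
      by (rule Nb[OF in_s(1)[OF that(1)]]) (use N[OF that(1,2)] e0 in simp)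
    with Nb[OF that(3) big[OF that]] norm_triangle_ineq4[of "?N f" "?N (u t)"]
    show ?thesis unfolding L_def by linarith
  qed
  have "\<bar>inner (imult (?S t\<^sub>1 (v t\<^sub>1 - u t\<^sub>1))) (?S t\<^sub>1 (z t\<^sub>1 - u t\<^sub>1))
      - inner (imult (?S t\<^sub>0 (v t\<^sub>0 - u t\<^sub>0))) (?S t\<^sub>0 (z t\<^sub>0 - u t\<^sub>0))\<bar>
    \<le> (?C * (2 * (K * e)) * (e * e)) * (t\<^sub>1 - t\<^sub>0)"
  \<comment> \<open>The path \<open>A\<close> carries the extra \<open>imult\<close> of the form,
    and the interaction equation contributes another one; their product is the minus sign in
    \<open>P\<close>.\<close>
  proof (rule inner_increment_bound[OF t(2), where P = "\<lambda>r. - ?S r (?N (v r) - ?N (u r))"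
        and Q = "\<lambda>r. imult (?S r (?N (z r) - ?N (u r)))" and A = "\<lambda>t. imult (?S t (v t - u t))"
        and B = "\<lambda>t. ?S t (z t - u t)" and C = L])
    note lin = linear_diff[OF linear_schroedinger_group] linear_diff[OF linear_imult] linear_add[OF linear_imult]
    fix r r' assume r: "t\<^sub>0 \<le> r" "r \<le> r'" "r' \<le> t\<^sub>1"
    then have r0: "0 \<le> r" using t by simp
    note int = mild_solution_interaction[OF m(1) r0 r(2)] mild_solution_interaction[OF m(2) r0 r(2)]
      mild_solution_interaction[OF m(3) r0 r(2)]
    show "((\<lambda>r. imult (?S r (?N (z r) - ?N (u r)))) has_integral (?S r' (z r' - u r') - ?S r (z r - u r))) {r..r'}"
      using has_integral_diff[OF int(3) int(1)] by (simp add: lin algebra_simps)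
    have "((imult \<circ> (\<lambda>r. imult (?S r (?N (v r))) - imult (?S r (?N (u r))))) has_integral
        imult ((?S r' (v r') - ?S r (v r)) - (?S r' (u r') - ?S r (u r)))) {r..r'}"
      by (intro has_integral_linear[OF _ bounded_linear_imult] has_integral_diff int)
    then show "((\<lambda>r. - ?S r (?N (v r) - ?N (u r))) has_integral
        (imult (?S r' (v r' - u r')) - imult (?S r (v r - u r)))) {r..r'}"
      by (simp add: o_def lin algebra_simps)
  next
    fix r assume r: "t\<^sub>0 \<le> r" "r \<le> t\<^sub>1"
    then have r0: "0 \<le> r" using t by simp
    show "norm (- ?S r (?N (v r) - ?N (u r))) \<le> L"
      using dN[OF r0 r(2) in_s(2)[OF r0] e(1)[OF r0 r(2)]] by simp
    show "norm (imult (?S r (?N (z r) - ?N (u r)))) \<le> L"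
      using dN[OF r0 r(2) in_s(3)[OF r0] e(2)[OF r0 r(2)]]
      by (simp add: norm_eq_sqrt_inner inner_imult inner_schroedinger_group)
    let ?a = "v r - u r" and ?b = "z r - u r"
    have ab: "?a \<in> sobolev s" "?b \<in> sobolev s" by (intro sobolev_diff(1) in_s r0)+
    \<comment> \<open>Both the group and \<open>imult\<close> preserve the inner product, so the
      dispersive part drops out and only the asymmetry of the nonlinearity remains.\<close>
    have eq: "inner (- ?S r (?N (v r) - ?N (u r))) (?S r ?b) + inner (imult (?S r ?a)) (imult (?S r (?N (z r) - ?N (u r))))
       = - (inner (?N (u r + ?a) - ?N (u r)) ?b - inner (?N (u r + ?b) - ?N (u r)) ?a)"
      by (simp add: inner_imult inner_schroedinger_group inner_commute[of _ "v r - u r"])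
    have "\<bar>inner (?N (u r + ?a) - ?N (u r)) ?b - inner (?N (u r + ?b) - ?N (u r)) ?a\<bar>
       \<le> ?C * (2 * (K * e)) * (norm ?a * norm ?b)"
    proof (rule nonlinearity_symmetric[OF \<sigma> B(2)])
      show "AE x in lborel. cmod (rep_L2 (u r) x) \<le> B"
        using bd[OF in_s(1)[OF r0] N[OF r0 r(2)]] by eventually_elim (use B(1) in linarith)
    qed (intro bd ab e r0 r)+
    also have "\<dots> \<le> ?C * (2 * (K * e)) * (e * e)"
    proof (rule mult_left_mono)
      show "norm ?a * norm ?b \<le> e * e"
        by (intro mult_mono order_trans[OF norm_le_sobolev_norm[OF ab(1) s] e(1)[OF r0 r(2)]]
            order_trans[OF norm_le_sobolev_norm[OF ab(2) s] e(2)[OF r0 r(2)]] e0 norm_ge_zero)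
      show "0 \<le> ?C * (2 * (K * e))" using K(1) e0 by (intro mult_nonneg_nonneg[OF C0]) simp
    qed
    finally show "\<bar>inner (- ?S r (?N (v r) - ?N (u r))) (?S r ?b) + inner (imult (?S r ?a)) (imult (?S r (?N (z r) - ?N (u r))))\<bar>
       \<le> ?C * (2 * (K * e)) * (e * e)" unfolding eq by simp
  qed (rule L0)
  then show ?thesis
    by (simp only: schroedinger_group_imult[symmetric] inner_schroedinger_group)
qed

lemma flow_symplectic:
  assumes \<sigma>: "0 < \<sigma>" "\<sigma> \<le> 2" and s: "1 \<le> s" and t: "0 \<le> t\<^sub>0" "t\<^sub>0 \<le> t\<^sub>1"
    and \<phi>: "\<And>u\<^sub>0. u\<^sub>0 \<in> sobolev s \<Longrightarrow> mild_solution \<sigma> s w u\<^sub>0 (\<phi> u\<^sub>0)"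
    and u\<^sub>0: "u\<^sub>0 \<in> sobolev s" and D: "flow_differential s \<phi> u\<^sub>0 D"
    and \<xi>: "\<xi> \<in> sobolev s" and \<eta>: "\<eta> \<in> sobolev s"
  shows "symplectic_structure D t\<^sub>1 \<xi> \<eta> = symplectic_structure D t\<^sub>0 \<xi> \<eta>"
proof -
  have T: "0 \<le> t\<^sub>1" and s0: "0 \<le> s" using t s by auto
  obtain K where K: "K > 0" "\<And>f. f \<in> sobolev s \<Longrightarrow> AE x in lborel. cmod (rep_L2 f x) \<le> K * sobolev_norm s f"
    using sobolev_embedding[OF s] by blast
  obtain N where N: "\<And>t. 0 \<le> t \<Longrightarrow> t \<le> t\<^sub>1 \<Longrightarrow> sobolev_norm s (\<phi> u\<^sub>0 t) \<le> N"
    using sobolev_path_bounded[of s "\<phi> u\<^sub>0" t\<^sub>1] \<phi>[OF u\<^sub>0] unfolding mild_solution_def by blast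
  let ?a = "\<lambda>\<xi> h t. \<phi> (u\<^sub>0 + h *\<^sub>R \<xi>) t - \<phi> u\<^sub>0 t"
  obtain M\<^sub>1 where M\<^sub>1: "\<forall>\<^sub>F h in at 0. \<forall>t\<in>{0..t\<^sub>1}. sobolev_norm s (?a \<xi> h t) \<le> \<bar>h\<bar> * M\<^sub>1"
    using flow_differential_difference_bound[OF \<phi> u\<^sub>0 D \<xi> T] by blast
  obtain M\<^sub>2 where M\<^sub>2: "\<forall>\<^sub>F h in at 0. \<forall>t\<in>{0..t\<^sub>1}. sobolev_norm s (?a \<eta> h t) \<le> \<bar>h\<bar> * M\<^sub>2"
    using flow_differential_difference_bound[OF \<phi> u\<^sub>0 D \<eta> T] by blast
  define M where "M = max 0 (max M\<^sub>1 M\<^sub>2)"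
  have uh: "u\<^sub>0 + h *\<^sub>R \<zeta> \<in> sobolev s" if "\<zeta> \<in> sobolev s" for h \<zeta> by (intro sobolev_add(1) sobolev_scaleR(1) u\<^sub>0 that)
  have in_s: "\<phi> v t \<in> sobolev s" if "v \<in> sobolev s" "0 \<le> t" for v t
    using \<phi>[OF that(1)] that(2) by (simp add: mild_solution_def sobolev_path_def)
  \<comment> \<open>For \<open>\<bar>h\<bar> \<le> 1\<close> this bounds the base solution and all
    increments in sup norm, so that the constant \<open>C\<close> below is independent of
    \<open>h\<close>.\<close>
  define B where "B = K * N + K * M"
  have N0: "0 \<le> N" using N[of 0] T sobolev_norm_nonneg[of s "\<phi> u\<^sub>0 0"] by simp
  have M0: "0 \<le> M" by (simp add: M_def)
  define C where "C = (1 + 3 * B + 11 * B\<^sup>2 + 15 * B ^ 3) * (B + 1) * (2 * (K * M)) * (M * M) * (t\<^sub>1 - t\<^sub>0)"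
  let ?\<omega> = "\<lambda>h t. inner (imult ((1 / h) *\<^sub>R ?a \<xi> h t)) ((1 / h) *\<^sub>R ?a \<eta> h t)"
  have small: "\<forall>\<^sub>F h in at (0::real). \<bar>h\<bar> \<le> 1"
    by (rule eventually_at_ball'[of 1, THEN eventually_mono]) auto
  \<comment> \<open>The form of the increments changes by at most
    \<open>\<bar>h\<bar> * h\<^sup>2 * C\<close>; normalising both arguments by \<open>1 / h\<close>
    divides by \<open>h\<^sup>2\<close> and leaves one factor.\<close>
  have bound: "\<forall>\<^sub>F h in at 0. norm (?\<omega> h t\<^sub>1 - ?\<omega> h t\<^sub>0) \<le> \<bar>h\<bar> * C"
    using M\<^sub>1 M\<^sub>2 small eventually_neq_at_within[of 0 0 UNIV]
  proof eventually_elim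
    case (elim h)
    have e: "\<bar>h\<bar> * M\<^sub>1 \<le> \<bar>h\<bar> * M" "\<bar>h\<bar> * M\<^sub>2 \<le> \<bar>h\<bar> * M" by (intro mult_left_mono; simp add: M_def)+
    have "K * (\<bar>h\<bar> * M) \<le> K * M"
      using elim(3) M0 K(1) by (intro mult_left_mono mult_left_le_one_le) auto
    moreover have "0 \<le> K * N" "0 \<le> K * M" using K(1) N0 M0 by simp_all
    ultimately have KB: "K * N \<le> B" "K * (\<bar>h\<bar> * M) \<le> B"
      unfolding B_def by linarith+
    have est: "\<bar>inner (imult (?a \<xi> h t\<^sub>1)) (?a \<eta> h t\<^sub>1) - inner (imult (?a \<xi> h t\<^sub>0)) (?a \<eta> h t\<^sub>0)\<bar>
       \<le> (1 + 3 * B + 11 * B\<^sup>2 + 15 * B ^ 3) * (B + 1) * (2 * (K * (\<bar>h\<bar> * M))) * ((\<bar>h\<bar> * M) * (\<bar>h\<bar> * M)) * (t\<^sub>1 - t\<^sub>0)"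
    proof (rule symplectic_difference_bound[OF \<sigma> s0 t \<phi>[OF u\<^sub>0] \<phi>[OF uh[OF \<xi>]] \<phi>[OF uh[OF \<eta>]] less_imp_le[OF K(1)] K(2) N _ _ KB])
      show "sobolev_norm s (?a \<xi> h t) \<le> \<bar>h\<bar> * M" if "0 \<le> t" "t \<le> t\<^sub>1" for t
        using elim(1) that e(1) by (meson atLeastAtMost_iff order_trans)
      show "sobolev_norm s (?a \<eta> h t) \<le> \<bar>h\<bar> * M" if "0 \<le> t" "t \<le> t\<^sub>1" for t
        using elim(2) that e(2) by (meson atLeastAtMost_iff order_trans)
    qed
    have hC: "(1 + 3 * B + 11 * B\<^sup>2 + 15 * B ^ 3) * (B + 1) * (2 * (K * (\<bar>h\<bar> * M))) * ((\<bar>h\<bar> * M) * (\<bar>h\<bar> * M)) * (t\<^sub>1 - t\<^sub>0)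
       = \<bar>h\<bar> * (\<bar>h\<bar> * \<bar>h\<bar>) * C"
      unfolding C_def by (simp only: mult_ac)
    have *: "\<bar>inner (imult (?a \<xi> h t\<^sub>1)) (?a \<eta> h t\<^sub>1) - inner (imult (?a \<xi> h t\<^sub>0)) (?a \<eta> h t\<^sub>0)\<bar> \<le> \<bar>h\<bar> * h\<^sup>2 * C"
      using est unfolding hC by (simp add: power2_eq_square)
    have \<omega>: "?\<omega> h t = inner (imult (?a \<xi> h t)) (?a \<eta> h t) / h\<^sup>2" for t
      by (simp add: linear_scale[OF linear_imult] power2_eq_square)
    show ?case
      using * elim(4) unfolding \<omega> by (simp add: diff_divide_distrib[symmetric] divide_le_eq mult_ac)
  qed
  \<comment> \<open>Sobolev convergence of the quotients is weakened to convergence in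
    \<open>L2\<close>, in which the form is continuous.\<close>
  have tend: "((\<lambda>h. (1 / h) *\<^sub>R ?a \<zeta> h t) \<longlongrightarrow> D \<zeta> t) (at 0)" if \<zeta>: "\<zeta> \<in> sobolev s" and tt: "0 \<le> t" "t \<le> t\<^sub>1" for \<zeta> t
  proof -
    have "uniform_limit {0..t\<^sub>1} (\<lambda>h t. sobolev_norm s ((1 / h) *\<^sub>R ?a \<zeta> h t - D \<zeta> t)) (\<lambda>t. 0) (at 0)"
      using D \<zeta> T by (simp add: flow_differential_def)
    from tendsto_uniform_limitI[OF this, of t] tt
    have "((\<lambda>h. sobolev_norm s ((1 / h) *\<^sub>R ?a \<zeta> h t - D \<zeta> t)) \<longlongrightarrow> 0) (at 0)" by simp
    moreover have "D \<zeta> t \<in> sobolev s" using D \<zeta> tt by (simp add: flow_differential_def)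
    then have "norm ((1 / h) *\<^sub>R ?a \<zeta> h t - D \<zeta> t) \<le> sobolev_norm s ((1 / h) *\<^sub>R ?a \<zeta> h t - D \<zeta> t)" for h
      by (intro norm_le_sobolev_norm s0 sobolev_diff(1) sobolev_scaleR(1) in_s uh \<zeta> u\<^sub>0 tt)
    ultimately show ?thesis
      by - (rule LIM_zero_cancel, rule Lim_null_comparison[OF always_eventually[OF allI]])
  qed
  have \<omega>: "((\<lambda>h. ?\<omega> h t) \<longlongrightarrow> symplectic_structure D t \<xi> \<eta>) (at 0)" if "0 \<le> t" "t \<le> t\<^sub>1" for t
    unfolding symplectic_structure_eq
    by (intro tendsto_inner tendsto_pointwise_mult[where K = 1] tend \<xi> \<eta> that) auto
  have "((\<lambda>h. \<bar>h\<bar> * C) \<longlongrightarrow> \<bar>0\<bar> * C) (at 0)" by (intro tendsto_intros)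
  then have "((\<lambda>h. ?\<omega> h t\<^sub>1 - ?\<omega> h t\<^sub>0) \<longlongrightarrow> 0) (at 0)"
    using Lim_null_comparison[OF bound] by simp
  moreover have "((\<lambda>h. ?\<omega> h t\<^sub>1 - ?\<omega> h t\<^sub>0) \<longlongrightarrow> symplectic_structure D t\<^sub>1 \<xi> \<eta> - symplectic_structure D t\<^sub>0 \<xi> \<eta>) (at 0)"
    using t by (intro tendsto_diff \<omega>) auto
  ultimately have "0 = symplectic_structure D t\<^sub>1 \<xi> \<eta> - symplectic_structure D t\<^sub>0 \<xi> \<eta>"
    by (rule tendsto_unique[rotated]) simp
  then show ?thesis by simp
qed

text \<open>The exceptional null set is the one of \<open>solution_flow\<close>. Off it,
  \<open>flow_symplectic\<close> is applied to the single path, so the same null set serves all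
  data, derivatives and directions.\<close>

theorem theorem2p2:
  fixes M :: "'w measure" and F :: "real \<Rightarrow> 'w measure" and W :: "real \<Rightarrow> 'w \<Rightarrow> real"
    and \<Phi> :: "'w \<Rightarrow> L2 \<Rightarrow> real \<Rightarrow> L2" and \<sigma> :: nat and s t\<^sub>0 t\<^sub>1 :: real
  assumes "brownian_motion M F W"
    and "0 < \<sigma>" and "\<sigma> \<le> 2" and "1 \<le> s"
    and "solution_flow M W \<sigma> s \<Phi>"
    and "0 \<le> t\<^sub>0" and "t\<^sub>0 \<le> t\<^sub>1"
  shows "AE \<omega> in M. \<forall>u\<^sub>0\<in>sobolev s. \<forall>D. flow_differential s (\<Phi> \<omega>) u\<^sub>0 D \<longrightarrow>
    (\<forall>\<xi>\<in>sobolev s. \<forall>\<eta>\<in>sobolev s.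
       symplectic_structure D t\<^sub>1 \<xi> \<eta> = symplectic_structure D t\<^sub>0 \<xi> \<eta>)"
  using assms(5) unfolding solution_flow_def
proof eventually_elim
  case (elim \<omega>)
  then show ?case using flow_symplectic[OF assms(2,3,4,6,7)] by blast
qed

end
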